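(* Let $d\in\mathbb{N}$ and let $X=\{x_1,\dots,x_{|X|}\}\subset\mathbb{R}^d$ be a finite set of pairwise distinct points with separation distance $q_X$. Let $\lambda_{\min}(-\Delta)$ be the smallest eigenvalue of the Dirichlet Laplace operator on the ball $B_{1/2}(0)\subset\mathbb{R}^d$ and set $c_0:=\sqrt{2}\,\lambda_{\min}^{1/2}(-\Delta)$. Let $$c_1:=\frac{\pi^{d/2}}{2\,\lambda_{\min}^{d/2}(-\Delta)}>0,\qquad c_2:=\left(\frac{2}{\pi}\right)^{d/2}\frac{1}{\beta}>0,$$ with $\beta>0$ the constant defined in the context; $c_1,c_2$ depend only on $d$. Then for any $R\ge \frac{c_0}{q_X}$, any $x_0\in\mathbb{R}^d$ and any $\alpha=(\alpha_j)_{j=1}^{|X|}\in\mathbb{R}^{|X|}$, $$c_1R^d\,\Vert\alpha\Vert^2\le\int_{B_R(x_0)}\left|\sum_{j=1}^{|X|}\alpha_je^{i\omega^\top x_j}\right|^2\,\mathrm{d}\omega\le c_2R^d\,\Vert\alpha\Vert^2 .$$ Moreover, the second inequality already holds for all $R\ge\frac{\pi}{q_X}$.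
   Context: $\Vert\cdot\Vert$ is the Euclidean norm and $B_R(x_0)\subset\mathbb{R}^d$ is the ball of radius $R$ centered at $x_0$. The separation distance of a finite set $X$ (with at least two points) is $q_X:=\min_{x_i\ne x_j\in X}\Vert x_i-x_j\Vert$. Let $H$ be the positive eigenfunction of $-\Delta$ in $H_0^1(B_{1/2}(0))$ belonging to the smallest eigenvalue $\lambda_{\min}(-\Delta)$, normalized by $\Vert H\Vert_{L^2(B_{1/2}(0))}=1$ and extended by zero to $\mathbb{R}^d$. Let $h$ be its Fourier transform, $h(\omega)=(2\pi)^{-d/2}\int_{\mathbb{R}^d}H(x)e^{-i\omega^\top x}\,\mathrm{d}x$ (which is real-valued, as $H$ is even). The constant $\beta$ is $\beta:=(2\pi)^{d/2}\left[\min_{\omega\in B_\pi(0)}h(\omega)\right]^2$, with the minimum over the closed ball; it is positive. *)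

theory Defs
  imports "HOL-Analysis.Analysis"
begin

section \<open>The Sobolev space \<open>H\<^sub>0\<^sup>1\<close> and the Dirichlet Laplacian\<close>

primrec C_k :: "nat \<Rightarrow> ('a::euclidean_space \<Rightarrow> real) \<Rightarrow> bool" where
  "C_k 0 f \<longleftrightarrow> continuous_on UNIV f"
| "C_k (Suc k) f \<longleftrightarrow> (\<forall>x. f differentiable (at x)) \<and>
     (\<forall>b\<in>Basis. C_k k (\<lambda>x. frechet_derivative f (at x) b))"

definition test_function :: "'a::euclidean_space set \<Rightarrow> ('a \<Rightarrow> real) \<Rightarrow> bool" where
  "test_function \<Omega> \<phi> \<longleftrightarrow> (\<forall>k. C_k k \<phi>) \<and>
     compact (closure {x. \<phi> x \<noteq> 0}) \<and> closure {x. \<phi> x \<noteq> 0} \<subseteq> \<Omega>"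

definition grad :: "('a::euclidean_space \<Rightarrow> real) \<Rightarrow> 'a \<Rightarrow> 'a" where
  "grad f x = (\<Sum>b\<in>Basis. frechet_derivative f (at x) b *\<^sub>R b)"

definition square_integrable :: "('a::euclidean_space \<Rightarrow> 'b::euclidean_space) \<Rightarrow> bool" where
  "square_integrable f \<longleftrightarrow> f \<in> borel_measurable lborel \<and>
     integrable lborel (\<lambda>x. (norm (f x))\<^sup>2)"

(* H_0^1(\<Omega>) is the closure of the test functions in the Sobolev norm.  Its elements are
   represented by functions on the whole space that vanish outside \<Omega>, together with their weak
   gradient G (determined by u up to a null set). *)
definition H01 :: "'a::euclidean_space set \<Rightarrow> ('a \<Rightarrow> real) \<Rightarrow> ('a \<Rightarrow> 'a) \<Rightarrow> bool" where
  "H01 \<Omega> u G \<longleftrightarrow> square_integrable u \<and> square_integrable G \<and> (\<forall>x. x \<notin> \<Omega> \<longrightarrow> u x = 0) \<and>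
     (\<exists>\<phi>. (\<forall>n::nat. test_function \<Omega> (\<phi> n)) \<and>
        (\<lambda>n. LINT x|lborel. (\<phi> n x - u x)\<^sup>2) \<longlonglongrightarrow> 0 \<and>
        (\<lambda>n. LINT x|lborel. (norm (grad (\<phi> n) x - G x))\<^sup>2) \<longlonglongrightarrow> 0)"

(* u is an eigenfunction of the operator -\<Delta> on H_0^1(\<Omega>), which is defined by its quadratic form *)
definition dirichlet_eigenfunction ::
  "'a::euclidean_space set \<Rightarrow> real \<Rightarrow> ('a \<Rightarrow> real) \<Rightarrow> bool" where
  "dirichlet_eigenfunction \<Omega> \<mu> u \<longleftrightarrow> \<not> (AE x in lborel. u x = 0) \<and>
     (\<exists>G. H01 \<Omega> u G \<and>
        (\<forall>v K. H01 \<Omega> v K \<longrightarrow>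
           (LINT x|lborel. G x \<bullet> K x) = \<mu> * (LINT x|lborel. u x * v x)))"

definition dirichlet_eigenvalue :: "'a::euclidean_space set \<Rightarrow> real \<Rightarrow> bool" where
  "dirichlet_eigenvalue \<Omega> \<mu> \<longleftrightarrow> (\<exists>u. dirichlet_eigenfunction \<Omega> \<mu> u)"

definition dirichlet_lambda_min :: "'a::euclidean_space set \<Rightarrow> real" where
  "dirichlet_lambda_min \<Omega> = (LEAST \<mu>. dirichlet_eigenvalue \<Omega> \<mu>)"

definition positive_ground_state :: "'a::euclidean_space set \<Rightarrow> ('a \<Rightarrow> real) \<Rightarrow> bool" where
  "positive_ground_state \<Omega> u \<longleftrightarrow> dirichlet_eigenfunction \<Omega> (dirichlet_lambda_min \<Omega>) u \<and>
     (\<forall>x\<in>\<Omega>. 0 < u x) \<and> (LINT x|lborel. (u x)\<^sup>2) = 1"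


section \<open>The constants\<close>

text \<open>All of the following depend only on the type \<open>'a\<close>, that is, on the dimension.\<close>

definition lambda_min :: "'a::euclidean_space itself \<Rightarrow> real" where
  "lambda_min _ = dirichlet_lambda_min (ball (0::'a) (1/2))"

(* The ground state of the ball is unique up to a null set; the choice only fixes a representative,
   and only integrals of it are used. *)
definition ground_state :: "'a::euclidean_space \<Rightarrow> real" where
  "ground_state = (SOME u. positive_ground_state (ball 0 (1/2)) u)"

definition fourier :: "('a::euclidean_space \<Rightarrow> complex) \<Rightarrow> 'a \<Rightarrow> complex" where
  "fourier f \<omega> = complex_of_real ((2 * pi) powr (- (real DIM('a) / 2))) *
     (LINT x|lborel. f x * exp (- (\<i> * complex_of_real (\<omega> \<bullet> x))))"

(* The Fourier transform is real-valued here, since the ground state is even. *)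
definition ground_state_fourier :: "'a::euclidean_space \<Rightarrow> real" where
  "ground_state_fourier \<omega> = Re (fourier (\<lambda>x. complex_of_real (ground_state x)) \<omega>)"

(* The infimum is a minimum, since the Fourier transform is continuous and the ball is compact. *)
definition ingham_beta :: "'a::euclidean_space itself \<Rightarrow> real" where
  "ingham_beta _ = (2 * pi) powr (real DIM('a) / 2) *
     (INF \<omega>\<in>cball (0::'a) pi. ground_state_fourier \<omega>)\<^sup>2"

definition ingham_c0 :: "'a::euclidean_space itself \<Rightarrow> real" where
  "ingham_c0 T = sqrt 2 * lambda_min T powr (1/2)"

definition ingham_c1 :: "'a::euclidean_space itself \<Rightarrow> real" where
  "ingham_c1 T = pi powr (real DIM('a) / 2) / (2 * lambda_min T powr (real DIM('a) / 2))"

definition ingham_c2 :: "'a::euclidean_space itself \<Rightarrow> real" where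
  "ingham_c2 T = (2 / pi) powr (real DIM('a) / 2) * (1 / ingham_beta T)"


section \<open>Separation distance and exponential sums\<close>

definition separation_distance :: "'a::euclidean_space set \<Rightarrow> real" where
  "separation_distance X = Min {norm (x - y) |x y. x \<in> X \<and> y \<in> X \<and> x \<noteq> y}"

definition exp_sum ::
  "nat \<Rightarrow> (nat \<Rightarrow> 'a::euclidean_space) \<Rightarrow> (nat \<Rightarrow> real) \<Rightarrow> 'a \<Rightarrow> complex" where
  "exp_sum N x \<alpha> \<omega> = (\<Sum>j=1..N. complex_of_real (\<alpha> j) * exp (\<i> * complex_of_real (\<omega> \<bullet> x j)))"

end

theory Submission
  imports Defs "HOL-Probability.Characteristic_Functions"
begin

text \<open>
  For points \<open>y j\<close> at mutual distance at least 1, put \<open>T(\<tau>) = \<Sum> a j exp (i \<tau> \<bullet> y j)\<close>.  If \<open>u\<close> is supported in the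
  ball of radius \<open>1/2\<close> and has Fourier transform \<open>U\<close>, then \<open>T U\<close> is the Fourier transform of
  \<open>\<Sum> a j u(x + y j)\<close>, a sum of functions with disjoint supports.  Plancherel's identity therefore gives the exact
  values \<open>(2 \<pi>)\<^sup>d \<Vert>a\<Vert>\<^sup>2 \<Vert>u\<Vert>\<^sup>2\<close> for the integral of \<open>|T|\<^sup>2 |U|\<^sup>2\<close> over the whole space, and
  \<open>(2 \<pi>)\<^sup>d \<Vert>a\<Vert>\<^sup>2 \<Vert>grad u\<Vert>\<^sup>2\<close> for that of \<open>|\<tau>|\<^sup>2 |T|\<^sup>2 |U|\<^sup>2\<close>.  Take for \<open>u\<close> the ground state, so that
  \<open>\<Vert>u\<Vert> = 1\<close> and \<open>\<Vert>grad u\<Vert>\<^sup>2 = \<lambda>\<close>.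

  Upper inequality (\<open>unit_separated_upper\<close>): on the ball of radius \<open>\<pi>\<close> the real part of \<open>U\<close> is bounded below by a
  positive constant, because \<open>cos (\<omega> \<bullet> x) > 0\<close> for \<open>|\<omega>| \<le> \<pi>\<close> and \<open>|x| < 1/2\<close>; so the integral of \<open>|T|\<^sup>2\<close> over
  this ball is controlled by the first identity.

  Lower inequality (\<open>unit_separated_lower\<close>): let \<open>c\<^sup>2 = 2 \<lambda>\<close>.  The weight \<open>c\<^sup>2 - |\<tau>|\<^sup>2\<close> is nonpositive off the
  ball of radius \<open>c\<close>, so the integral of \<open>(c\<^sup>2 - |\<tau>|\<^sup>2) |T|\<^sup>2 |U|\<^sup>2\<close> over that ball is at least the one over the whole
  space, \<open>(2 \<pi>)\<^sup>d \<Vert>a\<Vert>\<^sup>2 (2 \<lambda> - \<lambda>)\<close>.  It is at most \<open>2 \<lambda>\<close> times the integral of \<open>|T|\<^sup>2\<close>, since \<open>|U|\<close> is at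
  most 1 by the Cauchy-Schwarz inequality, the ball of radius \<open>1/2\<close> having volume at most 1.

  Points with separation \<open>q\<close> are rescaled by \<open>R / \<rho>\<close>, where \<open>\<rho>\<close> is the radius \<open>\<pi>\<close> or \<open>c\<close>; they are at distance at
  least 1 as soon as \<open>R \<ge> \<rho> / q\<close>.  As \<open>\<lambda> \<ge> \<pi>\<^sup>2\<close> by comparison with a cosine in one coordinate (\<open>dirichlet_lower_bound_cosine\<close>), the radius \<open>c = c\<^sub>0\<close> is at least \<open>\<pi>\<close>, and the upper inequality holds
  wherever the lower one does.

  Plancherel's identity is used for continuous functions of compact support only, as a limit of integrals with Gaussian
  weights (\<open>plancherel_limit\<close>).  The ground state is reached through test functions that converge to it in the
  Sobolev norm, which suffices because on a bounded set their Fourier transforms converge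
  (\<open>H01_weighted_limit\<close>).

  That there is a least Dirichlet eigenvalue with a positive eigenfunction is shown by an explicit formula instead of a
  compactness argument.  Let \<open>z\<close> be the first zero of the normalized Bessel function \<open>bessel (d / 2)\<close>; it exists because a
  positive solution of the corresponding Riccati equation blows up (\<open>bessel_not_positive\<close>).  Then
  \<open>u(x) = bessel (d / 2) (4 z |x|\<^sup>2)\<close> is positive in the ball, vanishes on its boundary, and has Laplacian \<open>- 16 z u\<close>.
  Smooth cutoffs show that it belongs to the Sobolev space (\<open>H01_radial_bessel\<close>), so \<open>16 z\<close> is an eigenvalue.  No eigenvalue
  is smaller, since inserting \<open>\<phi>\<^sup>2 / u\<close> into Green's identity gives \<open>16 z \<Vert>\<phi>\<Vert>\<^sup>2 \<le> \<Vert>grad \<phi>\<Vert>\<^sup>2\<close> for every test function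
  (\<open>dirichlet_lower_bound\<close>).
\<close>

section \<open>Derivatives integrate to zero\<close>

lemma integrable_continuous_bounded_support:
  fixes f :: "'a::euclidean_space \<Rightarrow> 'b::euclidean_space"
  assumes "continuous_on UNIV f" and "\<And>x. r \<le> norm x \<Longrightarrow> f x = 0"
  shows "integrable lborel f"
proof -
  have "integrable lborel (\<lambda>x. indicator (cball 0 r) x *\<^sub>R f x)"
    by (intro borel_integrable_compact continuous_on_subset[OF assms(1)]) auto
  moreover have "(\<lambda>x. indicator (cball 0 r) x *\<^sub>R f x) = f"
    using assms(2) by (fastforce simp: indicator_def)
  ultimately show ?thesis by simp
qed

lemma bounded_continuous_bounded_support:
  fixes f :: "'a::euclidean_space \<Rightarrow> 'b::euclidean_space"
  assumes "continuous_on UNIV f" and "\<And>x. r \<le> norm x \<Longrightarrow> f x = 0"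
  obtains M where "M \<ge> 0" "\<And>x. norm (f x) \<le> M"
proof -
  have "compact (f ` cball 0 r)"
    by (intro compact_continuous_image continuous_on_subset[OF assms(1)]) auto
  then obtain M where M: "\<And>y. y \<in> f ` cball 0 r \<Longrightarrow> norm y \<le> M"
    using compact_imp_bounded bounded_iff by metis
  have "norm (f x) \<le> max 0 M" for x
    using M[of "f x"] assms(2)[of x] by (cases "norm x \<le> r") (auto simp: le_max_iff_disj)
  then show ?thesis by (intro that[of "max 0 M"]) auto
qed

lemma lborel_integral_affine:
  fixes f :: "'a::euclidean_space \<Rightarrow> 'b::{banach, second_countable_topology}"
  assumes [measurable]: "f \<in> borel_measurable borel" and "c > 0"
  shows "(LINT x|lborel. f x) = c ^ DIM('a) *\<^sub>R (LINT x|lborel. f (t + c *\<^sub>R x))"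
proof -
  have "(LINT x|lborel. f x) =
      (LINT x|density (distr lborel borel (\<lambda>x. t + c *\<^sub>R x)) (\<lambda>_. ennreal (\<bar>c\<bar> ^ DIM('a))). f x)"
    using assms lborel_affine[of c t] by simp
  also have "\<dots> = (LINT x|distr lborel borel (\<lambda>x. t + c *\<^sub>R x). (\<bar>c\<bar> ^ DIM('a)) *\<^sub>R f x)"
    by (subst integral_density) auto
  also have "\<dots> = (LINT x|lborel. (\<bar>c\<bar> ^ DIM('a)) *\<^sub>R f (t + c *\<^sub>R x))"
    by (subst integral_distr) auto
  finally show ?thesis using assms by simp
qed

lemma lborel_integral_translate:
  fixes f :: "'a::euclidean_space \<Rightarrow> 'b::{banach, second_countable_topology}"
  assumes "f \<in> borel_measurable borel"
  shows "(LINT x|lborel. f (t + x)) = (LINT x|lborel. f x)"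
  using lborel_integral_affine[OF assms, of 1 t] by simp

text \<open>
  Translation invariance of the Lebesgue measure makes every difference quotient of \<open>f\<close> integrate to
  zero.  By the mean value inequality the quotients are bounded, uniformly on a fixed ball outside of which they
  vanish, so dominated convergence carries the zero over to the derivative.
\<close>
lemma integral_directional_derivative_eq_0:
  fixes f :: "'a::euclidean_space \<Rightarrow> 'b::euclidean_space"
  assumes der: "\<And>x. (f has_derivative D x) (at x)"
    and cont: "continuous_on UNIV (\<lambda>x. D x b)"
    and supp: "\<And>x. r \<le> norm x \<Longrightarrow> f x = 0"
    and b: "norm b = 1"
  shows "(LINT x|lborel. D x b) = 0"
proof -
  have contf: "continuous_on UNIV f"
    using der by (meson continuous_at_imp_continuous_on has_derivative_continuous)
  then have [measurable]: "f \<in> borel_measurable borel"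
    by (rule borel_measurable_continuous_onI)
  have intf: "integrable lborel f"
    by (rule integrable_continuous_bounded_support[OF contf supp])
  have [measurable]: "(\<lambda>x. D x b) \<in> borel_measurable borel"
    using cont by (rule borel_measurable_continuous_onI)
  have "compact ((\<lambda>x. D x b) ` cball 0 (\<bar>r\<bar>+2))"
    by (intro compact_continuous_image continuous_on_subset[OF cont]) auto
  then obtain M where M: "\<And>x. x \<in> cball 0 (\<bar>r\<bar>+2) \<Longrightarrow> norm (D x b) \<le> M"
    using compact_imp_bounded bounded_iff by (metis imageI)
  define h where "h n = 1 / real (Suc n)" for n
  have h: "h n > 0" "h n \<le> 1" for n by (auto simp: h_def)
  have hlim: "h \<longlonglongrightarrow> 0" unfolding h_def by (rule LIMSEQ_Suc[OF lim_const_over_n])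
  define q where "q n x = (1 / h n) *\<^sub>R (f (h n *\<^sub>R b + x) - f x)" for n x
  have derline: "((\<lambda>t. f (t *\<^sub>R b + x)) has_vector_derivative D (t *\<^sub>R b + x) b) (at t)" for t x
  proof -
    have 1: "((\<lambda>t. t *\<^sub>R b + x) has_derivative (\<lambda>t. t *\<^sub>R b)) (at t)"
      by (auto intro!: derivative_eq_intros)
    have lin: "linear (D (t *\<^sub>R b + x))" using der has_derivative_linear by blast
    have "((\<lambda>t. f (t *\<^sub>R b + x)) has_derivative (\<lambda>s. D (t *\<^sub>R b + x) (s *\<^sub>R b))) (at t)"
      using has_derivative_compose[OF 1 der] by (simp add: o_def)
    then show ?thesis unfolding has_vector_derivative_def using lin
      by (simp add: linear_cmul)
  qed
  have q_lim: "(\<lambda>n. q n x) \<longlonglongrightarrow> D x b" for x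
  proof -
    have "((\<lambda>t. f (t *\<^sub>R b + x)) has_vector_derivative D x b) (at 0)"
      using derline[of x 0] by simp
    then have "(\<lambda>t. norm (f (t *\<^sub>R b + x) - f x - t *\<^sub>R D x b) / norm t) \<midarrow>0\<rightarrow> 0"
      by (simp add: has_vector_derivative_def has_derivative_at)
    moreover have "\<forall>\<^sub>F t in at 0. norm (f (t *\<^sub>R b + x) - f x - t *\<^sub>R D x b) / norm t
        = norm ((1/t) *\<^sub>R (f (t *\<^sub>R b + x) - f x) - D x b)"
    proof (rule eventually_at_topological[THEN iffD2, OF exI[of _ UNIV]], safe)
      fix t :: real assume "t \<noteq> 0"
      then have "(1/t) *\<^sub>R (f (t *\<^sub>R b + x) - f x) - D x b
          = (1/t) *\<^sub>R (f (t *\<^sub>R b + x) - f x - t *\<^sub>R D x b)"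
        by (simp add: scaleR_diff_right)
      then show "norm (f (t *\<^sub>R b + x) - f x - t *\<^sub>R D x b) / norm t
        = norm ((1/t) *\<^sub>R (f (t *\<^sub>R b + x) - f x) - D x b)" by simp
    qed auto
    ultimately have "((\<lambda>t. norm ((1/t) *\<^sub>R (f (t *\<^sub>R b + x) - f x) - D x b)) \<longlongrightarrow> 0) (at 0)"
      by (rule Lim_transform_eventually)
    then have "((\<lambda>t. (1/t) *\<^sub>R (f (t *\<^sub>R b + x) - f x) - D x b) \<longlongrightarrow> 0) (at 0)"
      by (rule tendsto_norm_zero_cancel)
    then have "((\<lambda>t. (1/t) *\<^sub>R (f (t *\<^sub>R b + x) - f x)) \<longlongrightarrow> D x b) (at 0)"
      by (rule LIM_zero_cancel)
    moreover have "filterlim h (at 0) sequentially"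
      using hlim h by (auto simp: filterlim_at less_imp_neq[symmetric] intro!: always_eventually)
    ultimately show ?thesis unfolding q_def
      using filterlim_compose[of "\<lambda>t. (1/t) *\<^sub>R (f (t *\<^sub>R b + x) - f x)"] by auto
  qed
  have q_bd: "norm (q n x) \<le> M * indicator (cball 0 (\<bar>r\<bar>+1)) x" for n x
  proof (cases "x \<in> cball 0 (\<bar>r\<bar>+1)")
    case True
    have "\<exists>s\<in>{0<..<h n}. norm (f (h n *\<^sub>R b + x) - f (0 *\<^sub>R b + x))
            \<le> norm ((h n - 0) *\<^sub>R D (s *\<^sub>R b + x) b)"
    proof (rule mvt_general[of 0 "h n" "\<lambda>s. f (s *\<^sub>R b + x)" "\<lambda>s t. t *\<^sub>R D (s *\<^sub>R b + x) b", OF h(1)])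
      show "continuous_on {0..h n} (\<lambda>s. f (s *\<^sub>R b + x))"
        using derline by (meson continuous_at_imp_continuous_on has_vector_derivative_continuous)
    qed (use derline in \<open>auto simp: has_vector_derivative_def\<close>)
    then obtain s where s: "0 < s" "s < h n"
      "norm (f (h n *\<^sub>R b + x) - f x) \<le> norm (h n *\<^sub>R D (s *\<^sub>R b + x) b)" by auto
    have "norm (s *\<^sub>R b + x) \<le> \<bar>r\<bar>+2"
      using norm_triangle_ineq[of "s *\<^sub>R b" x] s h[of n] b True by auto
    then have "norm (D (s *\<^sub>R b + x) b) \<le> M" using M by auto
    then have "norm (f (h n *\<^sub>R b + x) - f x) \<le> h n * M"
      using s(3) h(1)[of n] by (smt (verit) mult_left_mono norm_scaleR real_norm_def)
    then show ?thesis using True h(1)[of n] by (simp add: q_def divide_simps mult.commute)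
  next
    case False
    then have "norm x > \<bar>r\<bar>+1" by auto
    moreover have "norm (h n *\<^sub>R b + x) \<ge> norm x - norm (h n *\<^sub>R b)"
      by (metis add.commute norm_diff_ineq)
    ultimately have "f x = 0" "f (h n *\<^sub>R b + x) = 0"
      using h[of n] b by (auto intro!: supp)
    then show ?thesis using False by (simp add: q_def)
  qed
  have "(\<lambda>n. LINT x|lborel. q n x) \<longlonglongrightarrow> (LINT x|lborel. D x b)"
  proof (rule integral_dominated_convergence[where w="\<lambda>x. M * indicator (cball 0 (\<bar>r\<bar>+1)) x"])
    show "integrable lborel (\<lambda>x::'a. M * indicator (cball 0 (\<bar>r\<bar>+1)) x :: real)"
      using emeasure_lborel_cball_finite[of "0::'a" "\<bar>r\<bar>+1"]
      by (intro integrable_mult_right integrable_real_indicator) auto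
  qed (use q_lim q_bd in \<open>auto simp: q_def\<close>)
  moreover have "(LINT x|lborel. q n x) = 0" for n
  proof -
    have "integrable lborel (\<lambda>x. f (h n *\<^sub>R b + x))"
    proof (rule integrable_continuous_bounded_support[where r = "\<bar>r\<bar>+1"])
      show "continuous_on UNIV (\<lambda>x. f (h n *\<^sub>R b + x))"
        by (intro continuous_on_compose2[OF contf] continuous_intros) auto
      fix x :: 'a assume "\<bar>r\<bar> + 1 \<le> norm x"
      moreover have "norm (h n *\<^sub>R b + x) \<ge> norm x - norm (h n *\<^sub>R b)"
        by (metis add.commute norm_diff_ineq)
      ultimately show "f (h n *\<^sub>R b + x) = 0"
        using h[of n] b by (auto intro!: supp)
    qed
    then show ?thesis unfolding q_def using intf
      by (simp add: lborel_integral_translate)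
  qed
  ultimately show ?thesis by (simp add: LIMSEQ_const_iff)
qed

section \<open>Smooth functions\<close>

lemma C_k_imp_continuous: "C_k k f \<Longrightarrow> continuous_on UNIV f"
  by (cases k) (auto intro: continuous_at_imp_continuous_on differentiable_imp_continuous_within)

lemma C_k_SucD: "C_k (Suc k) f \<Longrightarrow> C_k k f"
proof (induction k arbitrary: f)
  case 0
  then show ?case using C_k_imp_continuous by (metis C_k.simps(1))
next
  case (Suc k)
  then show ?case by (metis C_k.simps(2))
qed

lemma C_k_SucI:
  assumes "\<And>x. (f has_derivative D x) (at x)" "\<And>b. b \<in> Basis \<Longrightarrow> C_k k (\<lambda>x. D x b)"
  shows "C_k (Suc k) f"
proof -
  have "D x = frechet_derivative f (at x)" for x
    using assms(1) by (rule frechet_derivative_at)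
  then show ?thesis using assms by (auto simp: differentiable_def)
qed

lemma C_k_SucE:
  assumes "C_k (Suc k) f"
  obtains D where "\<And>x. (f has_derivative D x) (at x)" "\<And>b. b \<in> Basis \<Longrightarrow> C_k k (\<lambda>x. D x b)"
  using assms by (intro that[of "\<lambda>x. frechet_derivative f (at x)"])
    (auto simp: frechet_derivative_works[symmetric])

lemma C_k_const: "C_k k (\<lambda>x. c)"
proof (induction k arbitrary: c)
  case (Suc k)
  show ?case by (rule C_k_SucI[where D="\<lambda>_ _. 0"]) (auto simp: Suc)
qed auto

lemma C_k_inner: "C_k k (\<lambda>x. x \<bullet> c)"
proof (cases k)
  case (Suc m)
  show ?thesis unfolding Suc
    by (rule C_k_SucI[where D="\<lambda>_ h. h \<bullet> c"])
       (auto simp: C_k_const intro!: derivative_eq_intros)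
qed (auto intro!: continuous_intros)

lemma C_k_add: "C_k k f \<Longrightarrow> C_k k g \<Longrightarrow> C_k k (\<lambda>x. f x + g x)"
proof (induction k arbitrary: f g)
  case (Suc k)
  obtain D where D: "\<And>x. (f has_derivative D x) (at x)" "\<And>b. b \<in> Basis \<Longrightarrow> C_k k (\<lambda>x. D x b)"
    using C_k_SucE[OF Suc.prems(1)] by blast
  obtain E where E: "\<And>x. (g has_derivative E x) (at x)" "\<And>b. b \<in> Basis \<Longrightarrow> C_k k (\<lambda>x. E x b)"
    using C_k_SucE[OF Suc.prems(2)] by blast
  show ?case
    by (rule C_k_SucI[where D="\<lambda>x h. D x h + E x h"])
       (use D E Suc.IH in \<open>auto intro!: derivative_eq_intros\<close>)
qed (auto intro!: continuous_intros)

lemma C_k_mult: "C_k k f \<Longrightarrow> C_k k g \<Longrightarrow> C_k k (\<lambda>x. f x * g x)"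
proof (induction k arbitrary: f g)
  case (Suc k)
  obtain D where D: "\<And>x. (f has_derivative D x) (at x)" "\<And>b. b \<in> Basis \<Longrightarrow> C_k k (\<lambda>x. D x b)"
    using C_k_SucE[OF Suc.prems(1)] by blast
  obtain E where E: "\<And>x. (g has_derivative E x) (at x)" "\<And>b. b \<in> Basis \<Longrightarrow> C_k k (\<lambda>x. E x b)"
    using C_k_SucE[OF Suc.prems(2)] by blast
  show ?case
  proof (rule C_k_SucI[where D="\<lambda>x h. f x * E x h + D x h * g x"])
    show "((\<lambda>x. f x * g x) has_derivative (\<lambda>h. f x * E x h + D x h * g x)) (at x)" for x
      using D E by (auto intro!: derivative_eq_intros)
  qed (use D E Suc.IH C_k_SucD[OF Suc.prems(1)] C_k_SucD[OF Suc.prems(2)] in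
       \<open>auto intro!: C_k_add\<close>)
qed (auto intro!: continuous_intros)

lemma C_k_Suc_realI:
  assumes "\<And>t. (f has_real_derivative f' t) (at t)" "C_k k f'"
  shows "C_k (Suc k) f"
  by (rule C_k_SucI[where D="\<lambda>t h. f' t * h"])
     (use assms in \<open>auto simp: has_field_derivative_def\<close>)

lemma C_k_Suc_realE:
  assumes "C_k (Suc k) f"
  obtains f' where "\<And>t. (f has_real_derivative f' t) (at t)" "C_k k f'"
proof -
  obtain D where D: "\<And>x. (f has_derivative D x) (at x)" "\<And>b. b \<in> Basis \<Longrightarrow> C_k k (\<lambda>x. D x b)"
    using C_k_SucE[OF assms] by blast
  have "D x h = D x 1 * h" for x h
    using linear_cmul[OF has_derivative_linear[OF D(1)[of x]], of h 1] by simp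
  then have "(f has_real_derivative D t 1) (at t)" for t
    unfolding has_field_derivative_def using D(1)[of t] by (metis (no_types, lifting) ext)
  then show ?thesis using D(2) by (intro that[of "\<lambda>t. D t 1"]) auto
qed

text \<open>
  Each partial derivative of \<open>p(|x|\<^sup>2)\<close> is a coordinate function times \<open>p'(|x|\<^sup>2)\<close>, so that the induction
  only needs closure under products.
\<close>
lemma C_k_compose_inner_self:
  fixes p :: "real \<Rightarrow> real"
  shows "C_k k p \<Longrightarrow> C_k k (\<lambda>x::'a::euclidean_space. p (x \<bullet> x))"
proof (induction k arbitrary: p)
  case 0
  then show ?case by (auto intro!: continuous_on_compose2[of UNIV p] continuous_intros)
next
  case (Suc k)
  obtain p' where p': "\<And>t. (p has_real_derivative p' t) (at t)" "C_k k p'"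
    using C_k_Suc_realE[OF Suc.prems] by blast
  show ?case
  proof (rule C_k_SucI[where D="\<lambda>x h. p' (x \<bullet> x) * ((x \<bullet> h) * 2)"])
    show "((\<lambda>x. p (x \<bullet> x)) has_derivative (\<lambda>h. p' (x \<bullet> x) * ((x \<bullet> h) * 2))) (at x)" for x :: 'a
      by (rule has_derivative_compose[of "\<lambda>x. x \<bullet> x" "\<lambda>h. (x \<bullet> h) * 2" x _ p,
            OF _ p'(1)[unfolded has_field_derivative_def]])
         (auto intro!: derivative_eq_intros simp: inner_commute)
  qed (auto intro!: C_k_mult C_k_const C_k_inner Suc.IH p')
qed

text \<open>
  The standard smooth function that is flat at the origin is the case \<open>q = 1\<close>.  Carrying a polynomial
  in \<open>1 / s\<close> along makes the family closed under differentiation, and smoothness follows by induction.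
\<close>
definition flat_exp :: "real poly \<Rightarrow> real \<Rightarrow> real" where
  "flat_exp q s = (if s > 0 then poly q (1 / s) * exp (- (1 / s)) else 0)"

lemma poly_times_exp_minus_tendsto_0: "((\<lambda>y. poly q y * exp (- y)) \<longlongrightarrow> (0::real)) at_top"
proof -
  have "((\<lambda>y. \<Sum>i\<le>degree q. coeff q i * (y ^ i / exp y)) \<longlongrightarrow> (\<Sum>i\<le>degree q. coeff q i * (0::real))) at_top"
    by (intro tendsto_intros tendsto_power_div_exp_0)
  moreover have "(\<lambda>y. \<Sum>i\<le>degree q. coeff q i * (y ^ i / exp y)) = (\<lambda>y. poly q y * exp (- y))"
    by (auto simp: poly_altdef sum_distrib_right exp_minus divide_inverse mult.assoc)
  ultimately show ?thesis by simp
qed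

lemma flat_exp_tendsto_0: "(flat_exp q \<longlongrightarrow> 0) (at 0)"
proof -
  have right: "(flat_exp q \<longlongrightarrow> 0) (at_right 0)"
  proof -
    have "((\<lambda>s. poly q (inverse s) * exp (- inverse s)) \<longlongrightarrow> 0) (at_right (0::real))"
      using filterlim_compose[OF poly_times_exp_minus_tendsto_0 filterlim_inverse_at_top_right] .
    moreover have "\<forall>\<^sub>F s in at_right (0::real). poly q (inverse s) * exp (- inverse s) = flat_exp q s"
      by (auto simp: eventually_at_right_field flat_exp_def inverse_eq_divide intro!: exI[of _ 1])
    ultimately show ?thesis by (rule Lim_transform_eventually)
  qed
  have "\<forall>\<^sub>F s in at_left (0::real). 0 = flat_exp q s"
    by (auto simp: eventually_at_left_field flat_exp_def intro!: exI[of _ "-1"])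
  then have "(flat_exp q \<longlongrightarrow> 0) (at_left 0)"
    by (rule Lim_transform_eventually[OF tendsto_const])
  then show ?thesis using right by (simp add: filterlim_split_at)
qed

lemma flat_exp_has_derivative:
  "(flat_exp q has_real_derivative flat_exp ((q - pderiv q) * [:0, 0, 1:]) s) (at s)"
proof -
  consider "s > 0" | "s < 0" | "s = 0" by linarith
  then show ?thesis
  proof cases
    case 1
    have "((\<lambda>s. poly q (1 / s) * exp (- (1 / s))) has_real_derivative
        flat_exp ((q - pderiv q) * [:0, 0, 1:]) s) (at s)"
      using 1 by (auto intro!: derivative_eq_intros poly_DERIV[THEN DERIV_chain2]
          simp: flat_exp_def field_simps power2_eq_square)
    moreover have "\<forall>\<^sub>F t in nhds s. flat_exp q t = poly q (1 / t) * exp (- (1 / t))"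
      using eventually_nhds_in_open[of "{0<..}" s] 1
      by (auto simp: flat_exp_def elim!: eventually_mono)
    ultimately show ?thesis by (subst DERIV_cong_ev) auto
  next
    case 2
    have "\<forall>\<^sub>F t in nhds s. flat_exp q t = 0"
      using eventually_nhds_in_open[of "{..<0}" s] 2
      by (auto simp: flat_exp_def elim!: eventually_mono)
    moreover have "((\<lambda>t. 0) has_real_derivative flat_exp ((q - pderiv q) * [:0, 0, 1:]) s) (at s)"
      using 2 by (simp add: flat_exp_def)
    ultimately show ?thesis by (subst DERIV_cong_ev) auto
  next
    case 3
    have "(flat_exp q has_real_derivative 0) (at 0)"
      unfolding DERIV_def
    proof (rule Lim_transform_eventually[OF flat_exp_tendsto_0[of "q * [:0, 1:]"]])
      show "\<forall>\<^sub>F h in at 0. flat_exp (q * [:0, 1:]) h = (flat_exp q (0 + h) - flat_exp q 0) / h"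
        by (rule eventually_at_topological[THEN iffD2, OF exI[of _ UNIV]])
           (auto simp: flat_exp_def)
    qed
    then show ?thesis using 3 by (simp add: flat_exp_def)
  qed
qed

lemma C_k_flat_exp: "C_k k (flat_exp q)"
proof (induction k arbitrary: q)
  case 0
  then show ?case
    using DERIV_continuous[OF flat_exp_has_derivative] by (auto intro!: continuous_at_imp_continuous_on)
next
  case (Suc k)
  show ?case by (rule C_k_Suc_realI[OF flat_exp_has_derivative Suc.IH])
qed

lemma C_k_compose_affine:
  fixes p :: "real \<Rightarrow> real"
  shows "C_k k p \<Longrightarrow> C_k k (\<lambda>t. p (a + c * t))"
proof (induction k arbitrary: p)
  case 0
  then show ?case by (auto intro!: continuous_on_compose2[of UNIV p] continuous_intros)
next
  case (Suc k)
  obtain p' where p': "\<And>t. (p has_real_derivative p' t) (at t)" "C_k k p'"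
    using C_k_Suc_realE[OF Suc.prems] by blast
  show ?case
  proof (rule C_k_Suc_realI[where f' = "\<lambda>t. p' (a + c * t) * c"])
    show "((\<lambda>t. p (a + c * t)) has_real_derivative p' (a + c * t) * c) (at t)" for t
      by (rule DERIV_chain2[OF p'(1)]) (auto intro!: derivative_eq_intros)
  qed (auto intro!: C_k_mult C_k_const Suc.IH p')
qed

lemma C_k_power_series:
  fixes c :: "nat \<Rightarrow> real"
  shows "(\<And>x. summable (\<lambda>n. c n * x ^ n)) \<Longrightarrow> C_k k (\<lambda>x. \<Sum>n. c n * x ^ n)"
proof (induction k arbitrary: c)
  case 0
  then show ?case using DERIV_continuous[OF termdiffs_strong_converges_everywhere]
    by (auto intro!: continuous_at_imp_continuous_on)
next
  case (Suc k)
  show ?case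
    by (rule C_k_Suc_realI[OF termdiffs_strong_converges_everywhere[OF Suc.prems]])
       (intro Suc.IH termdiff_converges_all Suc.prems)
qed

section \<open>The Bessel function and its first zero\<close>

definition bessel_coeff :: "real \<Rightarrow> nat \<Rightarrow> real" where
  "bessel_coeff a n = (- 1) ^ n / (fact n * pochhammer a n)"

text \<open>
  Up to the factor \<open>\<Gamma>(a) t powr (- (a - 1) / 2)\<close> this is the Bessel function \<open>J\<close> of order \<open>a - 1\<close> at
  \<open>2 sqrt t\<close>.  In this normalization it is an entire function of \<open>t\<close>, so substituting \<open>|x|\<^sup>2\<close>
  gives a function that is smooth at the origin, too.
\<close>
definition bessel :: "real \<Rightarrow> real \<Rightarrow> real" where
  "bessel a t = (\<Sum>n. bessel_coeff a n * t ^ n)"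

definition bessel' :: "real \<Rightarrow> real \<Rightarrow> real" where
  "bessel' a t = (\<Sum>n. diffs (bessel_coeff a) n * t ^ n)"

definition bessel'' :: "real \<Rightarrow> real \<Rightarrow> real" where
  "bessel'' a t = (\<Sum>n. diffs (diffs (bessel_coeff a)) n * t ^ n)"

context
  fixes a :: real
  assumes a: "a > 0"
begin

lemma summable_bessel: "summable (\<lambda>n. bessel_coeff a n * t ^ n)"
proof (rule summable_comparison_test'[OF summable_exp[of "\<bar>t\<bar> / a"]])
  fix n
  have "(\<Prod>i = 0..<n. a) \<le> (\<Prod>i = 0..<n. a + of_nat i)"
    using a by (intro prod_mono) auto
  then have "a ^ n \<le> pochhammer a n" by (simp add: pochhammer_prod)
  moreover have "a ^ n > 0" using a by simp
  ultimately have "\<bar>t\<bar> ^ n / (fact n * pochhammer a n) \<le> \<bar>t\<bar> ^ n / (fact n * a ^ n)"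
    by (intro divide_left_mono mult_left_mono mult_pos_pos) auto
  then show "norm (bessel_coeff a n * t ^ n) \<le> inverse (fact n) * (\<bar>t\<bar> / a) ^ n"
    using pochhammer_pos[OF a, of n]
    by (simp add: bessel_coeff_def abs_mult power_abs power_divide power_inverse power_mult_distrib divide_inverse mult_ac)
qed

lemmas summable_bessel' = termdiff_converges_all[OF summable_bessel]
lemmas summable_bessel'' = termdiff_converges_all[OF summable_bessel']

lemma DERIV_bessel: "(bessel a has_real_derivative bessel' a t) (at t)"
  unfolding bessel_def[abs_def] bessel'_def
  by (rule termdiffs_strong_converges_everywhere[OF summable_bessel])

lemma DERIV_bessel': "(bessel' a has_real_derivative bessel'' a t) (at t)"
  unfolding bessel'_def[abs_def] bessel''_def
  by (rule termdiffs_strong_converges_everywhere[OF summable_bessel'])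

lemma C_k_bessel: "C_k k (bessel a)"
  unfolding bessel_def[abs_def] by (rule C_k_power_series[OF summable_bessel])

lemma C_k_bessel': "C_k k (bessel' a)"
  unfolding bessel'_def[abs_def] by (rule C_k_power_series[OF summable_bessel'])

lemma C_k_bessel'': "C_k k (bessel'' a)"
  unfolding bessel''_def[abs_def] by (rule C_k_power_series[OF summable_bessel''])

lemma bessel_0: "bessel a 0 = 1"
  using powser_zero[of "bessel_coeff a"] by (simp add: bessel_def bessel_coeff_def)

text \<open>
  For \<open>a = d / 2\<close> this is the eigenvalue equation of the Laplacian for radial functions, written in
  the variable \<open>|x|\<^sup>2\<close>.
\<close>
lemma bessel_ode: "t * bessel'' a t + a * bessel' a t + bessel a t = 0"
proof -
  let ?c = "bessel_coeff a"
  have "(\<lambda>n. t * (diffs (diffs ?c) n * t ^ n)) sums (t * bessel'' a t)"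
    unfolding bessel''_def by (intro sums_mult summable_sums summable_bessel'')
  then have "(\<lambda>n. real (Suc n) * diffs ?c (Suc n) * t ^ Suc n) sums (t * bessel'' a t)"
    by (simp add: diffs_def mult_ac)
  then have 2: "(\<lambda>n. real n * diffs ?c n * t ^ n) sums (t * bessel'' a t)"
    by (subst (asm) sums_Suc_iff) simp
  have 1: "(\<lambda>n. a * (diffs ?c n * t ^ n)) sums (a * bessel' a t)"
    unfolding bessel'_def by (intro sums_mult summable_sums summable_bessel')
  have 0: "(\<lambda>n. ?c n * t ^ n) sums bessel a t"
    unfolding bessel_def by (intro summable_sums summable_bessel)
  have "real n * diffs ?c n * t ^ n + a * (diffs ?c n * t ^ n) + ?c n * t ^ n = 0" for n
  proof -
    have "pochhammer a n > 0" using a by (rule pochhammer_pos)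
    then have "(real n + a) * (real (Suc n) * ?c (Suc n)) = - ?c n"
      using a by (simp add: bessel_coeff_def pochhammer_Suc divide_simps add_pos_nonneg)
    then have "((real n + a) * (real (Suc n) * ?c (Suc n)) + ?c n) * t ^ n = 0" by simp
    then show ?thesis by (simp add: diffs_def algebra_simps)
  qed
  then show ?thesis using sums_add[OF sums_add[OF 2 1] 0] sums_unique by fastforce
qed

text \<open>
  Were \<open>bessel a\<close> positive throughout, \<open>y = - t bessel' / bessel\<close> would solve the Riccati equation
  \<open>y' = 1 + (1 - a) y / t + y\<^sup>2 / t\<close> on the whole half-line.  For \<open>t \<ge> (1 - a)\<^sup>2\<close> the right-hand side is at
  least \<open>1/2 + y\<^sup>2 / (2 t)\<close>.  Hence \<open>y\<close> becomes positive, and from then on \<open>- 1 / y - ln t / 2\<close> is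
  nondecreasing although its first term is negative and its second tends to \<open>- \<infinity>\<close>.
\<close>
lemma bessel_not_positive: "\<exists>t\<ge>0. bessel a t \<le> 0"
proof (rule ccontr)
  assume "\<not> ?thesis"
  then have pos: "bessel a t > 0" if "t \<ge> 0" for t using that by force
  define y where "y t = - (t * bessel' a t / bessel a t)" for t
  define y' where "y' t = 1 + (1 - a) * y t / t + (y t)\<^sup>2 / t" for t
  have dy: "(y has_real_derivative y' t) (at t)" if "t > 0" for t
  proof -
    have J: "bessel a t > 0" using pos that by simp
    have J2: "t * bessel'' a t = - a * bessel' a t - bessel a t" using bessel_ode[of t] by simp
    have "(y has_real_derivative - (((bessel' a t + bessel'' a t * t) * bessel a t
        - t * bessel' a t * bessel' a t) / (bessel a t * bessel a t))) (at t)"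
      unfolding y_def[abs_def] using J
      by (auto intro!: derivative_eq_intros DERIV_bessel DERIV_bessel')
    also have "bessel'' a t * t = - a * bessel' a t - bessel a t" using J2 by (simp add: mult.commute)
    also have "- (((bessel' a t + (- a * bessel' a t - bessel a t)) * bessel a t
        - t * bessel' a t * bessel' a t) / (bessel a t * bessel a t)) = y' t"
      using J that by (simp add: y'_def y_def field_simps power2_eq_square)
    finally show ?thesis .
  qed
  define T where "T = max 1 ((1 - a)\<^sup>2)"
  \<comment> \<open>Completing the square: \<open>(y + (1 - a))\<^sup>2 + t - (1 - a)\<^sup>2 \<ge> 0\<close>.\<close>
  have y'_ge: "y' t \<ge> 1/2 + (y t)\<^sup>2 / (2 * t)" if "t \<ge> T" for t
  proof -
    have t: "t > 0" "t \<ge> (1 - a)\<^sup>2" using that by (auto simp: T_def)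
    have "0 \<le> (y t + (1 - a))\<^sup>2 + (t - (1 - a)\<^sup>2)" using t by simp
    also have "\<dots> = 2 * t * (y' t - (1/2 + (y t)\<^sup>2 / (2 * t)))"
      using t by (simp add: y'_def field_simps power2_eq_square)
    finally show ?thesis using t by (simp add: zero_le_mult_iff)
  qed
  have grow: "y T + (t - T) / 2 \<le> y t" if "t \<ge> T" for t
  proof -
    have "y T - T / 2 \<le> y t - t / 2"
    proof (rule DERIV_nonneg_imp_nondecreasing[OF that], intro exI conjI)
      fix s assume s: "T \<le> s" "s \<le> t"
      then have "s > 0" by (auto simp: T_def)
      then show "((\<lambda>t. y t - t / 2) has_real_derivative y' s - 1 / 2) (at s)"
        by (auto intro!: derivative_eq_intros dy)
      have "(y s)\<^sup>2 / (2 * s) \<ge> 0" using \<open>s > 0\<close> by simp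
      then show "0 \<le> y' s - 1 / 2" using y'_ge[OF s(1)] by simp
    qed
    then show ?thesis by (simp add: field_simps)
  qed
  define T2 where "T2 = T + 2 * \<bar>y T\<bar> + 1"
  have T2: "T2 \<ge> T" "T2 > 0" by (auto simp: T2_def T_def)
  have ypos: "y t > 0" if "t \<ge> T2" for t
  proof -
    have "y T + (t - T) / 2 \<le> y t" using grow[of t] that T2 by linarith
    then show ?thesis using that unfolding T2_def by (simp add: field_simps)
  qed
  define F where "F t = - (1 / y t) - ln t / 2" for t
  have "F T2 \<le> F t" if "t \<ge> T2" for t
  proof (rule DERIV_nonneg_imp_nondecreasing[OF that], intro exI conjI)
    fix s assume s: "T2 \<le> s" "s \<le> t"
    then have s0: "s > 0" "y s > 0" "s \<ge> T" using T2 ypos[of s] by auto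
    show "(F has_real_derivative y' s / (y s)\<^sup>2 - 1 / (2 * s)) (at s)"
      unfolding F_def[abs_def] using s0
      by (auto intro!: derivative_eq_intros dy simp: power2_eq_square)
    have "(y s)\<^sup>2 / (2 * s) \<le> y' s" using y'_ge[OF s0(3)] by simp
    then have "(y s)\<^sup>2 / (2 * s) / (y s)\<^sup>2 \<le> y' s / (y s)\<^sup>2"
      by (intro divide_right_mono) auto
    then show "0 \<le> y' s / (y s)\<^sup>2 - 1 / (2 * s)" using s0 by simp
  qed
  then have F_mono: "F T2 \<le> F t" if "t \<ge> T2" for t using that .
  have bound: "ln t < - 2 * F T2" if "t \<ge> T2" for t
  proof -
    have "1 / y t > 0" using ypos[OF that] by simp
    then show ?thesis using F_mono[OF that] F_def[of t] by linarith
  qed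
  \<comment> \<open>At this point the logarithm has outgrown the bound.\<close>
  define t where "t = max T2 (exp (- 2 * F T2))"
  have "- 2 * F T2 \<le> ln t"
    using T2 by (subst ln_ge_iff) (auto simp: t_def)
  moreover have "t \<ge> T2" by (simp add: t_def)
  ultimately show False using bound[of t] by simp
qed

lemma bessel_first_zero:
  obtains z where "z > 0" "bessel a z = 0" "\<And>t. 0 \<le> t \<Longrightarrow> t < z \<Longrightarrow> bessel a t > 0"
proof -
  have cont: "continuous_on A (bessel a)" for A
    using DERIV_continuous[OF DERIV_bessel] by (auto intro!: continuous_at_imp_continuous_on)
  obtain s where s: "s \<ge> 0" "bessel a s \<le> 0" using bessel_not_positive by blast
  define S where "S = {t \<in> {0..s}. bessel a t \<le> 0}"
  have "compact S"
  proof -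
    have "closed (UNIV \<inter> bessel a -` {..0})"
      by (intro continuous_closed_preimage cont) auto
    then have "compact ({0..s} \<inter> (UNIV \<inter> bessel a -` {..0}))" by (intro compact_Int_closed) auto
    also have "{0..s} \<inter> (UNIV \<inter> bessel a -` {..0}) = S" by (auto simp: S_def)
    finally show ?thesis .
  qed
  moreover have "s \<in> S" using s by (auto simp: S_def)
  ultimately obtain z where z: "z \<in> S" "\<And>t. t \<in> S \<Longrightarrow> z \<le> t"
    by (metis compact_attains_inf empty_iff)
  have "z > 0" using z(1) bessel_0 by (cases "z = 0") (auto simp: S_def)
  have pos: "bessel a t > 0" if "0 \<le> t" "t < z" for t
    using z(2)[of t] that z(1) by (force simp: S_def)
  have "bessel a z = 0"
  proof (rule antisym)
    show "bessel a z \<le> 0" using z by (auto simp: S_def)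
    have "(bessel a \<longlongrightarrow> bessel a z) (at_left z)"
      using cont[of UNIV] by (meson continuous_on_def UNIV_I tendsto_within_subset subset_UNIV)
    moreover have "\<forall>\<^sub>F t in at_left z. 0 \<le> bessel a t"
      unfolding eventually_at_left_field using \<open>z > 0\<close> pos by (intro exI[of _ 0]) (auto intro: less_imp_le)
    ultimately show "0 \<le> bessel a z" by (rule tendsto_lowerbound) auto
  qed
  then show ?thesis using that \<open>z > 0\<close> pos by blast
qed

end

section \<open>Limits in mean square\<close>

lemma square_integrable_inner:
  fixes f g :: "'a::euclidean_space \<Rightarrow> 'b::euclidean_space"
  assumes "square_integrable f" "square_integrable g"
  shows "integrable lborel (\<lambda>x. f x \<bullet> g x)"
proof (rule Bochner_Integration.integrable_bound)
  show "integrable lborel (\<lambda>x. (norm (f x))\<^sup>2 + (norm (g x))\<^sup>2)"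
    using assms by (auto simp: square_integrable_def)
  show "(\<lambda>x. f x \<bullet> g x) \<in> borel_measurable lborel"
    using assms by (auto simp: square_integrable_def)
  show "AE x in lborel. norm (f x \<bullet> g x) \<le> norm ((norm (f x))\<^sup>2 + (norm (g x))\<^sup>2)"
  proof (rule AE_I2)
    fix x
    have "\<bar>f x \<bullet> g x\<bar> \<le> norm (f x) * norm (g x)" by (rule Cauchy_Schwarz_ineq2)
    also have "\<dots> \<le> (norm (f x))\<^sup>2 + (norm (g x))\<^sup>2"
    proof -
      have "2 * (norm (f x) * norm (g x)) \<le> (norm (f x))\<^sup>2 + (norm (g x))\<^sup>2"
        using sum_squares_bound[of "norm (f x)" "norm (g x)"] by simp
      moreover have "0 \<le> norm (f x) * norm (g x)" by simp
      ultimately show ?thesis by linarith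
    qed
    finally show "norm (f x \<bullet> g x) \<le> norm ((norm (f x))\<^sup>2 + (norm (g x))\<^sup>2)" by simp
  qed
qed

lemma square_integrable_diff_scaleR:
  fixes f g :: "'a::euclidean_space \<Rightarrow> 'b::euclidean_space"
  assumes "square_integrable f" "square_integrable g"
  shows "square_integrable (\<lambda>x. f x - t *\<^sub>R g x)"
    and "(LINT x|lborel. (norm (f x - t *\<^sub>R g x))\<^sup>2) = (LINT x|lborel. (norm (f x))\<^sup>2)
           - 2 * t * (LINT x|lborel. f x \<bullet> g x) + t\<^sup>2 * (LINT x|lborel. (norm (g x))\<^sup>2)"
proof -
  have eq: "(norm (f x - t *\<^sub>R g x))\<^sup>2 = (norm (f x))\<^sup>2 - 2 * t * (f x \<bullet> g x) + t\<^sup>2 * (norm (g x))\<^sup>2" for x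
    by (simp only: power2_norm_eq_inner)
       (simp add: inner_diff inner_commute[of "g x" "f x"] power2_eq_square algebra_simps)
  have ints: "integrable lborel (\<lambda>x. (norm (f x))\<^sup>2)" "integrable lborel (\<lambda>x. (norm (g x))\<^sup>2)"
    using assms by (auto simp: square_integrable_def)
  have [measurable]: "f \<in> borel_measurable lborel" "g \<in> borel_measurable lborel"
    using assms by (auto simp: square_integrable_def)
  have "integrable lborel (\<lambda>x. (norm (f x))\<^sup>2 - 2 * t * (f x \<bullet> g x) + t\<^sup>2 * (norm (g x))\<^sup>2)"
    using ints square_integrable_inner[OF assms] by auto
  then show "square_integrable (\<lambda>x. f x - t *\<^sub>R g x)"
    unfolding square_integrable_def eq by auto
  show "(LINT x|lborel. (norm (f x - t *\<^sub>R g x))\<^sup>2) = (LINT x|lborel. (norm (f x))\<^sup>2)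
           - 2 * t * (LINT x|lborel. f x \<bullet> g x) + t\<^sup>2 * (LINT x|lborel. (norm (g x))\<^sup>2)"
    unfolding eq using ints square_integrable_inner[OF assms] by simp
qed

lemma square_integrable_diff:
  fixes f g :: "'a::euclidean_space \<Rightarrow> 'b::euclidean_space"
  assumes "square_integrable f" "square_integrable g"
  shows "square_integrable (\<lambda>x. f x - g x)"
  using square_integrable_diff_scaleR(1)[OF assms, of 1] by simp

lemma L2_Cauchy_Schwarz:
  fixes f g :: "'a::euclidean_space \<Rightarrow> 'b::euclidean_space"
  assumes "square_integrable f" "square_integrable g"
  shows "\<bar>LINT x|lborel. f x \<bullet> g x\<bar>
      \<le> sqrt (LINT x|lborel. (norm (f x))\<^sup>2) * sqrt (LINT x|lborel. (norm (g x))\<^sup>2)"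
proof -
  define a b c where "a = (LINT x|lborel. (norm (f x))\<^sup>2)" "b = (LINT x|lborel. (norm (g x))\<^sup>2)"
    "c = (LINT x|lborel. f x \<bullet> g x)"
  have pos: "0 \<le> a - 2 * t * c + t\<^sup>2 * b" for t
    using square_integrable_diff_scaleR(2)[OF assms, of t]
      Bochner_Integration.integral_nonneg[of lborel "\<lambda>x. (norm (f x - t *\<^sub>R g x))\<^sup>2"]
    by (simp add: a_b_c_def)
  have b0: "b \<ge> 0" by (simp add: a_b_c_def)
  have "c\<^sup>2 \<le> a * b"
  proof (cases "b = 0")
    case True
    have "c = 0"
    proof (rule ccontr)
      assume "c \<noteq> 0"
      then show False using pos[of "(a + 1) / (2 * c)"] True by (simp add: field_simps)
    qed
    then show ?thesis using True by simp
  next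
    case False
    then have "b > 0" using b0 by simp
    \<comment> \<open>The quadratic polynomial in \<open>t\<close> attains its minimum at \<open>c / b\<close>.\<close>
    have "0 \<le> a - c\<^sup>2 / b"
      using pos[of "c / b"] \<open>b > 0\<close> by (simp add: field_simps power2_eq_square)
    then show ?thesis using \<open>b > 0\<close> by (simp add: field_simps)
  qed
  then have "sqrt (c\<^sup>2) \<le> sqrt (a * b)" by (rule real_sqrt_le_mono)
  then show ?thesis by (simp add: a_b_c_def real_sqrt_mult)
qed

lemma L2_inner_tendsto:
  fixes f g :: "'a::euclidean_space \<Rightarrow> 'b::euclidean_space"
  assumes F: "\<And>n. square_integrable (F n)" "square_integrable f"
    and G: "\<And>n. square_integrable (G n)" "square_integrable g"
    and limF: "(\<lambda>n. LINT x|lborel. (norm (F n x - f x))\<^sup>2) \<longlonglongrightarrow> 0"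
    and limG: "(\<lambda>n. LINT x|lborel. (norm (G n x - g x))\<^sup>2) \<longlonglongrightarrow> 0"
  shows "(\<lambda>n. LINT x|lborel. F n x \<bullet> G n x) \<longlonglongrightarrow> (LINT x|lborel. f x \<bullet> g x)"
proof -
  let ?N = "\<lambda>f::'a \<Rightarrow> 'b. sqrt (LINT x|lborel. (norm (f x))\<^sup>2)"
  let ?A = "\<lambda>n. ?N (\<lambda>x. F n x - f x)" and ?B = "\<lambda>n. ?N (\<lambda>x. G n x - g x)"
  note sqF = square_integrable_diff[OF F] and sqG = square_integrable_diff[OF G]
  have eq: "(LINT x|lborel. F n x \<bullet> G n x) - (LINT x|lborel. f x \<bullet> g x)
      = (LINT x|lborel. (F n x - f x) \<bullet> (G n x - g x)) + (LINT x|lborel. (F n x - f x) \<bullet> g x)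
        + (LINT x|lborel. f x \<bullet> (G n x - g x))" for n
  proof -
    have "(LINT x|lborel. F n x \<bullet> G n x) - (LINT x|lborel. f x \<bullet> g x)
      = (LINT x|lborel. F n x \<bullet> G n x - f x \<bullet> g x)"
      using square_integrable_inner[OF F(1) G(1)] square_integrable_inner[OF F(2) G(2)] by simp
    also have "\<dots> = (LINT x|lborel. (F n x - f x) \<bullet> (G n x - g x) + (F n x - f x) \<bullet> g x
        + f x \<bullet> (G n x - g x))"
      by (rule Bochner_Integration.integral_cong) (auto simp: algebra_simps inner_diff)
    also have "\<dots> = (LINT x|lborel. (F n x - f x) \<bullet> (G n x - g x)) + (LINT x|lborel. (F n x - f x) \<bullet> g x)
        + (LINT x|lborel. f x \<bullet> (G n x - g x))"
      by (subst Bochner_Integration.integral_add;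
          (intro Bochner_Integration.integrable_add square_integrable_inner sqF sqG F G)?)+
         simp
    finally show ?thesis .
  qed
  have bd: "norm ((LINT x|lborel. F n x \<bullet> G n x) - (LINT x|lborel. f x \<bullet> g x))
      \<le> ?A n * ?B n + ?A n * ?N g + ?N f * ?B n" for n
    unfolding eq real_norm_def
    using L2_Cauchy_Schwarz[OF sqF[of n] sqG[of n]]
      L2_Cauchy_Schwarz[OF sqF[of n] G(2)] L2_Cauchy_Schwarz[OF F(2) sqG[of n]] by linarith
  have A: "?A \<longlonglongrightarrow> 0" using tendsto_real_sqrt[OF limF] by simp
  have B: "?B \<longlonglongrightarrow> 0" using tendsto_real_sqrt[OF limG] by simp
  have "(\<lambda>n. ?A n * ?B n + ?A n * ?N g + ?N f * ?B n) \<longlonglongrightarrow> 0 * 0 + 0 * ?N g + ?N f * 0"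
    by (intro tendsto_intros A B)
  then have "(\<lambda>n. ?A n * ?B n + ?A n * ?N g + ?N f * ?B n) \<longlonglongrightarrow> 0" by simp
  then have "(\<lambda>n. (LINT x|lborel. F n x \<bullet> G n x) - (LINT x|lborel. f x \<bullet> g x)) \<longlonglongrightarrow> 0"
    by (rule Lim_null_comparison[rotated]) (intro always_eventually allI bd)
  then show ?thesis by (rule LIM_zero_cancel)
qed

section \<open>Test functions and the Sobolev space\<close>

lemma gradient_zero_off_support:
  fixes w :: "'a::euclidean_space \<Rightarrow> real"
  assumes "(w has_derivative (\<lambda>h. g \<bullet> h)) (at x)" "open S" "x \<in> S" "\<And>y. y \<in> S \<Longrightarrow> w y = 0"
  shows "g = 0"
proof -
  have "(w has_derivative (\<lambda>h. 0)) (at x)"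
    by (rule has_derivative_transform_within_open[OF has_derivative_const assms(2,3)]) (use assms(4) in auto)
  then have "(\<lambda>h. g \<bullet> h) = (\<lambda>h. 0)" using assms(1) has_derivative_unique by blast
  then have "g \<bullet> g = 0" by metis
  then show ?thesis by simp
qed

lemma grad_eqI:
  assumes "(f has_derivative (\<lambda>h. g \<bullet> h)) (at x)"
  shows "grad f x = g"
proof -
  have "frechet_derivative f (at x) = (\<lambda>h. g \<bullet> h)" using frechet_derivative_at[OF assms] by simp
  then show ?thesis by (simp add: grad_def euclidean_representation)
qed

lemma has_derivative_grad:
  assumes "C_k (Suc k) f"
  shows "(f has_derivative (\<lambda>h. grad f x \<bullet> h)) (at x)"
proof -
  have D: "(f has_derivative frechet_derivative f (at x)) (at x)"
    using assms by (simp add: frechet_derivative_works[symmetric])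
  have lin: "linear (frechet_derivative f (at x))" by (rule has_derivative_linear[OF D])
  have "frechet_derivative f (at x) h = grad f x \<bullet> h" for h
  proof -
    have "frechet_derivative f (at x) h = frechet_derivative f (at x) (\<Sum>b\<in>Basis. (h \<bullet> b) *\<^sub>R b)"
      by (simp add: euclidean_representation)
    also have "\<dots> = (\<Sum>b\<in>Basis. (h \<bullet> b) * frechet_derivative f (at x) b)"
      by (simp add: linear_sum[OF lin] linear_cmul[OF lin])
    also have "\<dots> = grad f x \<bullet> h"
      unfolding grad_def inner_sum_left by (simp add: inner_commute mult.commute)
    finally show ?thesis .
  qed
  then show ?thesis using D by (metis (no_types, lifting) ext)
qed

lemma test_function_bounded_support:
  assumes "test_function \<Omega> \<phi>"
  obtains r where "\<And>x. r \<le> norm x \<Longrightarrow> \<phi> x = 0" "\<And>x. r \<le> norm x \<Longrightarrow> grad \<phi> x = 0"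
proof -
  have "bounded (closure {x. \<phi> x \<noteq> 0})" using assms compact_imp_bounded by (auto simp: test_function_def)
  then obtain r where r: "\<And>x. x \<in> closure {x. \<phi> x \<noteq> 0} \<Longrightarrow> norm x \<le> r" by (auto simp: bounded_iff)
  show ?thesis
  proof (rule that[of "r + 1"])
    fix x :: 'a assume "r + 1 \<le> norm x"
    then have x: "x \<notin> closure {x. \<phi> x \<noteq> 0}" using r[of x] by auto
    then show "\<phi> x = 0" using closure_subset[of "{x. \<phi> x \<noteq> 0}"] by auto
    show "grad \<phi> x = 0"
    proof (rule gradient_zero_off_support[of \<phi> _ x "- closure {x. \<phi> x \<noteq> 0}"])
      show "(\<phi> has_derivative (\<lambda>h. grad \<phi> x \<bullet> h)) (at x)"
        using assms has_derivative_grad by (auto simp: test_function_def simp del: C_k.simps)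
    qed (use x closure_subset[of "{x. \<phi> x \<noteq> 0}"] in auto)
  qed
qed

lemma test_function_has_derivative:
  "test_function \<Omega> \<phi> \<Longrightarrow> (\<phi> has_derivative (\<lambda>h. grad \<phi> x \<bullet> h)) (at x)"
  using has_derivative_grad by (auto simp: test_function_def simp del: C_k.simps)

lemma test_function_off:
  assumes "test_function \<Omega> \<phi>" "x \<notin> \<Omega>"
  shows "\<phi> x = 0" "grad \<phi> x = 0"
proof -
  have x: "x \<notin> closure {x. \<phi> x \<noteq> 0}" using assms by (auto simp: test_function_def)
  then show "\<phi> x = 0" using closure_subset[of "{x. \<phi> x \<noteq> 0}"] by auto
  show "grad \<phi> x = 0"
    by (rule gradient_zero_off_support[OF test_function_has_derivative[OF assms(1)], of "- closure {x. \<phi> x \<noteq> 0}"])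
       (use x closure_subset[of "{x. \<phi> x \<noteq> 0}"] in auto)
qed

lemma test_function_continuous: "test_function \<Omega> \<phi> \<Longrightarrow> continuous_on UNIV \<phi>"
  using C_k_imp_continuous by (auto simp: test_function_def)

lemma test_function_grad_continuous:
  assumes "test_function \<Omega> \<phi>"
  shows "continuous_on UNIV (grad \<phi>)"
proof -
  have "C_k (Suc 0) \<phi>" using assms by (simp only: test_function_def)
  then have "continuous_on UNIV (\<lambda>x. \<Sum>b\<in>Basis. frechet_derivative \<phi> (at x) b *\<^sub>R b)"
    by (intro continuous_intros) auto
  then show ?thesis by (simp add: grad_def[abs_def])
qed

lemma square_integrable_continuous_bounded_support:
  fixes f :: "'a::euclidean_space \<Rightarrow> 'b::euclidean_space"
  assumes "continuous_on UNIV f" and "\<And>x. r \<le> norm x \<Longrightarrow> f x = 0"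
  shows "square_integrable f"
  unfolding square_integrable_def
proof
  show "f \<in> borel_measurable lborel" using assms(1) borel_measurable_continuous_onI by simp
  show "integrable lborel (\<lambda>x. (norm (f x))\<^sup>2)"
    by (rule integrable_continuous_bounded_support[where r=r])
       (use assms in \<open>auto intro!: continuous_intros\<close>)
qed

lemma test_function_square_integrable:
  assumes "test_function \<Omega> \<phi>"
  shows "square_integrable \<phi>" "square_integrable (grad \<phi>)"
  using test_function_bounded_support[OF assms]
  by (metis assms square_integrable_continuous_bounded_support test_function_continuous
      test_function_grad_continuous)+

text \<open>
  These limits carry identities and inequalities between test functions over to the Sobolev space.
\<close>
lemma H01_inner_tendsto:
  assumes u: "square_integrable u" "square_integrable G"
    and \<phi>: "\<And>n. test_function \<Omega> (\<phi> n)"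
    and lim: "(\<lambda>n. LINT x|lborel. (\<phi> n x - u x)\<^sup>2) \<longlonglongrightarrow> 0"
      "(\<lambda>n. LINT x|lborel. (norm (grad (\<phi> n) x - G x))\<^sup>2) \<longlonglongrightarrow> 0"
    and vK: "square_integrable v" "square_integrable K"
  shows "(\<lambda>n. LINT x|lborel. \<phi> n x * v x) \<longlonglongrightarrow> (LINT x|lborel. u x * v x)"
    and "(\<lambda>n. LINT x|lborel. grad (\<phi> n) x \<bullet> K x) \<longlonglongrightarrow> (LINT x|lborel. G x \<bullet> K x)"
    and "(\<lambda>n. LINT x|lborel. (\<phi> n x)\<^sup>2) \<longlonglongrightarrow> (LINT x|lborel. (u x)\<^sup>2)"
    and "(\<lambda>n. LINT x|lborel. (norm (grad (\<phi> n) x))\<^sup>2) \<longlonglongrightarrow> (LINT x|lborel. (norm (G x))\<^sup>2)"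
proof -
  note sq = test_function_square_integrable[OF \<phi>]
  show "(\<lambda>n. LINT x|lborel. \<phi> n x * v x) \<longlonglongrightarrow> (LINT x|lborel. u x * v x)"
    using L2_inner_tendsto[of \<phi> u "\<lambda>_. v" v] sq u vK lim by simp
  show "(\<lambda>n. LINT x|lborel. grad (\<phi> n) x \<bullet> K x) \<longlonglongrightarrow> (LINT x|lborel. G x \<bullet> K x)"
    using L2_inner_tendsto[of "\<lambda>n. grad (\<phi> n)" G "\<lambda>_. K" K] sq u vK lim by simp
  show "(\<lambda>n. LINT x|lborel. (\<phi> n x)\<^sup>2) \<longlonglongrightarrow> (LINT x|lborel. (u x)\<^sup>2)"
    using L2_inner_tendsto[of \<phi> u \<phi> u] sq u lim by (simp add: power2_eq_square)
  show "(\<lambda>n. LINT x|lborel. (norm (grad (\<phi> n) x))\<^sup>2) \<longlonglongrightarrow> (LINT x|lborel. (norm (G x))\<^sup>2)"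
    using L2_inner_tendsto[of "\<lambda>n. grad (\<phi> n)" G "\<lambda>n. grad (\<phi> n)" G] sq u lim
    by (simp add: power2_norm_eq_inner)
qed

lemma H01_scale:
  assumes "H01 \<Omega> u G"
  shows "H01 \<Omega> (\<lambda>x. c * u x) (\<lambda>x. c *\<^sub>R G x)"
proof -
  obtain \<phi> where u: "square_integrable u" "square_integrable G" "\<And>x. x \<notin> \<Omega> \<Longrightarrow> u x = 0"
    and \<phi>: "\<And>n. test_function \<Omega> (\<phi> n)"
    and lim: "(\<lambda>n. LINT x|lborel. (\<phi> n x - u x)\<^sup>2) \<longlonglongrightarrow> 0"
      "(\<lambda>n. LINT x|lborel. (norm (grad (\<phi> n) x - G x))\<^sup>2) \<longlonglongrightarrow> 0"
    using assms by (auto simp: H01_def)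
  have g: "grad (\<lambda>x. c * \<phi> n x) x = c *\<^sub>R grad (\<phi> n) x" for n x
    using test_function_has_derivative[OF \<phi>[of n], of x]
    by (intro grad_eqI) (auto intro!: derivative_eq_intros)
  have t: "test_function \<Omega> (\<lambda>x. c * \<phi> n x)" for n
  proof -
    have sub: "closure {x. c * \<phi> n x \<noteq> 0} \<subseteq> closure {x. \<phi> n x \<noteq> 0}" by (rule closure_mono) auto
    have "compact (closure {x. c * \<phi> n x \<noteq> 0})"
      using \<phi>[of n] bounded_subset[OF _ sub] by (auto simp: test_function_def compact_eq_bounded_closed)
    then show ?thesis using \<phi>[of n] sub by (auto simp: test_function_def intro!: C_k_mult C_k_const)
  qed
  have "(\<lambda>n. c\<^sup>2 * (LINT x|lborel. (\<phi> n x - u x)\<^sup>2)) \<longlonglongrightarrow> c\<^sup>2 * 0"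
       "(\<lambda>n. c\<^sup>2 * (LINT x|lborel. (norm (grad (\<phi> n) x - G x))\<^sup>2)) \<longlonglongrightarrow> c\<^sup>2 * 0"
    by (intro tendsto_intros lim)+
  then have "(\<lambda>n. LINT x|lborel. (c * \<phi> n x - c * u x)\<^sup>2) \<longlonglongrightarrow> 0"
    "(\<lambda>n. LINT x|lborel. (norm (grad (\<lambda>x. c * \<phi> n x) x - c *\<^sub>R G x))\<^sup>2) \<longlonglongrightarrow> 0"
    by (simp_all add: g right_diff_distrib[symmetric] scaleR_diff_right[symmetric] power_mult_distrib)
  moreover have "square_integrable (\<lambda>x. c * u x)" "square_integrable (\<lambda>x. c *\<^sub>R G x)"
    using u by (auto simp: square_integrable_def power_mult_distrib)
  ultimately show ?thesis unfolding H01_def using u t by (auto intro!: exI[of _ "\<lambda>n x. c * \<phi> n x"])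
qed

section \<open>Positive solutions bound the Dirichlet form\<close>

text \<open>
  The divergence of the compactly supported vector field \<open>w Du\<close> is \<open>Dw \<bullet> Du - \<mu> w u\<close>, and its integral
  vanishes.  The factor \<open>w\<close> will be a test function, or a quotient with \<open>u\<close> itself in the denominator.
\<close>
lemma green_identity:
  fixes w u :: "'a::euclidean_space \<Rightarrow> real"
  assumes w: "\<And>x. (w has_derivative (\<lambda>h. Dw x \<bullet> h)) (at x)" "continuous_on UNIV Dw"
      "\<And>x. r \<le> norm x \<Longrightarrow> w x = 0"
    and Du: "\<And>x. (u has_derivative (\<lambda>h. Du x \<bullet> h)) (at x)" "continuous_on UNIV Du"
    and D2: "\<And>x b. b \<in> Basis \<Longrightarrow> ((\<lambda>x. Du x \<bullet> b) has_derivative D2 b x) (at x)"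
      "\<And>b. b \<in> Basis \<Longrightarrow> continuous_on UNIV (\<lambda>x. D2 b x b)"
    and eq: "\<And>x. (\<Sum>b\<in>Basis. D2 b x b) = - \<mu> * u x"
  shows "(LINT x|lborel. Dw x \<bullet> Du x) = \<mu> * (LINT x|lborel. w x * u x)"
proof -
  have contw: "continuous_on UNIV w" and contu: "continuous_on UNIV u"
    using w(1) Du(1) by (meson continuous_at_imp_continuous_on has_derivative_continuous)+
  have Dw0: "Dw x = 0" if "r + 1 \<le> norm x" for x
    by (rule gradient_zero_off_support[OF w(1), of "- cball 0 r"]) (use that w(3) in auto)
  have I1: "integrable lborel (\<lambda>x. w x * D2 b x b)" if "b \<in> Basis" for b
    by (rule integrable_continuous_bounded_support[where r=r])
       (use that w(3) D2(2) contw in \<open>auto intro!: continuous_intros\<close>)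
  have I2: "integrable lborel (\<lambda>x. (Dw x \<bullet> b) * (Du x \<bullet> b))" for b
    by (rule integrable_continuous_bounded_support[where r="r+1"])
       (use Dw0 w(2) Du(2) in \<open>auto intro!: continuous_intros\<close>)
  have I3: "integrable lborel (\<lambda>x. w x * u x)"
    by (rule integrable_continuous_bounded_support[where r=r])
       (use w(3) contu contw in \<open>auto intro!: continuous_intros\<close>)
  have I4: "integrable lborel (\<lambda>x. Dw x \<bullet> Du x)"
    by (rule integrable_continuous_bounded_support[where r="r+1"])
       (use Dw0 w(2) Du(2) in \<open>auto intro!: continuous_intros\<close>)
  have 0: "(LINT x|lborel. w x * D2 b x b + (Dw x \<bullet> b) * (Du x \<bullet> b)) = 0" if b: "b \<in> Basis" for b
  proof (rule integral_directional_derivative_eq_0[where f="\<lambda>x. w x * (Du x \<bullet> b)" and b=b and r=r and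
          D="\<lambda>x h. w x * D2 b x h + (Dw x \<bullet> h) * (Du x \<bullet> b)"])
    show "((\<lambda>x. w x * (Du x \<bullet> b)) has_derivative (\<lambda>h. w x * D2 b x h + (Dw x \<bullet> h) * (Du x \<bullet> b))) (at x)" for x
      using has_derivative_mult[OF w(1) D2(1)[OF b]] .
    show "continuous_on UNIV (\<lambda>x. w x * D2 b x b + (Dw x \<bullet> b) * (Du x \<bullet> b))"
      using contw w(2) Du(2) D2(2)[OF b] by (auto intro!: continuous_intros)
  qed (use b w(3) in auto)
  have "0 = (\<Sum>b\<in>Basis. LINT x|lborel. w x * D2 b x b + (Dw x \<bullet> b) * (Du x \<bullet> b))"
    using 0 by simp
  also have "\<dots> = (LINT x|lborel. (\<Sum>b\<in>Basis. w x * D2 b x b + (Dw x \<bullet> b) * (Du x \<bullet> b)))"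
    using I1 I2 by (subst Bochner_Integration.integral_sum) auto
  also have "\<dots> = (LINT x|lborel. Dw x \<bullet> Du x - \<mu> * (w x * u x))"
  proof (rule Bochner_Integration.integral_cong)
    fix x
    have "(\<Sum>b\<in>Basis. w x * D2 b x b) = w x * (- \<mu> * u x)"
      using eq[of x] by (simp add: sum_distrib_left[symmetric])
    then show "(\<Sum>b\<in>Basis. w x * D2 b x b + (Dw x \<bullet> b) * (Du x \<bullet> b)) = Dw x \<bullet> Du x - \<mu> * (w x * u x)"
      by (simp add: sum.distrib euclidean_inner[of "Dw x" "Du x"])
  qed auto
  also have "\<dots> = (LINT x|lborel. Dw x \<bullet> Du x) - \<mu> * (LINT x|lborel. w x * u x)"
    using I3 I4 by simp
  finally show ?thesis by simp
qed

text \<open>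
  Jacobi's substitution: for \<open>w = \<phi>\<^sup>2 / u\<close> with gradient \<open>Dw\<close> one has
  \<open>|grad \<phi>|\<^sup>2 - Dw \<bullet> Du = |grad \<phi> - (\<phi> / u) Du|\<^sup>2 \<ge> 0\<close>, and Green's identity evaluates the integral of
  \<open>Dw \<bullet> Du\<close> to \<open>\<mu>\<close> times that of \<open>w u = \<phi>\<^sup>2\<close>.  Thus a positive solution of the eigenvalue equation
  bounds the Dirichlet form from below.
\<close>
lemma dirichlet_lower_bound:
  fixes u :: "'a::euclidean_space \<Rightarrow> real"
  assumes Du: "\<And>x. (u has_derivative (\<lambda>h. Du x \<bullet> h)) (at x)" "continuous_on UNIV Du"
    and D2: "\<And>x b. b \<in> Basis \<Longrightarrow> ((\<lambda>x. Du x \<bullet> b) has_derivative D2 b x) (at x)"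
      "\<And>b. b \<in> Basis \<Longrightarrow> continuous_on UNIV (\<lambda>x. D2 b x b)"
    and eq: "\<And>x. (\<Sum>b\<in>Basis. D2 b x b) = - \<mu> * u x"
    and pos: "\<And>x. x \<in> \<Omega> \<Longrightarrow> 0 < u x" and \<Omega>: "open \<Omega>"
    and \<phi>: "test_function \<Omega> \<phi>"
  shows "\<mu> * (LINT x|lborel. (\<phi> x)\<^sup>2) \<le> (LINT x|lborel. (norm (grad \<phi> x))\<^sup>2)"
proof -
  let ?S = "closure {x. \<phi> x \<noteq> 0}"
  have S: "?S \<subseteq> \<Omega>" using \<phi> by (auto simp: test_function_def)
  have \<phi>0: "\<phi> x = 0" if "x \<notin> ?S" for x using that closure_subset[of "{x. \<phi> x \<noteq> 0}"] by auto
  have d\<phi>: "(\<phi> has_derivative (\<lambda>h. grad \<phi> x \<bullet> h)) (at x)" for x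
    by (rule test_function_has_derivative[OF \<phi>])
  have contu: "continuous_on UNIV u"
    using Du(1) by (meson continuous_at_imp_continuous_on has_derivative_continuous)
  note cont\<phi> = test_function_continuous[OF \<phi>] test_function_grad_continuous[OF \<phi>]
  obtain r where r: "\<And>x. r \<le> norm x \<Longrightarrow> \<phi> x = 0" "\<And>x. r \<le> norm x \<Longrightarrow> grad \<phi> x = 0"
    using test_function_bounded_support[OF \<phi>] by blast
  define w where "w x = (\<phi> x)\<^sup>2 / u x" for x
  define Dw where "Dw x = (2 * \<phi> x / u x) *\<^sub>R grad \<phi> x - ((\<phi> x)\<^sup>2 / (u x)\<^sup>2) *\<^sub>R Du x" for x
  have w0: "w x = 0" and Dw0: "Dw x = 0" if "x \<in> - ?S" for x
    using \<phi>0[of x] that by (simp_all add: w_def Dw_def)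
  have dw: "(w has_derivative (\<lambda>h. Dw x \<bullet> h)) (at x)" for x
  proof (cases "x \<in> \<Omega>")
    case True
    then have "u x \<noteq> 0" using pos by force
    have "((\<lambda>x. \<phi> x * \<phi> x / u x) has_derivative
        (\<lambda>h. - (\<phi> x * \<phi> x) * (inverse (u x) * (Du x \<bullet> h) * inverse (u x))
          + (\<phi> x * (grad \<phi> x \<bullet> h) + (grad \<phi> x \<bullet> h) * \<phi> x) / u x)) (at x)"
      by (intro has_derivative_divide has_derivative_mult d\<phi> Du(1) \<open>u x \<noteq> 0\<close>)
    also have "(\<lambda>h. - (\<phi> x * \<phi> x) * (inverse (u x) * (Du x \<bullet> h) * inverse (u x))
          + (\<phi> x * (grad \<phi> x \<bullet> h) + (grad \<phi> x \<bullet> h) * \<phi> x) / u x) = (\<lambda>h. Dw x \<bullet> h)"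
      using \<open>u x \<noteq> 0\<close> unfolding Dw_def
      by (simp add: inner_diff_left fun_eq_iff divide_simps power2_eq_square)
    finally show ?thesis by (simp add: w_def[abs_def] power2_eq_square)
  next
    case False
    then have x: "x \<in> - ?S" using S by auto
    have "(w has_derivative (\<lambda>h. 0)) (at x)"
      by (rule has_derivative_transform_within_open[OF has_derivative_const _ x])
         (use w0 in auto)
    moreover have "Dw x = 0" using Dw0 x by blast
    ultimately show ?thesis by simp
  qed
  \<comment> \<open>The two open sets where continuity is clear cover the space: \<open>\<Omega>\<close> and the complement of the support.\<close>
  have contDw: "continuous_on UNIV Dw"
  proof -
    have "continuous_on \<Omega> Dw" unfolding Dw_def[abs_def]
      using pos by (intro continuous_intros continuous_on_subset[OF cont\<phi>(1)] continuous_on_subset[OF cont\<phi>(2)]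
        continuous_on_subset[OF contu] continuous_on_subset[OF Du(2)]) force+
    moreover have "continuous_on (- ?S) Dw"
      by (rule continuous_on_eq[OF continuous_on_const[of _ 0]]) (use Dw0 in simp)
    ultimately have "continuous_on (\<Omega> \<union> - ?S) Dw"
      using \<Omega> by (intro continuous_on_open_Un) auto
    moreover have "\<Omega> \<union> - ?S = UNIV" using S by auto
    ultimately show ?thesis by simp
  qed
  \<comment> \<open>Off the support of \<open>\<phi>\<close>, where \<open>u\<close> may vanish, both integrands are zero.\<close>
  have "\<mu> * (LINT x|lborel. (\<phi> x)\<^sup>2) = \<mu> * (LINT x|lborel. w x * u x)"
  proof -
    have "(\<phi> x)\<^sup>2 = w x * u x" for x
      using pos[of x] \<phi>0[of x] S by (cases "x \<in> \<Omega>") (auto simp: w_def)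
    then show ?thesis by simp
  qed
  also have "\<dots> = (LINT x|lborel. Dw x \<bullet> Du x)"
    by (rule green_identity[OF dw contDw _ Du D2 eq, symmetric, of r]) (use r in \<open>auto simp: w_def\<close>)
  also have "\<dots> \<le> (LINT x|lborel. (norm (grad \<phi> x))\<^sup>2)"
  proof (rule integral_mono)
    show "integrable lborel (\<lambda>x. Dw x \<bullet> Du x)"
      by (rule integrable_continuous_bounded_support[where r=r])
         (use r Du(2) contDw in \<open>auto intro!: continuous_intros simp: Dw_def\<close>)
    show "integrable lborel (\<lambda>x. (norm (grad \<phi> x))\<^sup>2)"
      using test_function_square_integrable(2)[OF \<phi>] by (simp add: square_integrable_def)
    fix x
    have "(norm (grad \<phi> x))\<^sup>2 - Dw x \<bullet> Du x = (norm (grad \<phi> x - (\<phi> x / u x) *\<^sub>R Du x))\<^sup>2"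
      unfolding Dw_def power2_norm_eq_inner
      by (simp add: inner_diff inner_commute[of "Du x" "grad \<phi> x"] power2_eq_square algebra_simps)
    then show "Dw x \<bullet> Du x \<le> (norm (grad \<phi> x))\<^sup>2"
      by (metis diff_ge_0_iff_ge zero_le_power2)
  qed
  finally show ?thesis .
qed

section \<open>The ground state of the ball\<close>

text \<open>
  If \<open>z\<close> is the first zero of the Bessel function, the factor \<open>4 z\<close> places it on the sphere
  \<open>|x| = 1/2\<close>.
\<close>
definition radial_bessel :: "real \<Rightarrow> 'a::euclidean_space \<Rightarrow> real" where
  "radial_bessel z x = bessel (real DIM('a) / 2) (4 * z * (x \<bullet> x))"

definition radial_bessel_grad :: "real \<Rightarrow> 'a::euclidean_space \<Rightarrow> 'a" where
  "radial_bessel_grad z x = (8 * z * bessel' (real DIM('a) / 2) (4 * z * (x \<bullet> x))) *\<^sub>R x"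

definition radial_bessel_hess :: "real \<Rightarrow> 'a::euclidean_space \<Rightarrow> 'a \<Rightarrow> 'a \<Rightarrow> real" where
  "radial_bessel_hess z b x h =
     8 * z * (bessel' (real DIM('a) / 2) (4 * z * (x \<bullet> x)) * (h \<bullet> b)
       + bessel'' (real DIM('a) / 2) (4 * z * (x \<bullet> x)) * (8 * z * (x \<bullet> h)) * (x \<bullet> b))"

lemma half_DIM_pos: "0 < real DIM('a::euclidean_space) / 2"
  by simp

lemma has_derivative_radial:
  fixes x :: "'a::euclidean_space"
  assumes "\<And>t. (p has_real_derivative p' t) (at t)"
  shows "((\<lambda>x. p (c * (x \<bullet> x))) has_derivative (\<lambda>h. p' (c * (x \<bullet> x)) * (2 * c * (x \<bullet> h)))) (at x)"
  by (rule has_derivative_compose[of "\<lambda>x. c * (x \<bullet> x)" "\<lambda>h. 2 * c * (x \<bullet> h)" x _ p,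
        OF _ assms[unfolded has_field_derivative_def]])
     (auto intro!: derivative_eq_intros simp: inner_commute algebra_simps)

lemma radial_bessel_has_derivative:
  "(radial_bessel z has_derivative (\<lambda>h. radial_bessel_grad z x \<bullet> h)) (at x)"
  for x :: "'a::euclidean_space"
  using has_derivative_radial[OF DERIV_bessel[OF half_DIM_pos[where 'a='a]], of "4 * z" x]
  by (simp add: radial_bessel_def[abs_def] radial_bessel_grad_def mult_ac)

lemma radial_bessel_grad_has_derivative:
  "((\<lambda>x. radial_bessel_grad z x \<bullet> b) has_derivative radial_bessel_hess z b x) (at x)"
  for x :: "'a::euclidean_space"
proof -
  let ?a = "real DIM('a) / 2"
  have "((\<lambda>x. bessel' ?a (4 * z * (x \<bullet> x)) * (x \<bullet> b)) has_derivative
     (\<lambda>h. bessel' ?a (4 * z * (x \<bullet> x)) * (h \<bullet> b)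
        + bessel'' ?a (4 * z * (x \<bullet> x)) * (2 * (4 * z) * (x \<bullet> h)) * (x \<bullet> b))) (at x)"
    by (intro has_derivative_mult has_derivative_radial[OF DERIV_bessel'[OF half_DIM_pos]])
       (auto intro!: derivative_eq_intros)
  then have "((\<lambda>x. 8 * z * (bessel' ?a (4 * z * (x \<bullet> x)) * (x \<bullet> b))) has_derivative
     (\<lambda>h. 8 * z * (bessel' ?a (4 * z * (x \<bullet> x)) * (h \<bullet> b)
        + bessel'' ?a (4 * z * (x \<bullet> x)) * (2 * (4 * z) * (x \<bullet> h)) * (x \<bullet> b)))) (at x)"
    by (rule has_derivative_mult_right)
  then show ?thesis
    by (simp add: radial_bessel_grad_def radial_bessel_hess_def[abs_def] mult.assoc)
qed

lemma continuous_radial: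
  fixes p :: "real \<Rightarrow> real"
  shows "C_k k p \<Longrightarrow> continuous_on A (\<lambda>x::'a::euclidean_space. p (c * (x \<bullet> x)))"
  by (rule continuous_on_compose2[OF C_k_imp_continuous]) (auto intro!: continuous_intros)

lemma continuous_radial_bessel_grad: "continuous_on A (radial_bessel_grad z :: 'a::euclidean_space \<Rightarrow> 'a)"
  unfolding radial_bessel_grad_def[abs_def]
  by (intro continuous_intros continuous_radial[OF C_k_bessel'[OF half_DIM_pos, of 0]])

lemma continuous_radial_bessel_hess:
  "continuous_on A (\<lambda>x::'a::euclidean_space. radial_bessel_hess z b x h)"
  unfolding radial_bessel_hess_def[abs_def]
  by (intro continuous_intros continuous_radial[OF C_k_bessel'[OF half_DIM_pos, of 0]]
      continuous_radial[OF C_k_bessel''[OF half_DIM_pos, of 0]])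

lemma radial_bessel_laplacian:
  "(\<Sum>b\<in>Basis. radial_bessel_hess z b x b) = - (16 * z) * radial_bessel z x"
  for x :: "'a::euclidean_space"
proof -
  let ?a = "real DIM('a) / 2" and ?t = "4 * z * (x \<bullet> x)"
  have "(\<Sum>b\<in>Basis. radial_bessel_hess z b x b) =
     (\<Sum>b\<in>Basis. 8 * z * (bessel' ?a ?t + 8 * z * bessel'' ?a ?t * ((x \<bullet> b) * (x \<bullet> b))))"
    by (rule sum.cong) (auto simp: radial_bessel_hess_def algebra_simps)
  also have "\<dots> = 8 * z * (real DIM('a) * bessel' ?a ?t + 8 * z * bessel'' ?a ?t * (x \<bullet> x))"
    by (simp add: sum_distrib_left[symmetric] sum.distrib euclidean_inner[of x x])
  also have "\<dots> = 16 * z * (?t * bessel'' ?a ?t + ?a * bessel' ?a ?t)"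
    by (simp add: algebra_simps)
  also have "?t * bessel'' ?a ?t + ?a * bessel' ?a ?t = - bessel ?a ?t"
    using bessel_ode[OF half_DIM_pos[where 'a='a], of ?t] by linarith
  finally show ?thesis by (simp add: radial_bessel_def)
qed

lemma flat_exp_1: "flat_exp 1 s = (if s > 0 then exp (- (1 / s)) else 0)"
  by (simp add: flat_exp_def)

lemma DERIV_flat_exp_1: "(flat_exp 1 has_real_derivative flat_exp [:0, 0, 1:] s) (at s)"
  using flat_exp_has_derivative[of 1 s] by simp

text \<open>
  With \<open>s = 1/4 - |x|\<^sup>2\<close> this is \<open>exp (- \<epsilon> / (s - \<epsilon>))\<close> where \<open>s > \<epsilon>\<close>, and zero elsewhere.  Its gradient
  has size \<open>\<epsilon> / (s - \<epsilon>)\<^sup>2 exp (- \<epsilon> / (s - \<epsilon>))\<close>, which a factor of order \<open>s\<close> keeps bounded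
  uniformly in \<open>\<epsilon>\<close>.
\<close>
definition cutoff :: "real \<Rightarrow> 'a::euclidean_space \<Rightarrow> real" where
  "cutoff \<epsilon> x = flat_exp 1 ((1/4 - \<epsilon> - x \<bullet> x) / \<epsilon>)"

definition cutoff_grad :: "real \<Rightarrow> 'a::euclidean_space \<Rightarrow> 'a" where
  "cutoff_grad \<epsilon> x = (- 2 / \<epsilon> * flat_exp [:0, 0, 1:] ((1/4 - \<epsilon> - x \<bullet> x) / \<epsilon>)) *\<^sub>R x"

lemma cutoff_has_derivative:
  fixes x :: "'a::euclidean_space"
  shows "(cutoff \<epsilon> has_derivative (\<lambda>h. cutoff_grad \<epsilon> x \<bullet> h)) (at x)"
  unfolding cutoff_def[abs_def] cutoff_grad_def
  by (rule has_derivative_eq_rhs[OF has_derivative_compose[of "\<lambda>x. (1/4 - \<epsilon> - x \<bullet> x) / \<epsilon>"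
        "\<lambda>h. - 2 / \<epsilon> * (x \<bullet> h)" x _ "flat_exp 1",
        OF _ DERIV_flat_exp_1[unfolded has_field_derivative_def]]])
     (auto intro!: derivative_eq_intros simp: inner_commute diff_divide_distrib)

lemma C_k_cutoff: "C_k k (cutoff \<epsilon>)"
proof -
  have eq: "cutoff \<epsilon> = (\<lambda>x::'a. (\<lambda>t. flat_exp 1 ((1/4 - \<epsilon>) / \<epsilon> + (- 1 / \<epsilon>) * t)) (x \<bullet> x))"
    by (simp add: cutoff_def fun_eq_iff diff_divide_distrib)
  have "C_k k (\<lambda>t. flat_exp 1 ((1/4 - \<epsilon>) / \<epsilon> + (- 1 / \<epsilon>) * t))"
    by (rule C_k_compose_affine[OF C_k_flat_exp])
  from C_k_compose_inner_self[OF this] show ?thesis unfolding eq .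
qed

lemma C_k_radial_bessel: "C_k k (radial_bessel z :: 'a::euclidean_space \<Rightarrow> real)"
proof -
  have eq: "radial_bessel z = (\<lambda>x::'a. (\<lambda>t. bessel (real DIM('a) / 2) (0 + (4 * z) * t)) (x \<bullet> x))"
    by (auto simp: radial_bessel_def fun_eq_iff)
  have "C_k k (\<lambda>t. bessel (real DIM('a) / 2) (0 + (4 * z) * t))"
    by (rule C_k_compose_affine[OF C_k_bessel[OF half_DIM_pos]])
  from C_k_compose_inner_self[OF this] show ?thesis unfolding eq .
qed

lemma mem_half_ball: "x \<in> ball 0 (1/2) \<longleftrightarrow> x \<bullet> x < 1/4" for x :: "'a::euclidean_space"
  unfolding mem_ball_0 norm_lt_square by (simp add: power2_eq_square)

lemma test_function_cutoff_times:
  fixes u :: "'a::euclidean_space \<Rightarrow> real"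
  assumes "\<And>k. C_k k u" "\<epsilon> > 0"
  shows "test_function (ball 0 (1/2)) (\<lambda>x. u x * cutoff \<epsilon> x)"
proof -
  let ?K = "{x::'a. x \<bullet> x \<le> 1/4 - \<epsilon>}"
  have "closed ?K" by (intro closed_Collect_le continuous_intros)
  have sub: "closure {x. u x * cutoff \<epsilon> x \<noteq> 0} \<subseteq> ?K"
  proof (rule closure_minimal[OF _ \<open>closed ?K\<close>], safe)
    fix x assume "u x * cutoff \<epsilon> x \<noteq> 0"
    then show "x \<bullet> x \<le> 1/4 - \<epsilon>" using assms(2)
      by (auto simp: cutoff_def flat_exp_1 zero_less_divide_iff split: if_splits)
  qed
  have K: "?K \<subseteq> ball 0 (1/2)" using assms(2) unfolding mem_half_ball subset_iff by auto
  then have "compact (closure {x. u x * cutoff \<epsilon> x \<noteq> 0})"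
    using bounded_subset[OF bounded_ball subset_trans[OF sub K]] by (simp add: compact_eq_bounded_closed)
  then show ?thesis using assms sub K
    unfolding test_function_def by (auto intro!: C_k_mult C_k_cutoff simp del: C_k.simps)
qed

lemma exp_poly_bound: "w \<ge> 0 \<Longrightarrow> (w\<^sup>2 + w) * exp (- w) \<le> (3::real)"
proof -
  assume w: "w \<ge> 0"
  have "1 + w + w\<^sup>2 / 2 \<le> exp w" by (rule exp_lower_Taylor_quadratic[OF w])
  then have "w\<^sup>2 + w \<le> 3 * exp w" using w by (smt (verit) field_sum_of_halves zero_le_power2)
  then show ?thesis by (simp add: exp_minus field_simps)
qed

lemma H01_lower_bound:
  assumes test: "\<And>\<phi>. test_function \<Omega> \<phi> \<Longrightarrow>
      \<mu> * (LINT x|lborel. (\<phi> x)\<^sup>2) \<le> (LINT x|lborel. (norm (grad \<phi> x))\<^sup>2)"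
    and H: "H01 \<Omega> u G"
  shows "\<mu> * (LINT x|lborel. (u x)\<^sup>2) \<le> (LINT x|lborel. (norm (G x))\<^sup>2)"
proof -
  obtain \<phi> where u: "square_integrable u" "square_integrable G"
    and \<phi>: "\<And>n. test_function \<Omega> (\<phi> n)"
    and lim: "(\<lambda>n. LINT x|lborel. (\<phi> n x - u x)\<^sup>2) \<longlonglongrightarrow> 0"
      "(\<lambda>n. LINT x|lborel. (norm (grad (\<phi> n) x - G x))\<^sup>2) \<longlonglongrightarrow> 0"
    using H by (auto simp: H01_def)
  note L = H01_inner_tendsto[OF u \<phi> lim u]
  show ?thesis
    by (rule LIMSEQ_le[OF tendsto_mult_left[OF L(3)] L(4)]) (use test[OF \<phi>] in auto)
qed

lemma not_AE_zero_if_pos_on_half_ball: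
  fixes u :: "'a::euclidean_space \<Rightarrow> real"
  assumes "\<And>x. x \<in> ball 0 (1/2) \<Longrightarrow> 0 < u x"
  shows "\<not> (AE x in lborel. u x = 0)"
proof
  assume "AE x in lborel. u x = 0"
  then have "AE x in lborel. x \<notin> ball (0::'a) (1/2)"
    by eventually_elim (use assms in force)
  then have "ball (0::'a) (1/2) \<in> null_sets lborel" by (simp add: AE_iff_null_sets)
  then have "negligible (ball (0::'a) (1/2))"
    unfolding negligible_iff_null_sets by (rule null_sets_completionI)
  then show False using open_not_negligible[of "ball (0::'a) (1/2)"] by simp
qed

context
  fixes z :: real
  assumes z: "z > 0" "bessel (real DIM('a::euclidean_space) / 2) z = 0"
    and bessel_pos: "\<And>t. 0 \<le> t \<Longrightarrow> t < z \<Longrightarrow> bessel (real DIM('a) / 2) t > 0"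
begin

lemma radial_bessel_pos: "x \<in> ball 0 (1/2) \<Longrightarrow> 0 < radial_bessel z (x::'a)"
  unfolding mem_half_ball radial_bessel_def using z by (intro bessel_pos) auto

lemma radial_bessel_linear_bound:
  obtains C where "C > 0" "\<And>x::'a. x \<in> ball 0 (1/2) \<Longrightarrow> radial_bessel z x \<le> C * (1/4 - x \<bullet> x)"
proof -
  let ?a = "real DIM('a) / 2"
  have "compact (bessel' ?a ` {0..z})"
    by (intro compact_continuous_image continuous_on_subset[OF C_k_imp_continuous[OF C_k_bessel'[OF half_DIM_pos, of 0]]]) auto
  then obtain M where M: "\<And>t. t \<in> {0..z} \<Longrightarrow> norm (bessel' ?a t) \<le> M"
    using compact_imp_bounded bounded_iff by (metis imageI)
  have "radial_bessel z x \<le> (\<bar>M\<bar> + 1) * (4 * z) * (1/4 - x \<bullet> x)" if "x \<in> ball 0 (1/2)" for x :: 'a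
  proof -
    let ?t = "4 * z * (x \<bullet> x)"
    have t: "0 \<le> ?t" "?t < z" using that z unfolding mem_half_ball by auto
    have "\<exists>s. ?t < s \<and> s < z \<and> bessel ?a z - bessel ?a ?t = (z - ?t) * bessel' ?a s"
      by (rule MVT2[OF t(2)]) (intro DERIV_bessel half_DIM_pos)
    then obtain s where s: "?t < s" "s < z" "bessel ?a z - bessel ?a ?t = (z - ?t) * bessel' ?a s" by blast
    have "\<bar>bessel' ?a s\<bar> \<le> \<bar>M\<bar> + 1" using M[of s] s t by auto
    then have "- bessel' ?a s \<le> \<bar>M\<bar> + 1" by linarith
    then have "(z - ?t) * (- bessel' ?a s) \<le> (z - ?t) * (\<bar>M\<bar> + 1)"
      using t \<open>- bessel' ?a s \<le> \<bar>M\<bar> + 1\<close> by (intro mult_left_mono) linarith+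
    then show ?thesis using s(3) z(2) by (simp add: radial_bessel_def algebra_simps)
  qed
  moreover have "(\<bar>M\<bar> + 1) * (4 * z) > 0" using z by simp
  ultimately show ?thesis by (intro that)
qed

text \<open>
  The products of the Bessel function \<open>u\<close> with the cutoffs are test functions that converge to \<open>u\<close> on
  the ball.  In their gradients the critical term is \<open>u\<close> times the gradient of the cutoff.  Because \<open>u\<close>
  vanishes on the sphere, \<open>u \<le> C s\<close> with \<open>s = 1/4 - |x|\<^sup>2\<close>; writing \<open>w = \<epsilon> / (s - \<epsilon>)\<close>, the term is at most
  \<open>2 C (w\<^sup>2 + w) exp (- w) \<le> 6 C\<close>, so that dominated convergence applies.
\<close>
lemma H01_radial_bessel:
  "H01 (ball 0 (1/2)) (\<lambda>x::'a. indicator (ball 0 (1/2)) x *\<^sub>R radial_bessel z x)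
     (\<lambda>x. indicator (ball 0 (1/2)) x *\<^sub>R radial_bessel_grad z x)"
proof -
  let ?B = "ball (0::'a) (1/2)" and ?u = "radial_bessel z :: 'a \<Rightarrow> real" and ?g = "radial_bessel_grad z :: 'a \<Rightarrow> 'a"
  obtain C where C: "C > 0" "\<And>x. x \<in> ?B \<Longrightarrow> ?u x \<le> C * (1/4 - x \<bullet> x)"
    using radial_bessel_linear_bound by blast
  have contu: "continuous_on A ?u" for A
    by (rule continuous_on_subset[OF C_k_imp_continuous[OF C_k_radial_bessel[of 0]]]) simp
  have measu: "(\<lambda>x. indicator ?B x *\<^sub>R ?u x) \<in> borel_measurable lborel"
    by (intro borel_measurable_scaleR borel_measurable_indicator)
       (auto intro!: borel_measurable_continuous_onI contu)
  have measg: "(\<lambda>x. indicator ?B x *\<^sub>R ?g x) \<in> borel_measurable lborel"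
    by (intro borel_measurable_scaleR borel_measurable_indicator)
       (auto intro!: borel_measurable_continuous_onI continuous_radial_bessel_grad)
  have "compact (?g ` cball 0 (1/2))"
    by (intro compact_continuous_image continuous_radial_bessel_grad) auto
  then obtain M where M: "\<And>x. x \<in> cball 0 (1/2) \<Longrightarrow> norm (?g x) \<le> M"
    using compact_imp_bounded bounded_iff by (metis imageI)
  have M0: "M \<ge> 0" using M[of 0] norm_ge_zero order_trans by (metis centre_in_cball zero_le_divide_1_iff zero_le_numeral)
  have ub: "0 \<le> ?u x" "?u x \<le> C" if "x \<in> ?B" for x
  proof -
    show "0 \<le> ?u x" using radial_bessel_pos[OF that] by simp
    have "C * (1/4 - x \<bullet> x) \<le> C * 1" using C(1) by (intro mult_left_mono) (auto intro: order_trans[of _ "1/4"])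
    then show "?u x \<le> C" using C(2)[OF that] by simp
  qed
  have int1: "integrable lborel (\<lambda>x. K * indicator ?B x :: real)" for K
    using emeasure_lborel_ball_finite[of "0::'a" "1/2"]
    by (intro integrable_mult_right integrable_real_indicator) auto
  have squ: "square_integrable (\<lambda>x. indicator ?B x *\<^sub>R ?u x)"
    unfolding square_integrable_def
  proof
    show "integrable lborel (\<lambda>x. (norm (indicator ?B x *\<^sub>R ?u x))\<^sup>2)"
    proof (rule Bochner_Integration.integrable_bound[OF int1[of "C\<^sup>2"] _ AE_I2])
      show "(\<lambda>x. (norm (indicator ?B x *\<^sub>R ?u x))\<^sup>2) \<in> borel_measurable lborel"
        using measu by measurable
    qed (use ub in \<open>auto simp: indicator_def intro!: power_mono\<close>)
  qed (rule measu)
  have sqg: "square_integrable (\<lambda>x. indicator ?B x *\<^sub>R ?g x)"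
    unfolding square_integrable_def
  proof
    show "integrable lborel (\<lambda>x. (norm (indicator ?B x *\<^sub>R ?g x))\<^sup>2)"
    proof (rule Bochner_Integration.integrable_bound[OF int1[of "M\<^sup>2"] _ AE_I2])
      show "(\<lambda>x. (norm (indicator ?B x *\<^sub>R ?g x))\<^sup>2) \<in> borel_measurable lborel"
        using measg by measurable
    qed (use M in \<open>auto simp: indicator_def intro!: power_mono\<close>)
  qed (rule measg)
  define \<epsilon> where "\<epsilon> n = 1 / real (Suc n)" for n
  have \<epsilon>: "\<epsilon> n > 0" for n by (simp add: \<epsilon>_def)
  have \<epsilon>lim: "\<epsilon> \<longlonglongrightarrow> 0" unfolding \<epsilon>_def by (rule LIMSEQ_Suc[OF lim_const_over_n])
  define \<phi> where "\<phi> n x = ?u x * cutoff (\<epsilon> n) x" for n x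
  have test: "test_function ?B (\<phi> n)" for n
    unfolding \<phi>_def[abs_def] by (rule test_function_cutoff_times[OF C_k_radial_bessel \<epsilon>])
  have grad\<phi>: "grad (\<phi> n) x = ?u x *\<^sub>R cutoff_grad (\<epsilon> n) x + cutoff (\<epsilon> n) x *\<^sub>R ?g x" for n x
    unfolding \<phi>_def[abs_def]
    by (rule grad_eqI, rule has_derivative_eq_rhs,
        rule has_derivative_mult[OF radial_bessel_has_derivative cutoff_has_derivative])
       (auto simp: fun_eq_iff inner_add_left)
  have off: "\<phi> n x = 0" "grad (\<phi> n) x = 0" if "x \<notin> ?B" for n x
    using test_function_off[OF test that] by auto
  have cut01: "0 \<le> cutoff (\<epsilon> n) x" "cutoff (\<epsilon> n) x \<le> 1" for n and x :: 'a
    by (auto simp: cutoff_def flat_exp_1 zero_less_divide_iff zero_le_divide_iff)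
  have small: "\<forall>\<^sub>F n in sequentially. \<epsilon> n < 1/4 - x \<bullet> x" if "x \<in> ?B" for x
    using that order_tendstoD(2)[OF \<epsilon>lim, of "1/4 - x \<bullet> x"] unfolding mem_half_ball by auto
  have cut_lim: "(\<lambda>n. cutoff (\<epsilon> n) x) \<longlonglongrightarrow> 1" if x: "x \<in> ?B" for x
  proof -
    have "(\<lambda>n. exp (- (\<epsilon> n / (1/4 - \<epsilon> n - x \<bullet> x)))) \<longlonglongrightarrow> exp (- (0 / (1/4 - 0 - x \<bullet> x)))"
      using x unfolding mem_half_ball by (intro tendsto_intros \<epsilon>lim) auto
    moreover have "\<forall>\<^sub>F n in sequentially. exp (- (\<epsilon> n / (1/4 - \<epsilon> n - x \<bullet> x))) = cutoff (\<epsilon> n) x"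
      using small[OF x] by eventually_elim (use \<epsilon> in \<open>auto simp: cutoff_def flat_exp_1\<close>)
    ultimately show ?thesis using Lim_transform_eventually by force
  qed
  have cutg_lim: "(\<lambda>n. cutoff_grad (\<epsilon> n) x) \<longlonglongrightarrow> 0" if x: "x \<in> ?B" for x
  proof -
    have "(\<lambda>n. (- 2 * \<epsilon> n / (1/4 - \<epsilon> n - x \<bullet> x)\<^sup>2 * cutoff (\<epsilon> n) x) *\<^sub>R x)
        \<longlonglongrightarrow> (- 2 * 0 / (1/4 - 0 - x \<bullet> x)\<^sup>2 * 1) *\<^sub>R x"
      using x unfolding mem_half_ball by (intro tendsto_intros \<epsilon>lim cut_lim x) auto
    moreover have "\<forall>\<^sub>F n in sequentially. (- 2 * \<epsilon> n / (1/4 - \<epsilon> n - x \<bullet> x)\<^sup>2 * cutoff (\<epsilon> n) x) *\<^sub>R x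
        = cutoff_grad (\<epsilon> n) x"
      using small[OF x]
    proof eventually_elim
      case (elim n)
      have "- 2 * \<epsilon> n / (1/4 - \<epsilon> n - x \<bullet> x)\<^sup>2 * exp (- (1 / ((1/4 - \<epsilon> n - x \<bullet> x) / \<epsilon> n)))
        = - 2 / \<epsilon> n * (poly [:0, 0, 1:] (1 / ((1/4 - \<epsilon> n - x \<bullet> x) / \<epsilon> n))
            * exp (- (1 / ((1/4 - \<epsilon> n - x \<bullet> x) / \<epsilon> n))))"
        using \<epsilon>[of n] elim by (simp add: power2_eq_square)
      moreover have "(1/4 - \<epsilon> n - x \<bullet> x) / \<epsilon> n > 0" using elim \<epsilon>[of n] by simp
      ultimately show ?case
        unfolding cutoff_def cutoff_grad_def flat_exp_1 flat_exp_def[of "[:0, 0, 1:]"] by (simp only: if_True)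
    qed
    ultimately show ?thesis using Lim_transform_eventually by force
  qed
  have cutg_bd: "norm (?u x *\<^sub>R cutoff_grad (\<epsilon> n) x) \<le> 6 * C" if x: "x \<in> ?B" for x n
  proof (cases "1/4 - \<epsilon> n - x \<bullet> x > 0")
    case True
    let ?y = "(1/4 - \<epsilon> n - x \<bullet> x) / \<epsilon> n"
    have y: "?y > 0" using True \<epsilon>[of n] by simp
    have alg: "(1 + w) * (1 / w)\<^sup>2 = (1 / w)\<^sup>2 + 1 / w" if "w > 0" for w :: real
      using that by (simp add: field_simps power2_eq_square)
    have nx: "norm x \<le> 1" using x by simp
    have "norm (?u x *\<^sub>R cutoff_grad (\<epsilon> n) x)
        = ?u x * (2 / \<epsilon> n * ((1 / ?y)\<^sup>2 * exp (- (1 / ?y)))) * norm x"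
      using y \<epsilon>[of n] ub[OF x] by (simp add: cutoff_grad_def flat_exp_def abs_mult power2_eq_square)
    also have "\<dots> \<le> ?u x * (2 / \<epsilon> n * ((1 / ?y)\<^sup>2 * exp (- (1 / ?y)))) * 1"
      using \<epsilon>[of n] ub[OF x] nx by (intro mult_left_mono) auto
    also have "\<dots> \<le> (C * (1/4 - x \<bullet> x)) * (2 / \<epsilon> n * ((1 / ?y)\<^sup>2 * exp (- (1 / ?y)))) * 1"
      using \<epsilon>[of n] C(2)[OF x] by (intro mult_right_mono) auto
    also have "1/4 - x \<bullet> x = \<epsilon> n * (1 + ?y)" using \<epsilon>[of n] by (simp add: field_simps)
    also have "C * (\<epsilon> n * (1 + ?y)) * (2 / \<epsilon> n * ((1 / ?y)\<^sup>2 * exp (- (1 / ?y)))) * 1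
        = 2 * C * (((1 + ?y) * (1 / ?y)\<^sup>2) * exp (- (1 / ?y)))" using \<epsilon>[of n] by simp
    also have "(1 + ?y) * (1 / ?y)\<^sup>2 = (1 / ?y)\<^sup>2 + 1 / ?y"
      by (rule alg[OF y])
    also have "2 * C * (((1 / ?y)\<^sup>2 + 1 / ?y) * exp (- (1 / ?y))) \<le> 2 * C * 3"
    proof (intro mult_left_mono exp_poly_bound)
      show "0 \<le> 1 / ?y" by (rule less_imp_le[OF divide_pos_pos[OF zero_less_one y]])
    qed (use C(1) in simp)
    finally show ?thesis by simp
  next
    case False
    then have "(1/4 - \<epsilon> n - x \<bullet> x) / \<epsilon> n \<le> 0" using \<epsilon>[of n] by (simp add: divide_nonpos_pos)
    then show ?thesis using C(1) by (simp add: cutoff_grad_def flat_exp_def)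
  qed
  have lim1: "(\<lambda>n. LINT x|lborel. (\<phi> n x - indicator ?B x *\<^sub>R ?u x)\<^sup>2) \<longlonglongrightarrow> (LINT x|(lborel :: 'a measure). 0)"
  proof (rule integral_dominated_convergence[OF _ _ int1[of "C\<^sup>2"]])
    show "(\<lambda>x. (\<phi> n x - indicator ?B x *\<^sub>R ?u x)\<^sup>2) \<in> borel_measurable lborel" for n
      using borel_measurable_continuous_onI[OF test_function_continuous[OF test[of n]]]
      by (intro borel_measurable_power borel_measurable_diff measu) simp
    show "AE x in lborel. (\<lambda>n. (\<phi> n x - indicator ?B x *\<^sub>R ?u x)\<^sup>2) \<longlonglongrightarrow> 0"
    proof (rule AE_I2)
      fix x
      show "(\<lambda>n. (\<phi> n x - indicator ?B x *\<^sub>R ?u x)\<^sup>2) \<longlonglongrightarrow> 0"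
      proof (cases "x \<in> ?B")
        case True
        have "(\<lambda>n. (?u x * cutoff (\<epsilon> n) x - ?u x)\<^sup>2) \<longlonglongrightarrow> (?u x * 1 - ?u x)\<^sup>2"
          by (intro tendsto_intros cut_lim True)
        then show ?thesis using True by (simp add: \<phi>_def)
      qed (simp add: off)
    qed
    show "AE x in lborel. norm ((\<phi> n x - indicator ?B x *\<^sub>R ?u x)\<^sup>2) \<le> C\<^sup>2 * indicator ?B x" for n
    proof (rule AE_I2)
      fix x
      show "norm ((\<phi> n x - indicator ?B x *\<^sub>R ?u x)\<^sup>2) \<le> C\<^sup>2 * indicator ?B x"
      proof (cases "x \<in> ?B")
        case True
        have "?u x * cutoff (\<epsilon> n) x \<le> ?u x * 1" "0 \<le> ?u x * cutoff (\<epsilon> n) x"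
          using mult_left_mono[OF cut01(2)[of n x] ub(1)[OF True]]
            mult_nonneg_nonneg[OF ub(1)[OF True] cut01(1)[of n x]] by simp_all
        then have "\<bar>?u x * cutoff (\<epsilon> n) x - ?u x\<bar> \<le> \<bar>C\<bar>" using ub[OF True] by linarith
        then show ?thesis using True by (simp add: \<phi>_def abs_le_square_iff)
      qed (simp add: off)
    qed
  qed simp
  have lim2: "(\<lambda>n. LINT x|lborel. (norm (grad (\<phi> n) x - indicator ?B x *\<^sub>R ?g x))\<^sup>2)
      \<longlonglongrightarrow> (LINT x|(lborel :: 'a measure). 0)"
  proof (rule integral_dominated_convergence[OF _ _ int1[of "(6 * C + M)\<^sup>2"]])
    show "(\<lambda>x. (norm (grad (\<phi> n) x - indicator ?B x *\<^sub>R ?g x))\<^sup>2) \<in> borel_measurable lborel" for n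
      using borel_measurable_continuous_onI[OF test_function_grad_continuous[OF test[of n]]] measg
      by measurable
    show "AE x in lborel. (\<lambda>n. (norm (grad (\<phi> n) x - indicator ?B x *\<^sub>R ?g x))\<^sup>2) \<longlonglongrightarrow> 0"
    proof (rule AE_I2)
      fix x
      show "(\<lambda>n. (norm (grad (\<phi> n) x - indicator ?B x *\<^sub>R ?g x))\<^sup>2) \<longlonglongrightarrow> 0"
      proof (cases "x \<in> ?B")
        case True
        have "(\<lambda>n. (norm (?u x *\<^sub>R cutoff_grad (\<epsilon> n) x + cutoff (\<epsilon> n) x *\<^sub>R ?g x - ?g x))\<^sup>2)
            \<longlonglongrightarrow> (norm (?u x *\<^sub>R 0 + 1 *\<^sub>R ?g x - ?g x))\<^sup>2"
          by (intro tendsto_intros cut_lim cutg_lim True)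
        then show ?thesis using True by (simp add: grad\<phi>)
      qed (simp add: off)
    qed
    show "AE x in lborel. norm ((norm (grad (\<phi> n) x - indicator ?B x *\<^sub>R ?g x))\<^sup>2)
        \<le> (6 * C + M)\<^sup>2 * indicator ?B x" for n
    proof (rule AE_I2)
      fix x
      show "norm ((norm (grad (\<phi> n) x - indicator ?B x *\<^sub>R ?g x))\<^sup>2) \<le> (6 * C + M)\<^sup>2 * indicator ?B x"
      proof (cases "x \<in> ?B")
        case True
        have "grad (\<phi> n) x - ?g x = ?u x *\<^sub>R cutoff_grad (\<epsilon> n) x - (1 - cutoff (\<epsilon> n) x) *\<^sub>R ?g x"
          by (simp add: grad\<phi> algebra_simps)
        then have "norm (grad (\<phi> n) x - ?g x)
            \<le> norm (?u x *\<^sub>R cutoff_grad (\<epsilon> n) x) + norm ((1 - cutoff (\<epsilon> n) x) *\<^sub>R ?g x)"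
          using norm_triangle_ineq4 by metis
        moreover have "norm ((1 - cutoff (\<epsilon> n) x) *\<^sub>R ?g x) \<le> 1 * M"
          unfolding norm_scaleR using cut01[of n x] M[of x] True M0 by (intro mult_mono) auto
        ultimately have "norm (grad (\<phi> n) x - ?g x) \<le> 6 * C + M"
          using cutg_bd[OF True, of n] by linarith
        then show ?thesis using True by (simp add: power_mono)
      qed (simp add: off)
    qed
  qed simp
  show ?thesis unfolding H01_def using squ sqg test lim1 lim2 by (auto intro!: exI[of _ \<phi>])
qed

lemma dirichlet_lower_bound_half_ball:
  assumes "test_function (ball 0 (1/2)) (\<phi> :: 'a \<Rightarrow> real)"
  shows "16 * z * (LINT x|lborel. (\<phi> x)\<^sup>2) \<le> (LINT x|lborel. (norm (grad \<phi> x))\<^sup>2)"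
  by (rule dirichlet_lower_bound[of "radial_bessel z" "radial_bessel_grad z" "radial_bessel_hess z"])
     (use assms radial_bessel_has_derivative radial_bessel_grad_has_derivative continuous_radial_bessel_grad
       continuous_radial_bessel_hess radial_bessel_laplacian radial_bessel_pos in auto)

lemma H01_half_ball_lower_bound:
  assumes "H01 (ball 0 (1/2)) (u :: 'a \<Rightarrow> real) G"
  shows "16 * z * (LINT x|lborel. (u x)\<^sup>2) \<le> (LINT x|lborel. (norm (G x))\<^sup>2)"
  by (rule H01_lower_bound[OF dirichlet_lower_bound_half_ball assms])

lemma radial_bessel_weak_equation:
  assumes "H01 (ball 0 (1/2)) (v :: 'a \<Rightarrow> real) K"
  shows "(LINT x|lborel. (indicator (ball 0 (1/2)) x *\<^sub>R radial_bessel_grad z x) \<bullet> K x)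
    = 16 * z * (LINT x|lborel. (indicator (ball 0 (1/2)) x *\<^sub>R radial_bessel z x) * v x)"
proof -
  let ?u = "\<lambda>x::'a. indicator (ball 0 (1/2)) x *\<^sub>R radial_bessel z x"
    and ?G = "\<lambda>x::'a. indicator (ball 0 (1/2)) x *\<^sub>R radial_bessel_grad z x"
  obtain \<phi> where v: "square_integrable v" "square_integrable K"
    and \<phi>: "\<And>n. test_function (ball 0 (1/2)) (\<phi> n)"
    and lim: "(\<lambda>n. LINT x|lborel. (\<phi> n x - v x)\<^sup>2) \<longlonglongrightarrow> 0"
      "(\<lambda>n. LINT x|lborel. (norm (grad (\<phi> n) x - K x))\<^sup>2) \<longlonglongrightarrow> 0"
    using assms by (auto simp: H01_def)
  have sq: "square_integrable ?u" "square_integrable ?G"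
    using H01_radial_bessel by (auto simp: H01_def)
  note L = H01_inner_tendsto[OF v \<phi> lim sq]
  have "(LINT x|lborel. grad (\<phi> n) x \<bullet> ?G x) = 16 * z * (LINT x|lborel. \<phi> n x * ?u x)" for n
  proof -
    obtain r where r: "\<And>x. r \<le> norm x \<Longrightarrow> \<phi> n x = 0"
      using test_function_bounded_support[OF \<phi>] by metis
    have eqs: "grad (\<phi> n) x \<bullet> ?G x = grad (\<phi> n) x \<bullet> radial_bessel_grad z x"
      "\<phi> n x * ?u x = \<phi> n x * radial_bessel z x" for x
      using test_function_off[OF \<phi>, of x n] by (cases "x \<in> ball 0 (1/2)"; simp)+
    show ?thesis unfolding eqs
      by (rule green_identity[OF test_function_has_derivative[OF \<phi>] test_function_grad_continuous[OF \<phi>] r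
        radial_bessel_has_derivative continuous_radial_bessel_grad radial_bessel_grad_has_derivative
        continuous_radial_bessel_hess radial_bessel_laplacian])
  qed
  then have "(\<lambda>n. 16 * z * (LINT x|lborel. \<phi> n x * ?u x)) \<longlonglongrightarrow> (LINT x|lborel. K x \<bullet> ?G x)"
    using L(2) by simp
  moreover have "(\<lambda>n. 16 * z * (LINT x|lborel. \<phi> n x * ?u x)) \<longlonglongrightarrow> 16 * z * (LINT x|lborel. v x * ?u x)"
    by (rule tendsto_mult_left[OF L(1)])
  ultimately have "(LINT x|lborel. K x \<bullet> ?G x) = 16 * z * (LINT x|lborel. v x * ?u x)"
    by (rule LIMSEQ_unique)
  then show ?thesis by (simp add: inner_commute mult.commute)
qed

lemma dirichlet_eigenfunction_scaled_radial_bessel: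
  assumes "c > 0"
  shows "dirichlet_eigenfunction (ball 0 (1/2)) (16 * z)
     (\<lambda>x::'a. c * (indicator (ball 0 (1/2)) x *\<^sub>R radial_bessel z x))"
  unfolding dirichlet_eigenfunction_def
proof (intro conjI exI allI impI)
  show "\<not> (AE x in lborel. c * (indicator (ball 0 (1/2)) x *\<^sub>R radial_bessel z (x::'a)) = 0)"
    by (rule not_AE_zero_if_pos_on_half_ball) (use assms radial_bessel_pos in auto)
  show "H01 (ball 0 (1/2)) (\<lambda>x::'a. c * (indicator (ball 0 (1/2)) x *\<^sub>R radial_bessel z x))
      (\<lambda>x. c *\<^sub>R (indicator (ball 0 (1/2)) x *\<^sub>R radial_bessel_grad z x))"
    by (rule H01_scale[OF H01_radial_bessel])
  fix v :: "'a \<Rightarrow> real" and K assume "H01 (ball 0 (1/2)) v K"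
  from radial_bessel_weak_equation[OF this]
  show "(LINT x|lborel. (c *\<^sub>R (indicator (ball 0 (1/2)) x *\<^sub>R radial_bessel_grad z x)) \<bullet> K x)
     = 16 * z * (LINT x|lborel. c * (indicator (ball 0 (1/2)) x *\<^sub>R radial_bessel z x) * v x)"
    by (simp only: inner_scaleR_left mult.assoc integral_mult_right_zero) (simp add: mult_ac)
qed

text \<open>
  The weak equation makes \<open>16 z\<close> an eigenvalue.  Testing an arbitrary eigenfunction with itself shows that
  its eigenvalue is a quotient to which the lower bound on the Dirichlet form applies.
\<close>
lemma lambda_min_eq: "lambda_min TYPE('a) = 16 * z"
  unfolding lambda_min_def dirichlet_lambda_min_def
proof (rule Least_equality)
  show "dirichlet_eigenvalue (ball (0::'a) (1/2)) (16 * z)"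
    using dirichlet_eigenfunction_scaled_radial_bessel[of 1] by (auto simp: dirichlet_eigenvalue_def)
  fix \<mu> assume "dirichlet_eigenvalue (ball (0::'a) (1/2)) \<mu>"
  then obtain u G where u: "\<not> (AE x in lborel. u x = 0)" "H01 (ball (0::'a) (1/2)) u G"
    and eq: "(LINT x|lborel. G x \<bullet> G x) = \<mu> * (LINT x|lborel. u x * u x)"
    by (auto simp: dirichlet_eigenvalue_def dirichlet_eigenfunction_def)
  have "integrable lborel (\<lambda>x. (u x)\<^sup>2)" using u(2) by (simp add: H01_def square_integrable_def)
  then have "(LINT x|lborel. (u x)\<^sup>2) \<noteq> 0"
    using u(1) by (simp add: integral_nonneg_eq_0_iff_AE)
  then have I: "(LINT x|lborel. (u x)\<^sup>2) > 0"
    by (metis Bochner_Integration.integral_nonneg less_eq_real_def zero_le_power2)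
  have "16 * z * (LINT x|lborel. (u x)\<^sup>2) \<le> \<mu> * (LINT x|lborel. (u x)\<^sup>2)"
    using H01_half_ball_lower_bound[OF u(2)] eq
    unfolding power2_norm_eq_inner by (simp only: power2_eq_square)
  then show "16 * z \<le> \<mu>" using I by (rule mult_right_le_imp_le)
qed

lemma ex_positive_ground_state: "\<exists>u. positive_ground_state (ball (0::'a) (1/2)) u"
proof -
  let ?u = "\<lambda>x::'a. indicator (ball 0 (1/2)) x *\<^sub>R radial_bessel z x"
  have sq: "integrable lborel (\<lambda>x. (?u x)\<^sup>2)"
    using H01_radial_bessel by (simp add: H01_def square_integrable_def)
  have "\<not> (AE x in lborel. ?u x = 0)"
    by (rule not_AE_zero_if_pos_on_half_ball) (use radial_bessel_pos in auto)
  then have "(LINT x|lborel. (?u x)\<^sup>2) \<noteq> 0" using sq by (simp add: integral_nonneg_eq_0_iff_AE)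
  then have I: "(LINT x|lborel. (?u x)\<^sup>2) > 0"
    by (metis (no_types, lifting) Bochner_Integration.integral_nonneg less_eq_real_def zero_le_power2)
  define c where "c = 1 / sqrt (LINT x|lborel. (?u x)\<^sup>2)"
  have c: "c > 0" using I by (simp add: c_def)
  have "(LINT x|lborel. (c * ?u x)\<^sup>2) = c\<^sup>2 * (LINT x|lborel. (?u x)\<^sup>2)"
    by (simp only: power_mult_distrib[of c] integral_mult_right_zero)
  also have "\<dots> = 1" using I by (simp add: c_def power_divide)
  finally have "(LINT x|lborel. (c * ?u x)\<^sup>2) = 1" .
  then have "positive_ground_state (ball 0 (1/2)) (\<lambda>x. c * ?u x)"
    using dirichlet_eigenfunction_scaled_radial_bessel[OF c] lambda_min_eq radial_bessel_pos c
    by (auto simp: positive_ground_state_def lambda_min_def)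
  then show ?thesis by blast
qed

end

text \<open>
  Since positive normalized ground states exist, the choice operator selects one of them.  What follows
  is derived from the defining properties of the selected one.
\<close>
theorem lambda_min_pos: "lambda_min TYPE('a::euclidean_space) > 0"
  and positive_ground_state_ground_state:
    "positive_ground_state (ball 0 (1/2)) (ground_state :: 'a::euclidean_space \<Rightarrow> real)"
proof -
  obtain z where z: "z > 0" "bessel (real DIM('a) / 2) z = 0"
    "\<And>t. 0 \<le> t \<Longrightarrow> t < z \<Longrightarrow> bessel (real DIM('a) / 2) t > 0"
    using bessel_first_zero[OF half_DIM_pos[where 'a='a]] by blast
  show "lambda_min TYPE('a) > 0" using lambda_min_eq[where 'a='a, OF z] z by simp
  show "positive_ground_state (ball 0 (1/2)) (ground_state :: 'a \<Rightarrow> real)"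
    unfolding ground_state_def using ex_positive_ground_state[where 'a='a, OF z] by (rule someI_ex)
qed

section \<open>The Fourier transform and Gaussians\<close>

lemma lborel_integral_prod_coordinates:
  fixes f :: "'a::euclidean_space \<Rightarrow> real \<Rightarrow> complex"
  assumes int: "\<And>b. b \<in> Basis \<Longrightarrow> integrable lborel (f b)"
  shows "integrable lborel (\<lambda>x::'a. \<Prod>b\<in>Basis. f b (x \<bullet> b))"
    and "(LINT x|lborel. (\<Prod>b\<in>Basis. f b (x \<bullet> b))) = (\<Prod>b\<in>Basis. LINT t|lborel. f b t)"
proof -
  interpret P: product_sigma_finite "\<lambda>_::'a. lborel :: real measure" by standard
  have [measurable]: "f b \<in> borel_measurable borel" if "b \<in> Basis" for b
    using int[OF that] by auto
  let ?P = "\<Pi>\<^sub>M b\<in>(Basis::'a set). (lborel :: real measure)"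
  let ?T = "\<lambda>g. \<Sum>b\<in>(Basis::'a set). g b *\<^sub>R b"
  have T: "?T \<in> measurable ?P borel" by measurable
  have m: "(\<lambda>x::'a. \<Prod>b\<in>Basis. f b (x \<bullet> b)) \<in> borel_measurable borel" by measurable
  have eq: "(\<Prod>b\<in>Basis. f b (?T g \<bullet> b)) = (\<Prod>b\<in>Basis. f b (g b))" for g
    by (rule prod.cong) auto
  show "integrable lborel (\<lambda>x::'a. \<Prod>b\<in>Basis. f b (x \<bullet> b))"
    by (subst lborel_eq, subst integrable_distr_eq[OF T m], unfold eq)
       (rule P.product_integrable_prod[OF finite_Basis int])
  show "(LINT x|lborel. (\<Prod>b\<in>Basis. f b (x \<bullet> b))) = (\<Prod>b\<in>Basis. LINT t|lborel. f b t)"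
    by (subst lborel_eq, subst integral_distr[OF T m], unfold eq)
       (rule P.product_integral_prod[OF finite_Basis int])
qed

definition wave :: "'a::euclidean_space \<Rightarrow> 'a \<Rightarrow> complex" where
  "wave \<tau> x = exp (- (\<i> * complex_of_real (\<tau> \<bullet> x)))"

definition gauss :: "'a::euclidean_space \<Rightarrow> real" where
  "gauss x = exp (- (x \<bullet> x) / 2)"

text \<open>
  There is no normalizing factor; Plancherel's identity holds with the constant \<open>(2 \<pi>)\<^sup>d\<close> instead.
\<close>
definition ft :: "('a::euclidean_space \<Rightarrow> complex) \<Rightarrow> 'a \<Rightarrow> complex" where
  "ft F \<tau> = (LINT x|lborel. F x * wave \<tau> x)"

lemma norm_wave [simp]: "cmod (wave \<tau> x) = 1"
  by (simp add: wave_def)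

lemma wave_add: "wave \<tau> (x + y) = wave \<tau> x * wave \<tau> y"
  by (simp add: wave_def inner_add_right exp_add[symmetric] algebra_simps)

lemma cnj_wave: "cnj (wave \<tau> x) = wave \<tau> (- x)"
  by (simp add: wave_def exp_cnj)

lemma wave_minus_cancel: "wave \<tau> (- x) * wave \<tau> x = 1" "wave \<tau> x * wave \<tau> (- x) = 1"
  unfolding wave_add[symmetric] by (simp_all add: wave_def)

lemma continuous_on_wave [continuous_intros]:
  "continuous_on A f \<Longrightarrow> continuous_on A g \<Longrightarrow> continuous_on A (\<lambda>x. wave (f x) (g x))"
  unfolding wave_def by (intro continuous_intros)

lemma borel_measurable_wave [measurable]:
  "f \<in> borel_measurable M \<Longrightarrow> g \<in> borel_measurable M \<Longrightarrow> (\<lambda>x. wave (f x) (g x)) \<in> borel_measurable M"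
  unfolding wave_def by measurable

lemma borel_measurable_cnj [measurable]:
  "f \<in> borel_measurable M \<Longrightarrow> (\<lambda>x. cnj (f x)) \<in> borel_measurable M"
  by (rule borel_measurable_continuous_on[of cnj]) (intro continuous_intros)

lemma borel_measurable_gauss [measurable]: "gauss \<in> borel_measurable borel"
  unfolding gauss_def[abs_def] by measurable

lemma gauss_bounds: "0 < gauss x" "gauss x \<le> 1"
  by (auto simp: gauss_def)

lemma abs_gauss [simp]: "\<bar>gauss x\<bar> = gauss x"
  using gauss_bounds(1)[of x] by simp

lemma wave_rescale: "\<epsilon> \<noteq> 0 \<Longrightarrow> wave (\<epsilon> *\<^sub>R \<tau>) ((1 / \<epsilon>) *\<^sub>R w) = wave \<tau> w"
  by (simp add: wave_def)

lemma gaussian_fourier_transform_real: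
  fixes t :: real
  shows "integrable lborel (\<lambda>x. complex_of_real (exp (- x\<^sup>2 / 2)) * exp (- (\<i> * complex_of_real (x * t))))"
    and "(LINT x|lborel. complex_of_real (exp (- x\<^sup>2 / 2)) * exp (- (\<i> * complex_of_real (x * t))))
      = complex_of_real (sqrt (2 * pi) * exp (- t\<^sup>2 / 2))"
proof -
  have eq: "complex_of_real (exp (- x\<^sup>2 / 2)) * exp (- (\<i> * complex_of_real (x * t)))
      = complex_of_real (sqrt (2 * pi)) * (std_normal_density x *\<^sub>R iexp (- t * x))" for x
    by (simp add: std_normal_density_def scaleR_conv_of_real mult_ac)
  have "integrable lborel std_normal_density"
    using integrable_std_normal_moment[of 0] by simp
  then have i: "integrable lborel (\<lambda>x. std_normal_density x *\<^sub>R iexp (- t * x))"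
    by (rule Bochner_Integration.integrable_bound) auto
  then show "integrable lborel (\<lambda>x. complex_of_real (exp (- x\<^sup>2 / 2)) * exp (- (\<i> * complex_of_real (x * t))))"
    unfolding eq by (rule integrable_mult_right)
  have "(LINT x|lborel. std_normal_density x *\<^sub>R iexp (- t * x)) = char std_normal_distribution (- t)"
    unfolding char_def by (subst integral_density) (auto simp: normal_density_nonneg)
  also have "\<dots> = complex_of_real (exp (- t\<^sup>2 / 2))"
    by (simp add: char_std_normal_distribution)
  finally show "(LINT x|lborel. complex_of_real (exp (- x\<^sup>2 / 2)) * exp (- (\<i> * complex_of_real (x * t))))
      = complex_of_real (sqrt (2 * pi) * exp (- t\<^sup>2 / 2))"
    unfolding eq integral_mult_right_zero by simp
qed

text \<open>
  Both sides are products over the coordinates; the one-dimensional case is the characteristic function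
  of the standard normal distribution.
\<close>
lemma gaussian_fourier_transform:
  fixes w :: "'a::euclidean_space"
  shows "integrable lborel (\<lambda>\<tau>::'a. complex_of_real (gauss \<tau>) * wave \<tau> w)"
    and "(LINT \<tau>|lborel. complex_of_real (gauss \<tau>) * wave \<tau> w)
      = complex_of_real (sqrt (2 * pi) ^ DIM('a) * gauss w)"
proof -
  let ?f = "\<lambda>b x. complex_of_real (exp (- x\<^sup>2 / 2)) * exp (- (\<i> * complex_of_real (x * (w \<bullet> b))))"
  have eq: "complex_of_real (gauss \<tau>) * wave \<tau> w = (\<Prod>b\<in>Basis. ?f b (\<tau> \<bullet> b))" for \<tau>
  proof -
    have "complex_of_real (gauss \<tau>) = (\<Prod>b\<in>Basis. complex_of_real (exp (- (\<tau> \<bullet> b)\<^sup>2 / 2)))"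
      by (simp add: gauss_def euclidean_inner[of \<tau> \<tau>] power2_eq_square sum_negf[symmetric]
          sum_divide_distrib exp_sum of_real_prod)
    moreover have "wave \<tau> w = (\<Prod>b\<in>Basis. exp (- (\<i> * complex_of_real ((\<tau> \<bullet> b) * (w \<bullet> b)))))"
      by (simp add: wave_def euclidean_inner[of \<tau> w] sum_negf[symmetric] sum_distrib_left exp_sum of_real_sum)
    ultimately show ?thesis by (simp add: prod.distrib)
  qed
  note P = lborel_integral_prod_coordinates[of ?f, OF gaussian_fourier_transform_real(1)]
  show "integrable lborel (\<lambda>\<tau>::'a. complex_of_real (gauss \<tau>) * wave \<tau> w)"
    unfolding eq by (rule P)
  have "(LINT \<tau>|lborel. complex_of_real (gauss \<tau>) * wave \<tau> w) =
      (\<Prod>b\<in>(Basis::'a set). complex_of_real (sqrt (2 * pi) * exp (- (w \<bullet> b)\<^sup>2 / 2)))"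
    unfolding eq P(2) gaussian_fourier_transform_real(2) ..
  also have "\<dots> = complex_of_real (sqrt (2 * pi) ^ DIM('a) * gauss w)"
    by (simp add: gauss_def euclidean_inner[of w w] power2_eq_square sum_negf[symmetric]
          sum_divide_distrib exp_sum of_real_prod prod.distrib)
  finally show "(LINT \<tau>|lborel. complex_of_real (gauss \<tau>) * wave \<tau> w)
      = complex_of_real (sqrt (2 * pi) ^ DIM('a) * gauss w)" .
qed

lemma gauss_integral:
  shows "integrable lborel (gauss :: 'a::euclidean_space \<Rightarrow> real)"
    and "(LINT x|lborel. gauss (x::'a)) = sqrt (2 * pi) ^ DIM('a)"
proof -
  have eq: "complex_of_real (gauss \<tau>) * wave \<tau> 0 = complex_of_real (gauss \<tau>)" for \<tau> :: 'a
    by (simp add: wave_def)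
  have "integrable lborel (\<lambda>\<tau>::'a. complex_of_real (gauss \<tau>))"
    using gaussian_fourier_transform(1)[of "0::'a"] unfolding eq .
  then show "integrable lborel (gauss :: 'a \<Rightarrow> real)"
    by (simp add: complex_of_real_integrable_eq)
  have "complex_of_real (LINT x|lborel. gauss (x::'a)) = complex_of_real (sqrt (2 * pi) ^ DIM('a))"
    using gaussian_fourier_transform(2)[of "0::'a"] unfolding eq by (simp add: gauss_def)
  then show "(LINT x|lborel. gauss (x::'a)) = sqrt (2 * pi) ^ DIM('a)"
    by (simp only: of_real_eq_iff)
qed

lemma scaled_gaussian_fourier_transform:
  fixes w :: "'a::euclidean_space"
  assumes "\<epsilon> > 0"
  shows "integrable lborel (\<lambda>\<tau>::'a. gauss (\<epsilon> *\<^sub>R \<tau>))"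
    and "\<epsilon> ^ DIM('a) *\<^sub>R (LINT \<tau>|lborel. complex_of_real (gauss (\<epsilon> *\<^sub>R \<tau>)) * wave \<tau> w)
      = complex_of_real (sqrt (2 * pi) ^ DIM('a) * gauss ((1 / \<epsilon>) *\<^sub>R w))"
proof -
  have "\<epsilon> ^ DIM('a) *\<^sub>R (LINT \<tau>|lborel. complex_of_real (gauss (\<epsilon> *\<^sub>R \<tau>)) * wave (\<epsilon> *\<^sub>R \<tau>) ((1/\<epsilon>) *\<^sub>R w))
      = (LINT \<tau>|lborel. complex_of_real (gauss \<tau>) * wave \<tau> ((1/\<epsilon>) *\<^sub>R w))"
    by (subst lborel_integral_affine[of _ \<epsilon> 0]) (use assms in auto)
  then show "\<epsilon> ^ DIM('a) *\<^sub>R (LINT \<tau>|lborel. complex_of_real (gauss (\<epsilon> *\<^sub>R \<tau>)) * wave \<tau> w)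
      = complex_of_real (sqrt (2 * pi) ^ DIM('a) * gauss ((1 / \<epsilon>) *\<^sub>R w))"
    using assms unfolding gaussian_fourier_transform(2) by (simp only: wave_rescale)
  show "integrable lborel (\<lambda>\<tau>::'a. gauss (\<epsilon> *\<^sub>R \<tau>))"
  proof (rule ccontr)
    assume "\<not> ?thesis"
    then have "(LINT \<tau>|lborel. gauss (\<epsilon> *\<^sub>R \<tau> :: 'a)) = 0" by (rule not_integrable_integral_eq)
    moreover have "(LINT \<tau>|lborel. gauss (\<tau>::'a)) = \<epsilon> ^ DIM('a) *\<^sub>R (LINT \<tau>|lborel. gauss (0 + \<epsilon> *\<^sub>R \<tau> :: 'a))"
      by (rule lborel_integral_affine) (use assms in auto)
    ultimately show False using gauss_integral(2)[where 'a='a] by simp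
  qed
qed

lemma continuous_ft:
  fixes F :: "'a::euclidean_space \<Rightarrow> complex"
  assumes "integrable lborel F"
  shows "continuous_on UNIV (ft F)"
  unfolding continuous_on_sequentially
proof (intro allI impI ballI)
  fix \<tau> :: "nat \<Rightarrow> 'a" and t assume "(\<forall>n. \<tau> n \<in> UNIV) \<and> \<tau> \<longlonglongrightarrow> t"
  then have t: "\<tau> \<longlonglongrightarrow> t" by simp
  show "(ft F \<circ> \<tau>) \<longlonglongrightarrow> ft F t"
    unfolding ft_def[abs_def] comp_def
  proof (rule integral_dominated_convergence[where w="\<lambda>x. cmod (F x)"])
    show "AE x in lborel. (\<lambda>n. F x * wave (\<tau> n) x) \<longlonglongrightarrow> F x * wave t x"
      unfolding wave_def by (intro AE_I2 tendsto_intros t)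
  qed (use assms in \<open>auto simp: norm_mult\<close>)
qed

lemma norm_ft_le: "cmod (ft F \<tau>) \<le> (LINT x|lborel. cmod (F x))"
  unfolding ft_def using integral_norm_bound[of lborel "\<lambda>x. F x * wave \<tau> x"] by (simp add: norm_mult)

section \<open>Plancherel's identity with Gaussian weights\<close>

context
  fixes F :: "'a::euclidean_space \<Rightarrow> complex" and r :: real
  assumes contF: "continuous_on UNIV F" and suppF: "\<And>x. r \<le> norm x \<Longrightarrow> F x = 0"
begin

text \<open>
  Its Fourier transform is the squared modulus of that of \<open>F\<close>, and its value at the origin is the
  squared norm of \<open>F\<close>.  Plancherel's identity for \<open>F\<close> is therefore Fourier inversion at the origin for this function.
\<close>
definition autocorrelation :: "'a \<Rightarrow> complex" where
  "autocorrelation z = (LINT y|lborel. cnj (F y) * F (y + z))"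

lemma supported_integrable: "integrable lborel F"
  by (rule integrable_continuous_bounded_support[OF contF suppF])

lemma supported_measurable [measurable]: "F \<in> borel_measurable borel"
  by (rule borel_measurable_continuous_onI[OF contF])

lemma autocorrelation_kernel_integrable:
  assumes "continuous_on UNIV g"
  shows "integrable lborel (\<lambda>p::'a \<times> 'a. cnj (F (snd p)) * F (snd p + fst p) * g (fst p))"
proof (rule integrable_continuous_bounded_support[where r = "3 * \<bar>r\<bar>"])
  show "continuous_on UNIV (\<lambda>p. cnj (F (snd p)) * F (snd p + fst p) * g (fst p))"
    by (intro continuous_intros continuous_on_compose2[OF contF] continuous_on_compose2[OF assms]) auto
  fix p :: "'a \<times> 'a" assume p: "3 * \<bar>r\<bar> \<le> norm p"
  show "cnj (F (snd p)) * F (snd p + fst p) * g (fst p) = 0"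
  proof (rule ccontr)
    assume "\<not> ?thesis"
    then have "norm (snd p) < r" "norm (snd p + fst p) < r" using suppF by force+
    moreover have "norm (fst p) \<le> norm (snd p + fst p) + norm (snd p)"
      by (metis add_diff_cancel_left' norm_triangle_ineq4)
    moreover have "norm p \<le> norm (fst p) + norm (snd p)"
      using norm_Pair_le[of "fst p" "snd p"] by simp
    moreover have "norm (snd p) \<ge> 0" by simp
    ultimately show False using p by linarith
  qed
qed

lemma integrable_autocorrelation: "integrable lborel autocorrelation"
proof -
  have "integrable (lborel \<Otimes>\<^sub>M lborel) (\<lambda>(z, y). cnj (F y) * F (y + z))"
    using autocorrelation_kernel_integrable[of "\<lambda>_. 1"]
    by (simp add: lborel_prod case_prod_unfold)
  from lborel_pair.integrable_fst[OF this] show ?thesis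
    by (simp add: autocorrelation_def[abs_def])
qed

lemma ft_autocorrelation: "ft autocorrelation \<tau> = complex_of_real ((cmod (ft F \<tau>))\<^sup>2)"
proof -
  have int: "integrable (lborel \<Otimes>\<^sub>M lborel) (\<lambda>(z, y). cnj (F y) * F (y + z) * wave \<tau> z)"
    using autocorrelation_kernel_integrable[of "wave \<tau>"] continuous_on_wave[of UNIV "\<lambda>_. \<tau>" "\<lambda>x. x"]
    by (simp add: lborel_prod case_prod_unfold)
  have "ft autocorrelation \<tau> = (LINT z|lborel. LINT y|lborel. cnj (F y) * F (y + z) * wave \<tau> z)"
    by (simp add: ft_def autocorrelation_def)
  also have "\<dots> = (LINT y|lborel. LINT z|lborel. cnj (F y) * F (y + z) * wave \<tau> z)"
    by (rule lborel_pair.Fubini_integral[OF int, symmetric])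
  also have "\<dots> = (LINT y|lborel. cnj (F y * wave \<tau> y) * ft F \<tau>)"
  proof (rule Bochner_Integration.integral_cong)
    fix y
    have "(LINT z|lborel. cnj (F y) * F (y + z) * wave \<tau> z)
        = (LINT z|lborel. cnj (F y) * wave \<tau> (- y) * (F (y + z) * wave \<tau> (y + z)))"
      by (rule Bochner_Integration.integral_cong)
         (simp_all add: wave_add mult.assoc mult.left_commute[of "wave \<tau> (- y)"] wave_minus_cancel
           mult.left_commute[of _ "wave \<tau> y"] flip: mult.assoc[of "wave \<tau> (- y)" "wave \<tau> y"])
    also have "\<dots> = cnj (F y) * wave \<tau> (- y) * (LINT z|lborel. F (y + z) * wave \<tau> (y + z))"
      by simp
    also have "(LINT z|lborel. F (y + z) * wave \<tau> (y + z)) = ft F \<tau>"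
      unfolding ft_def by (rule lborel_integral_translate) measurable
    finally show "(LINT z|lborel. cnj (F y) * F (y + z) * wave \<tau> z) = cnj (F y * wave \<tau> y) * ft F \<tau>"
      by (simp add: cnj_wave)
  qed simp
  also have "\<dots> = cnj (ft F \<tau>) * ft F \<tau>"
    by (simp only: integral_mult_left_zero ft_def Bochner_Integration.integral_cnj)
  also have "\<dots> = complex_of_real ((cmod (ft F \<tau>))\<^sup>2)"
    by (metis complex_norm_square mult.commute)
  finally show ?thesis .
qed

text \<open>
  Fubini's theorem moves the Fourier transform from the autocorrelation to the Gaussian weight, whose
  transform is a Gaussian concentrating at the origin as \<open>\<epsilon>\<close> tends to zero.
\<close>
lemma gaussian_weighted_plancherel:
  assumes "\<epsilon> > 0"
  shows "complex_of_real (LINT \<tau>|lborel. (cmod (ft F \<tau>))\<^sup>2 * gauss (\<epsilon> *\<^sub>R \<tau>))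
    = complex_of_real (sqrt (2 * pi) ^ DIM('a)) * (LINT z|lborel. autocorrelation (\<epsilon> *\<^sub>R z) * gauss z)"
proof -
  have [measurable]: "autocorrelation \<in> borel_measurable borel"
    using integrable_autocorrelation by auto
  note G = scaled_gaussian_fourier_transform(1)[OF assms, where 'a='a]
  have int: "integrable (lborel \<Otimes>\<^sub>M lborel)
      (\<lambda>(\<tau>, z). complex_of_real (gauss (\<epsilon> *\<^sub>R \<tau>)) * (autocorrelation z * wave \<tau> z))"
  proof (rule lborel_pair.Fubini_integrable)
    have "integrable lborel (\<lambda>\<tau>. gauss (\<epsilon> *\<^sub>R \<tau> :: 'a) * (LINT z|lborel. cmod (autocorrelation z)))"
      using G by (rule integrable_mult_left)
    then show "integrable lborel (\<lambda>\<tau>. LINT z|lborel. norm (case (\<tau>, z) of (\<tau>, z) \<Rightarrow>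
          complex_of_real (gauss (\<epsilon> *\<^sub>R \<tau>)) * (autocorrelation z * wave \<tau> z)))"
      by (simp add: norm_mult)
    show "AE \<tau> in lborel. integrable lborel (\<lambda>z. case (\<tau>, z) of (\<tau>, z) \<Rightarrow>
          complex_of_real (gauss (\<epsilon> *\<^sub>R \<tau>)) * (autocorrelation z * wave \<tau> z))"
    proof (rule AE_I2)
      fix \<tau>
      have "integrable lborel (\<lambda>z. autocorrelation z * wave \<tau> z)"
        by (rule Bochner_Integration.integrable_bound[OF integrable_autocorrelation])
           (auto simp: norm_mult)
      then show "integrable lborel (\<lambda>z. case (\<tau>, z) of (\<tau>, z) \<Rightarrow>
          complex_of_real (gauss (\<epsilon> *\<^sub>R \<tau>)) * (autocorrelation z * wave \<tau> z))" by simp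
    qed
  qed measurable
  have "complex_of_real (LINT \<tau>|lborel. (cmod (ft F \<tau>))\<^sup>2 * gauss (\<epsilon> *\<^sub>R \<tau>))
      = (LINT \<tau>|lborel. complex_of_real (gauss (\<epsilon> *\<^sub>R \<tau>)) * ft autocorrelation \<tau>)"
    unfolding integral_complex_of_real[symmetric] ft_autocorrelation
    by (simp add: mult.commute del: integral_complex_of_real)
  also have "\<dots> = (LINT \<tau>|lborel. LINT z|lborel. complex_of_real (gauss (\<epsilon> *\<^sub>R \<tau>)) * (autocorrelation z * wave \<tau> z))"
    by (simp add: ft_def)
  also have "\<dots> = (LINT z|lborel. LINT \<tau>|lborel. complex_of_real (gauss (\<epsilon> *\<^sub>R \<tau>)) * (autocorrelation z * wave \<tau> z))"
    by (rule lborel_pair.Fubini_integral[OF int, symmetric])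
  also have "\<dots> = (LINT z|lborel. autocorrelation z *
      (LINT \<tau>|lborel. complex_of_real (gauss (\<epsilon> *\<^sub>R \<tau>)) * wave \<tau> z))"
    by (simp add: mult.left_commute[of _ "autocorrelation _"])
  also have "\<dots> = \<epsilon> ^ DIM('a) *\<^sub>R (LINT z|lborel. autocorrelation (0 + \<epsilon> *\<^sub>R z) *
      (LINT \<tau>|lborel. complex_of_real (gauss (\<epsilon> *\<^sub>R \<tau>)) * wave \<tau> (0 + \<epsilon> *\<^sub>R z)))"
    by (rule lborel_integral_affine[OF _ assms]) measurable
  also have "\<dots> = (LINT z|lborel. autocorrelation (\<epsilon> *\<^sub>R z) *
      (\<epsilon> ^ DIM('a) *\<^sub>R (LINT \<tau>|lborel. complex_of_real (gauss (\<epsilon> *\<^sub>R \<tau>)) * wave \<tau> (\<epsilon> *\<^sub>R z))))"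
    unfolding integral_scaleR_right[symmetric] by simp
  also have "\<dots> = (LINT z|lborel. complex_of_real (sqrt (2 * pi) ^ DIM('a)) * (autocorrelation (\<epsilon> *\<^sub>R z) * gauss z))"
    unfolding scaled_gaussian_fourier_transform(2)[OF assms] using assms by (simp add: mult_ac)
  also have "\<dots> = complex_of_real (sqrt (2 * pi) ^ DIM('a)) * (LINT z|lborel. autocorrelation (\<epsilon> *\<^sub>R z) * gauss z)"
    by (rule integral_mult_right_zero)
  finally show ?thesis .
qed

lemma integrable_ft_gauss:
  assumes "\<epsilon> > 0"
  shows "integrable lborel (\<lambda>\<tau>. (cmod (ft F \<tau>))\<^sup>2 * gauss (\<epsilon> *\<^sub>R \<tau>))"
proof (rule Bochner_Integration.integrable_bound)
  let ?M = "(LINT x|lborel. cmod (F x))"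
  show "integrable lborel (\<lambda>\<tau>::'a. ?M\<^sup>2 * gauss (\<epsilon> *\<^sub>R \<tau>))"
    by (intro integrable_mult_right scaled_gaussian_fourier_transform assms)
  have [measurable]: "ft F \<in> borel_measurable borel"
    by (rule borel_measurable_continuous_onI[OF continuous_ft[OF supported_integrable]])
  show "(\<lambda>\<tau>. (cmod (ft F \<tau>))\<^sup>2 * gauss (\<epsilon> *\<^sub>R \<tau>)) \<in> borel_measurable lborel" by measurable
  have "(cmod (ft F \<tau>))\<^sup>2 * gauss (\<epsilon> *\<^sub>R \<tau>) \<le> ?M\<^sup>2 * gauss (\<epsilon> *\<^sub>R \<tau>)" for \<tau>
    using gauss_bounds(1)[of "\<epsilon> *\<^sub>R \<tau>"] norm_ft_le[of F \<tau>]
    by (intro mult_right_mono power_mono) auto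
  then show "AE \<tau> in lborel. norm ((cmod (ft F \<tau>))\<^sup>2 * gauss (\<epsilon> *\<^sub>R \<tau>)) \<le> norm (?M\<^sup>2 * gauss (\<epsilon> *\<^sub>R \<tau>))"
    by (simp add: abs_mult)
qed

lemma autocorrelation_tendsto:
  assumes z: "z \<longlonglongrightarrow> 0"
  shows "(\<lambda>n. autocorrelation (z n)) \<longlonglongrightarrow> complex_of_real (LINT y|lborel. (cmod (F y))\<^sup>2)"
    and "\<exists>C. \<forall>z. cmod (autocorrelation z) \<le> C"
proof -
  obtain M where M: "M \<ge> 0" "\<And>x. cmod (F x) \<le> M"
    using bounded_continuous_bounded_support[OF contF suppF] by blast
  have bd: "cmod (cnj (F y) * F (y + w)) \<le> cmod (F y) * M" for y w
    using M by (simp add: norm_mult mult_left_mono)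
  have intM: "integrable lborel (\<lambda>y. cmod (F y) * M)"
    using supported_integrable by (intro integrable_mult_left integrable_norm)
  have "(\<lambda>n. LINT y|lborel. cnj (F y) * F (y + z n)) \<longlonglongrightarrow> (LINT y|lborel. cnj (F y) * F (y + 0))"
  proof (rule integral_dominated_convergence[where w="\<lambda>y. cmod (F y) * M"])
    have F: "isCont F x" for x using contF by (simp add: continuous_on_eq_continuous_at)
    show "AE y in lborel. (\<lambda>n. cnj (F y) * F (y + z n)) \<longlonglongrightarrow> cnj (F y) * F (y + 0)"
      by (intro AE_I2 tendsto_mult tendsto_const isCont_tendsto_compose[OF F] tendsto_add z)
    show "(\<lambda>y. cnj (F y) * F (y + z n)) \<in> borel_measurable lborel"
      "(\<lambda>y. cnj (F y) * F (y + 0)) \<in> borel_measurable lborel" for n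
      by measurable
  qed (use intM bd in \<open>auto intro!: AE_I2\<close>)
  moreover have "(LINT y|lborel. cnj (F y) * F (y + 0)) = complex_of_real (LINT y|lborel. (cmod (F y))\<^sup>2)"
    unfolding integral_complex_of_real[symmetric]
    by (rule Bochner_Integration.integral_cong) (auto simp: complex_norm_square mult.commute simp flip: of_real_power)
  ultimately show "(\<lambda>n. autocorrelation (z n)) \<longlonglongrightarrow> complex_of_real (LINT y|lborel. (cmod (F y))\<^sup>2)"
    by (simp add: autocorrelation_def)
  have "cmod (autocorrelation w) \<le> (LINT y|lborel. cmod (F y) * M)" for w
    unfolding autocorrelation_def
    by (rule order_trans[OF integral_norm_bound integral_mono'[OF intM bd]])
       (use M in auto)
  then show "\<exists>C. \<forall>z. cmod (autocorrelation z) \<le> C" by blast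
qed

text \<open>
  Keeping the Gaussian weight avoids the question of whether the square of the Fourier transform is
  integrable; the inequalities below can be read off from the weighted integrals.
\<close>
lemma plancherel_limit:
  assumes \<epsilon>: "\<And>n. \<epsilon> n > 0" "\<epsilon> \<longlonglongrightarrow> 0"
  shows "(\<lambda>n. LINT \<tau>|lborel. (cmod (ft F \<tau>))\<^sup>2 * gauss (\<epsilon> n *\<^sub>R \<tau>))
     \<longlonglongrightarrow> (2 * pi) ^ DIM('a) * (LINT y|lborel. (cmod (F y))\<^sup>2)"
proof -
  let ?I = "LINT y|lborel. (cmod (F y))\<^sup>2" and ?c = "sqrt (2 * pi) ^ DIM('a)"
  have [measurable]: "autocorrelation \<in> borel_measurable borel"
    using integrable_autocorrelation by auto
  obtain C where C: "\<And>z. cmod (autocorrelation z) \<le> C" using autocorrelation_tendsto(2)[of "\<lambda>_. 0"] by auto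
  have "(\<lambda>n. LINT z|lborel. autocorrelation (\<epsilon> n *\<^sub>R z) * gauss z)
      \<longlonglongrightarrow> (LINT z|(lborel::'a measure). complex_of_real ?I * gauss z)"
  proof (rule integral_dominated_convergence[where w="\<lambda>z. C * gauss z"])
    show "integrable lborel (\<lambda>z::'a. C * gauss z)"
      by (intro integrable_mult_right gauss_integral)
    show "AE z in lborel. (\<lambda>n. autocorrelation (\<epsilon> n *\<^sub>R z) * gauss z) \<longlonglongrightarrow> complex_of_real ?I * gauss z"
    proof (rule AE_I2)
      fix z :: 'a
      have "(\<lambda>n. \<epsilon> n *\<^sub>R z) \<longlonglongrightarrow> 0 *\<^sub>R z" by (intro tendsto_intros \<epsilon>)
      then show "(\<lambda>n. autocorrelation (\<epsilon> n *\<^sub>R z) * gauss z) \<longlonglongrightarrow> complex_of_real ?I * gauss z"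
        by (intro tendsto_mult tendsto_const autocorrelation_tendsto(1)) simp
    qed
    show "AE z in lborel. norm (autocorrelation (\<epsilon> n *\<^sub>R z) * gauss z) \<le> C * gauss z" for n
      by (intro AE_I2) (simp add: norm_mult mult_right_mono[OF C less_imp_le[OF gauss_bounds(1)]])
  qed measurable
  then have "(\<lambda>n. complex_of_real ?c * (LINT z|lborel. autocorrelation (\<epsilon> n *\<^sub>R z) * gauss z))
      \<longlonglongrightarrow> complex_of_real ?c * (LINT z|(lborel::'a measure). complex_of_real ?I * gauss z)"
    by (rule tendsto_mult_left)
  also have "(LINT z|(lborel::'a measure). complex_of_real ?I * gauss z) = complex_of_real (?I * ?c)"
    by (simp add: gauss_integral)
  finally have "(\<lambda>n. complex_of_real (LINT \<tau>|lborel. (cmod (ft F \<tau>))\<^sup>2 * gauss (\<epsilon> n *\<^sub>R \<tau>)))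
      \<longlonglongrightarrow> complex_of_real (?c * (?I * ?c))"
    unfolding gaussian_weighted_plancherel[OF \<epsilon>(1)] by simp
  then have "(\<lambda>n. LINT \<tau>|lborel. (cmod (ft F \<tau>))\<^sup>2 * gauss (\<epsilon> n *\<^sub>R \<tau>)) \<longlonglongrightarrow> ?c * (?I * ?c)"
    by (rule tendsto_of_real_iff[THEN iffD1])
  also have "?c * (?I * ?c) = (2 * pi) ^ DIM('a) * ?I"
  proof -
    have "?c * ?c = (sqrt (2 * pi) * sqrt (2 * pi)) ^ DIM('a)"
      by (rule power_mult_distrib[symmetric])
    also have "sqrt (2 * pi) * sqrt (2 * pi) = 2 * pi" by simp
    finally have cc: "?c * ?c = (2 * pi) ^ DIM('a)" .
    have "?c * (?I * ?c) = (?c * ?c) * ?I" by (simp only: mult.commute mult.left_commute)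
    then show ?thesis unfolding cc .
  qed
  finally show ?thesis .
qed

end

section \<open>Trigonometric sums and translates with disjoint supports\<close>

lemma ball_in_sets_borel [measurable]: "ball c r \<in> sets borel"
  by simp

lemma measure_half_ball_le_1: "measure lborel (ball (0::'a::euclidean_space) (1/2)) \<le> 1"
proof -
  let ?C = "cbox (- (1/2) *\<^sub>R One) ((1/2) *\<^sub>R One :: 'a)"
  have "ball (0::'a) (1/2) \<subseteq> ?C"
  proof
    fix x :: 'a assume "x \<in> ball 0 (1/2)"
    then have "\<bar>x \<bullet> b\<bar> \<le> 1/2" if "b \<in> Basis" for b
      using Basis_le_norm[OF that, of x] by simp
    then show "x \<in> ?C" by (force simp: mem_box abs_le_iff)
  qed
  then have "measure lborel (ball (0::'a) (1/2)) \<le> measure lborel ?C"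
    by (intro measure_mono_fmeasurable) auto
  also have "\<dots> = 1"
    by (subst measure_lborel_cbox_eq) (auto simp: inner_diff_left algebra_simps)
  finally show ?thesis .
qed

text \<open>
  The Cauchy-Schwarz inequality against the indicator of the ball, which has volume at most 1.
\<close>
lemma L1_le_L2_on_half_ball:
  fixes v :: "'a::euclidean_space \<Rightarrow> real"
  assumes v: "square_integrable v" and off: "\<And>x. x \<notin> ball 0 (1/2) \<Longrightarrow> v x = 0"
  shows "integrable lborel v" and "(LINT x|lborel. \<bar>v x\<bar>) \<le> sqrt (LINT x|lborel. (v x)\<^sup>2)"
proof -
  let ?B = "ball (0::'a) (1/2)"
  have [measurable]: "v \<in> borel_measurable lborel" using v by (simp add: square_integrable_def)
  have intB: "integrable lborel (indicator ?B :: 'a \<Rightarrow> real)"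
    using emeasure_lborel_ball_finite[of "0::'a" "1/2"] by (intro integrable_real_indicator) auto
  have sqB: "square_integrable (indicator ?B :: 'a \<Rightarrow> real)"
    using intB by (simp add: square_integrable_def power2_eq_square flip: indicator_inter_arith)
  have sqv: "square_integrable (\<lambda>x. \<bar>v x\<bar>)"
    using v by (simp add: square_integrable_def)
  have eq: "\<bar>v x\<bar> \<bullet> indicator ?B x = \<bar>v x\<bar>" for x
    using off[of x] by (cases "x \<in> ?B") auto
  have "integrable lborel (\<lambda>x. \<bar>v x\<bar>)"
    using square_integrable_inner[OF sqv sqB] unfolding eq .
  then show "integrable lborel v"
    by (rule integrable_abs_cancel) measurable
  have "(LINT x|lborel. \<bar>v x\<bar>) \<le> sqrt (LINT x|lborel. (norm \<bar>v x\<bar>)\<^sup>2) *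
     sqrt (LINT x|lborel. (norm (indicator ?B x :: real))\<^sup>2)"
    using L2_Cauchy_Schwarz[OF sqv sqB] unfolding eq by (simp only: abs_le_iff)
  also have "(LINT x|lborel. (norm (indicator ?B x :: real))\<^sup>2) = measure lborel ?B"
    by (simp add: power2_eq_square flip: indicator_inter_arith)
  also have "sqrt (LINT x|lborel. (norm \<bar>v x\<bar>)\<^sup>2) * sqrt (measure lborel ?B)
      \<le> sqrt (LINT x|lborel. (norm \<bar>v x\<bar>)\<^sup>2) * 1"
    using measure_half_ball_le_1[where 'a='a] by (intro mult_left_mono) auto
  finally show "(LINT x|lborel. \<bar>v x\<bar>) \<le> sqrt (LINT x|lborel. (v x)\<^sup>2)" by simp
qed

abbreviation ft_real :: "('a::euclidean_space \<Rightarrow> real) \<Rightarrow> 'a \<Rightarrow> complex" where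
  "ft_real f \<equiv> ft (\<lambda>x. complex_of_real (f x))"

lemma norm_ft_le_L2:
  fixes v :: "'a::euclidean_space \<Rightarrow> real"
  assumes "square_integrable v" "\<And>x. x \<notin> ball 0 (1/2) \<Longrightarrow> v x = 0"
  shows "cmod (ft_real v \<tau>) \<le> sqrt (LINT x|lborel. (v x)\<^sup>2)"
  using norm_ft_le[of "\<lambda>x. complex_of_real (v x)" \<tau>] L1_le_L2_on_half_ball(2)[OF assms] by simp

lemma wave_has_derivative:
  "(wave \<tau> has_derivative (\<lambda>h. wave \<tau> x * (- (\<i> * complex_of_real (\<tau> \<bullet> h))))) (at x)"
  unfolding wave_def[abs_def]
  by (rule has_derivative_compose[of "\<lambda>x. - (\<i> * complex_of_real (\<tau> \<bullet> x))" "\<lambda>h. - (\<i> * complex_of_real (\<tau> \<bullet> h))"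
        x _ exp, OF _ DERIV_exp[unfolded has_field_derivative_def]])
     (auto intro!: derivative_eq_intros)

lemma ft_partial_derivative:
  fixes \<phi> :: "'a::euclidean_space \<Rightarrow> real"
  assumes \<phi>: "test_function \<Omega> \<phi>" and b: "b \<in> Basis"
  shows "ft_real (\<lambda>x. grad \<phi> x \<bullet> b) \<tau> = \<i> * complex_of_real (\<tau> \<bullet> b) * ft_real \<phi> \<tau>"
proof -
  obtain r where r: "\<And>x. r \<le> norm x \<Longrightarrow> \<phi> x = 0" "\<And>x. r \<le> norm x \<Longrightarrow> grad \<phi> x = 0"
    using test_function_bounded_support[OF \<phi>] by blast
  note cont = test_function_continuous[OF \<phi>] test_function_grad_continuous[OF \<phi>]
  have cw: "continuous_on UNIV (wave \<tau>)"
    using continuous_on_wave[of UNIV "\<lambda>_. \<tau>" "\<lambda>x. x"] by simp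
  let ?D = "\<lambda>x h. complex_of_real (\<phi> x) * (wave \<tau> x * (- (\<i> * complex_of_real (\<tau> \<bullet> h))))
       + complex_of_real (grad \<phi> x \<bullet> h) * wave \<tau> x"
  have "(LINT x|lborel. ?D x b) = 0"
  proof (rule integral_directional_derivative_eq_0[where f="\<lambda>x. complex_of_real (\<phi> x) * wave \<tau> x" and r=r and D="?D"])
    show "((\<lambda>x. complex_of_real (\<phi> x) * wave \<tau> x) has_derivative ?D x) (at x)" for x
      by (intro has_derivative_mult wave_has_derivative
          bounded_linear.has_derivative[OF bounded_linear_of_real] test_function_has_derivative[OF \<phi>])
    show "continuous_on UNIV (\<lambda>x. ?D x b)"
      by (intro continuous_intros cont cw)
  qed (use r b in auto)
  moreover have "integrable lborel (\<lambda>x. complex_of_real (\<phi> x) * wave \<tau> x)"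
    by (rule integrable_continuous_bounded_support[where r=r])
       (use r in \<open>auto intro!: continuous_intros cont cw\<close>)
  moreover have "integrable lborel (\<lambda>x. complex_of_real (grad \<phi> x \<bullet> b) * wave \<tau> x)"
    by (rule integrable_continuous_bounded_support[where r=r])
       (use r in \<open>auto intro!: continuous_intros cont cw\<close>)
  moreover have "(LINT x|lborel. ?D x b) = (LINT x|lborel. - (\<i> * complex_of_real (\<tau> \<bullet> b)) *
       (complex_of_real (\<phi> x) * wave \<tau> x) + complex_of_real (grad \<phi> x \<bullet> b) * wave \<tau> x)"
    by (rule Bochner_Integration.integral_cong) auto
  ultimately have "- (\<i> * complex_of_real (\<tau> \<bullet> b)) * (LINT x|lborel. complex_of_real (\<phi> x) * wave \<tau> x)
      + (LINT x|lborel. complex_of_real (grad \<phi> x \<bullet> b) * wave \<tau> x) = 0"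
    by (subst (asm) (2) Bochner_Integration.integral_add) (auto simp del: mult_minus_left)
  then show ?thesis unfolding ft_def by (simp add: eq_neg_iff_add_eq_0)
qed

lemma integrable_ball_continuous:
  fixes g :: "'a::euclidean_space \<Rightarrow> real"
  assumes "continuous_on UNIV g"
  shows "integrable lborel (\<lambda>x. indicator (ball c \<rho>) x * g x)"
proof (rule Bochner_Integration.integrable_bound)
  show "integrable lborel (\<lambda>x. indicator (cball c \<rho>) x *\<^sub>R g x)"
    by (intro borel_integrable_compact continuous_on_subset[OF assms]) auto
  have [measurable]: "g \<in> borel_measurable borel" by (rule borel_measurable_continuous_onI[OF assms])
  show "(\<lambda>x. indicator (ball c \<rho>) x * g x) \<in> borel_measurable lborel" by measurable
qed (auto simp: indicator_def intro!: AE_I2)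

definition trig_sum :: "nat set \<Rightarrow> (nat \<Rightarrow> complex) \<Rightarrow> (nat \<Rightarrow> 'a::euclidean_space) \<Rightarrow> 'a \<Rightarrow> complex" where
  "trig_sum J a y \<tau> = (\<Sum>j\<in>J. a j * wave \<tau> (- y j))"

context
  fixes J :: "nat set" and a :: "nat \<Rightarrow> complex" and y :: "nat \<Rightarrow> 'a::euclidean_space"
  assumes J: "finite J"
    and sep: "\<And>j k. j \<in> J \<Longrightarrow> k \<in> J \<Longrightarrow> j \<noteq> k \<Longrightarrow> 1 \<le> norm (y j - y k)"
begin

lemma continuous_trig_sum: "continuous_on UNIV (trig_sum J a y)"
  unfolding trig_sum_def[abs_def] by (intro continuous_intros)

text \<open>
  The balls of radius \<open>1/2\<close> around the points \<open>- y j\<close> are disjoint, so at most one summand is nonzero.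
\<close>
lemma separated_translates_norm:
  fixes f :: "'a \<Rightarrow> real"
  assumes off: "\<And>x. x \<notin> ball 0 (1/2) \<Longrightarrow> f x = 0"
  shows "(cmod (\<Sum>j\<in>J. a j * complex_of_real (f (x + y j))))\<^sup>2 = (\<Sum>j\<in>J. (cmod (a j))\<^sup>2 * (f (x + y j))\<^sup>2)"
proof (cases "\<exists>i\<in>J. x + y i \<in> ball 0 (1/2)")
  case True
  then obtain i where i: "i \<in> J" "norm (x + y i) < 1/2" by auto
  have "f (x + y j) = 0" if "j \<in> J - {i}" for j
  proof (rule off)
    have "1 \<le> norm (y j - y i)" using sep that i by auto
    also have "y j - y i = (x + y j) - (x + y i)" by simp
    also have "norm \<dots> \<le> norm (x + y j) + norm (x + y i)" by (rule norm_triangle_ineq4)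
    finally show "x + y j \<notin> ball 0 (1/2)" using i by auto
  qed
  then have "(\<Sum>j\<in>J. a j * complex_of_real (f (x + y j))) = a i * complex_of_real (f (x + y i))"
    "(\<Sum>j\<in>J. (cmod (a j))\<^sup>2 * (f (x + y j))\<^sup>2) = (cmod (a i))\<^sup>2 * (f (x + y i))\<^sup>2"
    using i J by (simp_all add: sum.remove[of J i])
  then show ?thesis by (simp add: norm_mult power_mult_distrib)
next
  case False
  then have "f (x + y j) = 0" if "j \<in> J" for j using off that by auto
  then show ?thesis by simp
qed

text \<open>
  The product of the trigonometric sum with the Fourier transform of \<open>f\<close> is the Fourier transform of the
  sum of the translates \<open>a j f(x + y j)\<close>, and these have disjoint supports.
\<close>
lemma plancherel_separated_translates:
  fixes f :: "'a \<Rightarrow> real"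
  assumes contf: "continuous_on UNIV f" and off: "\<forall>x. x \<notin> ball 0 (1/2) \<longrightarrow> f x = 0"
  shows "\<epsilon> > 0 \<Longrightarrow> integrable lborel (\<lambda>\<tau>. (cmod (trig_sum J a y \<tau>))\<^sup>2 * (cmod (ft_real f \<tau>))\<^sup>2 * gauss (\<epsilon> *\<^sub>R \<tau>))"
    and "(\<And>n. e n > 0) \<Longrightarrow> e \<longlonglongrightarrow> 0 \<Longrightarrow>
      (\<lambda>n. LINT \<tau>|lborel. (cmod (trig_sum J a y \<tau>))\<^sup>2 * (cmod (ft_real f \<tau>))\<^sup>2 * gauss (e n *\<^sub>R \<tau>))
      \<longlonglongrightarrow> (2 * pi) ^ DIM('a) * ((\<Sum>j\<in>J. (cmod (a j))\<^sup>2) * (LINT x|lborel. (f x)\<^sup>2))"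
proof -
  define F where "F x = (\<Sum>j\<in>J. a j * complex_of_real (f (x + y j)))" for x
  have fshift0: "f (x + y j) = 0" if "1/2 + (\<Sum>j\<in>J. norm (y j)) \<le> norm x" "j \<in> J" for x j
  proof (rule off[rule_format])
    have "norm (y j) \<le> (\<Sum>j\<in>J. norm (y j))" using that J by (intro member_le_sum) auto
    moreover have "norm x - norm (y j) \<le> norm (x + y j)" by (rule norm_diff_ineq)
    ultimately show "x + y j \<notin> ball 0 (1/2)" using that by auto
  qed
  have contshift: "continuous_on UNIV (\<lambda>x. f (x + y j))" for j
    by (intro continuous_on_compose2[OF contf] continuous_intros) auto
  have contF: "continuous_on UNIV F"
    unfolding F_def[abs_def] by (intro continuous_intros contshift)
  have suppF: "F x = 0" if "1/2 + (\<Sum>j\<in>J. norm (y j)) \<le> norm x" for x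
    unfolding F_def using fshift0[OF that] by simp
  have cw: "continuous_on UNIV (wave \<tau>)" for \<tau> :: 'a
    using continuous_on_wave[of UNIV "\<lambda>_. \<tau>" "\<lambda>x. x"] by simp
  have [measurable]: "f \<in> borel_measurable borel" by (rule borel_measurable_continuous_onI[OF contf])
  have "ft F \<tau> = trig_sum J a y \<tau> * ft_real f \<tau>" for \<tau>
  proof -
    have "ft F \<tau> = (LINT x|lborel. (\<Sum>j\<in>J. a j * (complex_of_real (f (x + y j)) * wave \<tau> x)))"
      unfolding ft_def F_def by (simp add: sum_distrib_right mult.assoc)
    also have "\<dots> = (\<Sum>j\<in>J. LINT x|lborel. a j * (complex_of_real (f (x + y j)) * wave \<tau> x))"
    proof (rule Bochner_Integration.integral_sum)
      fix j assume "j \<in> J"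
      then show "integrable lborel (\<lambda>x. a j * (complex_of_real (f (x + y j)) * wave \<tau> x))"
        by (intro integrable_continuous_bounded_support[where r="1/2 + (\<Sum>j\<in>J. norm (y j))"]
            continuous_intros contshift cw) (simp add: fshift0)
    qed
    also have "\<dots> = (\<Sum>j\<in>J. a j * (wave \<tau> (- y j) * ft_real f \<tau>))"
    proof (rule sum.cong[OF refl])
      fix j
      have "complex_of_real (f (x + y j)) * wave \<tau> x = wave \<tau> (- y j) * (complex_of_real (f (y j + x)) * wave \<tau> (y j + x))" for x
        using wave_minus_cancel(1)[of \<tau> "y j"] by (simp add: wave_add add.commute)
      then have "(LINT x|lborel. complex_of_real (f (x + y j)) * wave \<tau> x)
          = wave \<tau> (- y j) * (LINT x|lborel. complex_of_real (f (y j + x)) * wave \<tau> (y j + x))"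
        by simp
      also have "(LINT x|lborel. complex_of_real (f (y j + x)) * wave \<tau> (y j + x)) = ft_real f \<tau>"
        unfolding ft_def by (rule lborel_integral_translate) measurable
      finally show "(LINT x|lborel. a j * (complex_of_real (f (x + y j)) * wave \<tau> x))
          = a j * (wave \<tau> (- y j) * ft_real f \<tau>)" by simp
    qed
    finally show ?thesis by (simp add: trig_sum_def sum_distrib_right mult.assoc)
  qed
  then have ftF: "(cmod (ft F \<tau>))\<^sup>2 = (cmod (trig_sum J a y \<tau>))\<^sup>2 * (cmod (ft_real f \<tau>))\<^sup>2" for \<tau>
    by (simp add: norm_mult power_mult_distrib)
  show "integrable lborel (\<lambda>\<tau>. (cmod (trig_sum J a y \<tau>))\<^sup>2 * (cmod (ft_real f \<tau>))\<^sup>2 * gauss (\<epsilon> *\<^sub>R \<tau>))" if "\<epsilon> > 0"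
    by (rule integrable_ft_gauss[OF contF suppF, unfolded ftF]) (use that in auto)
  have "(LINT x|lborel. (cmod (F x))\<^sup>2) = (LINT x|lborel. (\<Sum>j\<in>J. (cmod (a j))\<^sup>2 * (f (x + y j))\<^sup>2))"
    unfolding F_def
    by (intro Bochner_Integration.integral_cong refl separated_translates_norm) (use off in blast)
  also have "\<dots> = (\<Sum>j\<in>J. LINT x|lborel. (cmod (a j))\<^sup>2 * (f (x + y j))\<^sup>2)"
  proof (rule Bochner_Integration.integral_sum)
    fix j assume "j \<in> J"
    then show "integrable lborel (\<lambda>x. (cmod (a j))\<^sup>2 * (f (x + y j))\<^sup>2)"
      by (intro integrable_continuous_bounded_support[where r="1/2 + (\<Sum>j\<in>J. norm (y j))"]
          continuous_intros contshift) (simp add: fshift0)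
  qed
  also have "\<dots> = (\<Sum>j\<in>J. (cmod (a j))\<^sup>2 * (LINT x|lborel. (f x)\<^sup>2))"
    using lborel_integral_translate[of "\<lambda>x. (f x)\<^sup>2"] by (simp add: add.commute[of _ "y _"])
  finally have "(LINT x|lborel. (cmod (F x))\<^sup>2) = (\<Sum>j\<in>J. (cmod (a j))\<^sup>2) * (LINT x|lborel. (f x)\<^sup>2)"
    by (simp add: sum_distrib_right)
  then show "(\<lambda>n. LINT \<tau>|lborel. (cmod (trig_sum J a y \<tau>))\<^sup>2 * (cmod (ft_real f \<tau>))\<^sup>2 * gauss (e n *\<^sub>R \<tau>))
      \<longlonglongrightarrow> (2 * pi) ^ DIM('a) * ((\<Sum>j\<in>J. (cmod (a j))\<^sup>2) * (LINT x|lborel. (f x)\<^sup>2))"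
    if "\<And>n. e n > 0" "e \<longlonglongrightarrow> 0"
    using plancherel_limit[of F "1/2 + (\<Sum>j\<in>J. norm (y j))" e] contF suppF that
    unfolding ftF by simp
qed

text \<open>
  On the ball the Gaussian weight is at least \<open>exp (- \<epsilon>\<^sup>2 \<rho>\<^sup>2 / 2)\<close>, which tends to 1, and off the ball the
  integrand of Plancherel's identity is nonnegative.
\<close>
lemma trig_sum_upper_test_function:
  assumes \<phi>: "test_function (ball 0 (1/2)) \<phi>"
  shows "(LINT \<tau>|lborel. indicator (ball 0 \<rho>) \<tau> * ((cmod (trig_sum J a y \<tau>))\<^sup>2 * (cmod (ft_real \<phi> \<tau>))\<^sup>2))
     \<le> (2 * pi) ^ DIM('a) * ((\<Sum>j\<in>J. (cmod (a j))\<^sup>2) * (LINT x|lborel. (\<phi> x)\<^sup>2))"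
proof -
  note cont\<phi> = test_function_continuous[OF \<phi>]
  have off\<phi>: "\<forall>x. x \<notin> ball 0 (1/2) \<longrightarrow> \<phi> x = 0"
    using test_function_off(1)[OF \<phi>] by blast
  note P = plancherel_separated_translates[OF cont\<phi> off\<phi>]
  let ?T = "\<lambda>\<tau>. (cmod (trig_sum J a y \<tau>))\<^sup>2 * (cmod (ft_real \<phi> \<tau>))\<^sup>2"
  define e where "e n = 1 / real (Suc n)" for n
  have e: "e n > 0" for n by (simp add: e_def)
  have elim: "e \<longlonglongrightarrow> 0" unfolding e_def by (rule LIMSEQ_Suc[OF lim_const_over_n])
  have int\<phi>: "integrable lborel \<phi>"
    using test_function_square_integrable(1)[OF \<phi>] test_function_off(1)[OF \<phi>] by (rule L1_le_L2_on_half_ball)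
  have contT: "continuous_on UNIV ?T"
    by (intro continuous_intros continuous_trig_sum continuous_ft) (use int\<phi> in simp)
  have intT: "integrable lborel (\<lambda>\<tau>. indicator (ball 0 \<rho>) \<tau> * ?T \<tau>)"
    by (rule integrable_ball_continuous[OF contT])
  have "exp (- (e n)\<^sup>2 * \<rho>\<^sup>2 / 2) * (LINT \<tau>|lborel. indicator (ball 0 \<rho>) \<tau> * ?T \<tau>)
      \<le> (LINT \<tau>|lborel. ?T \<tau> * gauss (e n *\<^sub>R \<tau>))" for n
  proof -
    have "(LINT \<tau>|lborel. exp (- (e n)\<^sup>2 * \<rho>\<^sup>2 / 2) * (indicator (ball 0 \<rho>) \<tau> * ?T \<tau>))
      \<le> (LINT \<tau>|lborel. ?T \<tau> * gauss (e n *\<^sub>R \<tau>))"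
    proof (rule integral_mono[OF integrable_mult_right[OF intT] P(1)[OF e]])
      fix \<tau> :: 'a
      show "exp (- (e n)\<^sup>2 * \<rho>\<^sup>2 / 2) * (indicator (ball 0 \<rho>) \<tau> * ?T \<tau>) \<le> ?T \<tau> * gauss (e n *\<^sub>R \<tau>)"
      proof (cases "\<tau> \<in> ball 0 \<rho>")
        case True
        then have "\<tau> \<bullet> \<tau> \<le> \<rho>\<^sup>2"
          by (metis mem_ball_0 norm_ge_zero power2_norm_eq_inner power_mono less_imp_le)
        then have "(e n)\<^sup>2 * (\<tau> \<bullet> \<tau>) \<le> (e n)\<^sup>2 * \<rho>\<^sup>2" by (intro mult_left_mono) auto
        then have "exp (- (e n)\<^sup>2 * \<rho>\<^sup>2 / 2) \<le> gauss (e n *\<^sub>R \<tau>)"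
          by (simp add: gauss_def power2_eq_square)
        then have "exp (- (e n)\<^sup>2 * \<rho>\<^sup>2 / 2) * ?T \<tau> \<le> gauss (e n *\<^sub>R \<tau>) * ?T \<tau>"
          by (intro mult_right_mono) auto
        then show ?thesis using True by (simp add: mult.commute)
      next
        case False
        then show ?thesis using gauss_bounds(1)[of "e n *\<^sub>R \<tau>"] by simp
      qed
    qed
    then show ?thesis by simp
  qed
  moreover have "(\<lambda>n. exp (- (e n)\<^sup>2 * \<rho>\<^sup>2 / 2) * (LINT \<tau>|lborel. indicator (ball 0 \<rho>) \<tau> * ?T \<tau>))
      \<longlonglongrightarrow> exp (- 0\<^sup>2 * \<rho>\<^sup>2 / 2) * (LINT \<tau>|lborel. indicator (ball 0 \<rho>) \<tau> * ?T \<tau>)"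
    by (intro tendsto_intros elim) auto
  ultimately show ?thesis using LIMSEQ_le[OF _ P(2)[OF e elim]] by auto
qed

text \<open>
  Multiplying the squared Fourier transform by \<open>|\<tau>|\<^sup>2\<close> amounts to replacing \<open>\<phi>\<close> by its partial derivatives, so
  the weight \<open>c\<^sup>2 - |\<tau>|\<^sup>2\<close> gives \<open>c\<^sup>2 \<Vert>\<phi>\<Vert>\<^sup>2 - \<Vert>grad \<phi>\<Vert>\<^sup>2\<close> on the whole space.  The weight is
  nonpositive off the ball of radius \<open>c\<close>, hence restricting to the ball can only enlarge the integral.
\<close>
lemma trig_sum_lower_test_function:
  assumes \<phi>: "test_function (ball 0 (1/2)) \<phi>" and c: "c > 0"
  shows "(2 * pi) ^ DIM('a) * ((\<Sum>j\<in>J. (cmod (a j))\<^sup>2) *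
       (c\<^sup>2 * (LINT x|lborel. (\<phi> x)\<^sup>2) - (LINT x|lborel. (norm (grad \<phi> x))\<^sup>2)))
    \<le> (LINT \<tau>|lborel. indicator (ball 0 c) \<tau> *
          ((c\<^sup>2 - \<tau> \<bullet> \<tau>) * ((cmod (trig_sum J a y \<tau>))\<^sup>2 * (cmod (ft_real \<phi> \<tau>))\<^sup>2)))"
proof -
  note cont\<phi> = test_function_continuous[OF \<phi>] test_function_grad_continuous[OF \<phi>]
  have off\<phi>: "\<forall>x. x \<notin> ball 0 (1/2) \<longrightarrow> \<phi> x = 0"
    using test_function_off(1)[OF \<phi>] by blast
  note P = plancherel_separated_translates[OF cont\<phi>(1) off\<phi>]
  let ?T = "\<lambda>\<tau>. (cmod (trig_sum J a y \<tau>))\<^sup>2 * (cmod (ft_real \<phi> \<tau>))\<^sup>2"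
  let ?Tb = "\<lambda>b \<tau>. (cmod (trig_sum J a y \<tau>))\<^sup>2 * (cmod (ft_real (\<lambda>x. grad \<phi> x \<bullet> b) \<tau>))\<^sup>2"
  let ?A = "\<Sum>j\<in>J. (cmod (a j))\<^sup>2"
  define e where "e n = 1 / real (Suc n)" for n
  have e: "e n > 0" for n by (simp add: e_def)
  have elim: "e \<longlonglongrightarrow> 0" unfolding e_def by (rule LIMSEQ_Suc[OF lim_const_over_n])
  have contb: "continuous_on UNIV (\<lambda>x. grad \<phi> x \<bullet> b)" for b
    by (intro continuous_intros cont\<phi>)
  have offb: "\<forall>x. x \<notin> ball 0 (1/2) \<longrightarrow> grad \<phi> x \<bullet> b = 0" for b
    using test_function_off(2)[OF \<phi>] by simp
  note Pb = plancherel_separated_translates[OF contb offb]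
  have Tb: "?Tb b \<tau> = (\<tau> \<bullet> b)\<^sup>2 * ?T \<tau>" if "b \<in> Basis" for b \<tau>
    using that by (simp add: ft_partial_derivative[OF \<phi>] norm_mult power_mult_distrib)
  have int\<phi>: "integrable lborel \<phi>"
    using test_function_square_integrable(1)[OF \<phi>] test_function_off(1)[OF \<phi>] by (rule L1_le_L2_on_half_ball)
  have contT: "continuous_on UNIV ?T"
    by (intro continuous_intros continuous_trig_sum continuous_ft) (use int\<phi> in simp)
  have intR: "integrable lborel (\<lambda>\<tau>. indicator (ball 0 c) \<tau> * ((c\<^sup>2 - \<tau> \<bullet> \<tau>) * ?T \<tau>))"
    by (rule integrable_ball_continuous) (intro continuous_intros contT)
  have le: "c\<^sup>2 * (LINT \<tau>|lborel. ?T \<tau> * gauss (e n *\<^sub>R \<tau>))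
        - (\<Sum>b\<in>Basis. LINT \<tau>|lborel. ?Tb b \<tau> * gauss (e n *\<^sub>R \<tau>))
      \<le> (LINT \<tau>|lborel. indicator (ball 0 c) \<tau> * ((c\<^sup>2 - \<tau> \<bullet> \<tau>) * ?T \<tau>))" for n
  proof -
    let ?L = "\<lambda>\<tau>. c\<^sup>2 * (?T \<tau> * gauss (e n *\<^sub>R \<tau>)) - (\<Sum>b\<in>Basis. ?Tb b \<tau> * gauss (e n *\<^sub>R \<tau>))"
    have intL: "integrable lborel ?L"
      by (intro Bochner_Integration.integrable_diff integrable_mult_right P(1)[OF e]
          Bochner_Integration.integrable_sum Pb(1)[OF e])
    have "c\<^sup>2 * (LINT \<tau>|lborel. ?T \<tau> * gauss (e n *\<^sub>R \<tau>))
        - (\<Sum>b\<in>Basis. LINT \<tau>|lborel. ?Tb b \<tau> * gauss (e n *\<^sub>R \<tau>)) = (LINT \<tau>|lborel. ?L \<tau>)"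
      using P(1)[OF e[of n]] Pb(1)[OF e[of n]]
      by (subst Bochner_Integration.integral_diff) (auto simp: Bochner_Integration.integral_sum)
    also have "\<dots> \<le> (LINT \<tau>|lborel. indicator (ball 0 c) \<tau> * ((c\<^sup>2 - \<tau> \<bullet> \<tau>) * ?T \<tau>))"
    proof (rule integral_mono[OF intL intR])
      fix \<tau> :: 'a
      have "(\<Sum>b\<in>Basis. ?Tb b \<tau> * gauss (e n *\<^sub>R \<tau>)) = (\<Sum>b\<in>Basis. (\<tau> \<bullet> b)\<^sup>2 * (?T \<tau> * gauss (e n *\<^sub>R \<tau>)))"
        by (rule sum.cong) (simp_all only: Tb mult.assoc)
      also have "\<dots> = (\<tau> \<bullet> \<tau>) * (?T \<tau> * gauss (e n *\<^sub>R \<tau>))"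
        by (simp add: sum_distrib_right[symmetric] euclidean_inner[of \<tau> \<tau>] power2_eq_square)
      finally have L: "?L \<tau> = ((c\<^sup>2 - \<tau> \<bullet> \<tau>) * ?T \<tau>) * gauss (e n *\<^sub>R \<tau>)" by (simp add: algebra_simps)
      show "?L \<tau> \<le> indicator (ball 0 c) \<tau> * ((c\<^sup>2 - \<tau> \<bullet> \<tau>) * ?T \<tau>)"
      proof (cases "\<tau> \<in> ball 0 c")
        case True
        then have "\<tau> \<bullet> \<tau> \<le> c\<^sup>2"
          by (metis mem_ball_0 norm_ge_zero power2_norm_eq_inner power_mono less_imp_le)
        then have "0 \<le> (c\<^sup>2 - \<tau> \<bullet> \<tau>) * ?T \<tau>" by (intro mult_nonneg_nonneg) auto
        then have "((c\<^sup>2 - \<tau> \<bullet> \<tau>) * ?T \<tau>) * gauss (e n *\<^sub>R \<tau>) \<le> ((c\<^sup>2 - \<tau> \<bullet> \<tau>) * ?T \<tau>) * 1"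
          by (intro mult_left_mono gauss_bounds)
        then show ?thesis unfolding L using True by simp
      next
        case False
        then have "c\<^sup>2 \<le> \<tau> \<bullet> \<tau>"
          using c by (metis mem_ball_0 not_less power2_norm_eq_inner power_mono less_imp_le)
        then have "((c\<^sup>2 - \<tau> \<bullet> \<tau>) * ?T \<tau>) * gauss (e n *\<^sub>R \<tau>) \<le> 0"
          using gauss_bounds(1)[of "e n *\<^sub>R \<tau>"]
          by (intro mult_nonpos_nonneg) auto
        then show ?thesis unfolding L using False by simp
      qed
    qed
    finally show ?thesis .
  qed
  have "(\<lambda>n. c\<^sup>2 * (LINT \<tau>|lborel. ?T \<tau> * gauss (e n *\<^sub>R \<tau>))
        - (\<Sum>b\<in>Basis. LINT \<tau>|lborel. ?Tb b \<tau> * gauss (e n *\<^sub>R \<tau>)))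
    \<longlonglongrightarrow> c\<^sup>2 * ((2 * pi) ^ DIM('a) * (?A * (LINT x|lborel. (\<phi> x)\<^sup>2)))
        - (\<Sum>b\<in>(Basis::'a set). (2 * pi) ^ DIM('a) * (?A * (LINT x|lborel. (grad \<phi> x \<bullet> b)\<^sup>2)))"
    by (intro tendsto_diff tendsto_mult_left tendsto_sum P(2) Pb(2) e elim)
  then have "c\<^sup>2 * ((2 * pi) ^ DIM('a) * (?A * (LINT x|lborel. (\<phi> x)\<^sup>2)))
        - (\<Sum>b\<in>(Basis::'a set). (2 * pi) ^ DIM('a) * (?A * (LINT x|lborel. (grad \<phi> x \<bullet> b)\<^sup>2)))
     \<le> (LINT \<tau>|lborel. indicator (ball 0 c) \<tau> * ((c\<^sup>2 - \<tau> \<bullet> \<tau>) * ?T \<tau>))"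
    by (rule LIMSEQ_le_const2) (use le in auto)
  also have "(\<Sum>b\<in>(Basis::'a set). (2 * pi) ^ DIM('a) * (?A * (LINT x|lborel. (grad \<phi> x \<bullet> b)\<^sup>2)))
     = (2 * pi) ^ DIM('a) * (?A * (LINT x|lborel. (norm (grad \<phi> x))\<^sup>2))"
  proof -
    have "integrable lborel (\<lambda>x. (grad \<phi> x \<bullet> b)\<^sup>2)" for b
    proof -
      have "square_integrable (\<lambda>x. grad \<phi> x \<bullet> b)"
        by (rule square_integrable_continuous_bounded_support[OF contb, of "1/2"]) (use offb in auto)
      then show ?thesis by (simp add: square_integrable_def)
    qed
    then have "(LINT x|lborel. (\<Sum>b\<in>Basis. (grad \<phi> x \<bullet> b)\<^sup>2)) = (\<Sum>b\<in>Basis. LINT x|lborel. (grad \<phi> x \<bullet> b)\<^sup>2)"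
      by (intro Bochner_Integration.integral_sum)
    moreover have "(norm (grad \<phi> x))\<^sup>2 = (\<Sum>b\<in>Basis. (grad \<phi> x \<bullet> b)\<^sup>2)" for x
      unfolding power2_norm_eq_inner by (subst euclidean_inner) (simp add: power2_eq_square)
    ultimately show ?thesis by (simp add: sum_distrib_left[symmetric])
  qed
  finally show ?thesis by (simp add: algebra_simps)
qed

text \<open>
  On a set of finite volume, convergence in square mean implies convergence in mean, and therefore uniform
  convergence of the Fourier transforms.
\<close>
lemma H01_weighted_limit:
  fixes W :: "'a \<Rightarrow> real"
  assumes u: "square_integrable u" "\<And>x. x \<notin> ball 0 (1/2) \<Longrightarrow> u x = 0"
    and \<phi>: "\<And>n. test_function (ball 0 (1/2)) (\<phi> n)"
    and lim: "(\<lambda>n. LINT x|lborel. (\<phi> n x - u x)\<^sup>2) \<longlonglongrightarrow> 0"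
    and W: "continuous_on UNIV W"
  shows "(\<lambda>n. LINT \<tau>|lborel. indicator (ball 0 \<rho>) \<tau> * (W \<tau> * ((cmod (trig_sum J a y \<tau>))\<^sup>2 * (cmod (ft_real (\<phi> n) \<tau>))\<^sup>2)))
    \<longlonglongrightarrow> (LINT \<tau>|lborel. indicator (ball 0 \<rho>) \<tau> * (W \<tau> * ((cmod (trig_sum J a y \<tau>))\<^sup>2 * (cmod (ft_real u \<tau>))\<^sup>2)))"
proof -
  let ?N = "\<lambda>v::'a \<Rightarrow> real. sqrt (LINT x|lborel. (v x)\<^sup>2)"
  note sq\<phi> = test_function_square_integrable(1)[OF \<phi>]
  note off\<phi> = test_function_off(1)[OF \<phi>]
  have int: "integrable lborel u" "integrable lborel (\<phi> n)" for n
    using L1_le_L2_on_half_ball(1)[OF u] L1_le_L2_on_half_ball(1)[OF sq\<phi> off\<phi>] by auto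
  have diff: "cmod (ft_real (\<phi> n) \<tau> - ft_real u \<tau>) \<le> ?N (\<lambda>x. \<phi> n x - u x)" for n \<tau>
  proof -
    have I: "integrable lborel (\<lambda>x. complex_of_real (v x) * wave \<tau> x)" if "integrable lborel v" for v
      by (rule Bochner_Integration.integrable_bound[OF that]) (use that in \<open>auto simp: norm_mult\<close>)
    have "ft_real (\<phi> n) \<tau> - ft_real u \<tau> = ft_real (\<lambda>x. \<phi> n x - u x) \<tau>"
      unfolding ft_def using I[OF int(1)] I[OF int(2)]
      by (simp add: left_diff_distrib)
    also have "cmod \<dots> \<le> ?N (\<lambda>x. \<phi> n x - u x)"
      by (rule norm_ft_le_L2[OF square_integrable_diff[OF sq\<phi> u(1)]]) (use u off\<phi> in auto)
    finally show ?thesis .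
  qed
  have Nlim: "(\<lambda>n. ?N (\<lambda>x. \<phi> n x - u x)) \<longlonglongrightarrow> 0" using tendsto_real_sqrt[OF lim] by simp
  have ptw: "(\<lambda>n. ft_real (\<phi> n) \<tau>) \<longlonglongrightarrow> ft_real u \<tau>" for \<tau>
    by (rule LIM_zero_cancel, rule Lim_null_comparison[OF _ Nlim]) (use diff in auto)
  have "Bseq (\<lambda>n. ?N (\<lambda>x. \<phi> n x - u x))"
    by (rule convergent_imp_Bseq[OF convergentI[OF Nlim]])
  then obtain K0 where "\<forall>n. norm (?N (\<lambda>x. \<phi> n x - u x)) \<le> K0" by (rule BseqE)
  then have K0: "\<bar>?N (\<lambda>x. \<phi> n x - u x)\<bar> \<le> K0" for n by (simp only: real_norm_def)
  define K where "K = K0 + ?N u"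
  have K: "cmod (ft_real (\<phi> n) \<tau>) \<le> K" for n \<tau>
    using diff[of n \<tau>] K0[of n] norm_ft_le_L2[OF u, of \<tau>]
      norm_triangle_ineq2[of "ft_real (\<phi> n) \<tau>" "ft_real u \<tau>"] unfolding K_def by linarith
  let ?T = "\<lambda>\<tau>. (cmod (trig_sum J a y \<tau>))\<^sup>2"
  have [measurable]: "W \<in> borel_measurable borel" "trig_sum J a y \<in> borel_measurable borel"
    "ft_real u \<in> borel_measurable borel" "ft_real (\<phi> n) \<in> borel_measurable borel" for n
    by (intro borel_measurable_continuous_onI W continuous_trig_sum continuous_ft; use int in simp)+
  show ?thesis
  proof (rule integral_dominated_convergence[where w="\<lambda>\<tau>. indicator (ball 0 \<rho>) \<tau> * (\<bar>W \<tau>\<bar> * (?T \<tau> * K\<^sup>2))"])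
    show "integrable lborel (\<lambda>\<tau>. indicator (ball 0 \<rho>) \<tau> * (\<bar>W \<tau>\<bar> * (?T \<tau> * K\<^sup>2)))"
      by (rule integrable_ball_continuous) (intro continuous_intros W continuous_trig_sum)
    show "AE \<tau> in lborel. (\<lambda>n. indicator (ball 0 \<rho>) \<tau> * (W \<tau> * (?T \<tau> * (cmod (ft_real (\<phi> n) \<tau>))\<^sup>2)))
        \<longlonglongrightarrow> indicator (ball 0 \<rho>) \<tau> * (W \<tau> * (?T \<tau> * (cmod (ft_real u \<tau>))\<^sup>2))"
      by (intro AE_I2 tendsto_intros ptw)
    show "AE \<tau> in lborel. norm (indicator (ball 0 \<rho>) \<tau> * (W \<tau> * (?T \<tau> * (cmod (ft_real (\<phi> n) \<tau>))\<^sup>2)))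
        \<le> indicator (ball 0 \<rho>) \<tau> * (\<bar>W \<tau>\<bar> * (?T \<tau> * K\<^sup>2))" for n
    proof (rule AE_I2)
      fix \<tau> :: 'a
      have "\<bar>W \<tau>\<bar> * (?T \<tau> * (cmod (ft_real (\<phi> n) \<tau>))\<^sup>2) \<le> \<bar>W \<tau>\<bar> * (?T \<tau> * K\<^sup>2)"
        using K[of n \<tau>] by (intro mult_left_mono power_mono) auto
      then show "norm (indicator (ball 0 \<rho>) \<tau> * (W \<tau> * (?T \<tau> * (cmod (ft_real (\<phi> n) \<tau>))\<^sup>2)))
        \<le> indicator (ball 0 \<rho>) \<tau> * (\<bar>W \<tau>\<bar> * (?T \<tau> * K\<^sup>2))"
        by (cases "\<tau> \<in> ball 0 \<rho>") (auto simp: abs_mult)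
    qed
  qed measurable
qed

lemma trig_sum_upper_H01:
  assumes "H01 (ball 0 (1/2)) u G"
  shows "(LINT \<tau>|lborel. indicator (ball 0 \<rho>) \<tau> * ((cmod (trig_sum J a y \<tau>))\<^sup>2 * (cmod (ft_real u \<tau>))\<^sup>2))
     \<le> (2 * pi) ^ DIM('a) * ((\<Sum>j\<in>J. (cmod (a j))\<^sup>2) * (LINT x|lborel. (u x)\<^sup>2))"
proof -
  obtain \<phi> where u: "square_integrable u" "square_integrable G" "\<And>x. x \<notin> ball 0 (1/2) \<Longrightarrow> u x = 0"
    and \<phi>: "\<And>n. test_function (ball 0 (1/2)) (\<phi> n)"
    and lim: "(\<lambda>n. LINT x|lborel. (\<phi> n x - u x)\<^sup>2) \<longlonglongrightarrow> 0"
      "(\<lambda>n. LINT x|lborel. (norm (grad (\<phi> n) x - G x))\<^sup>2) \<longlonglongrightarrow> 0"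
    using assms unfolding H01_def by blast
  note L = H01_inner_tendsto[OF u(1,2) \<phi> lim u(1,2)]
  show ?thesis
    using LIMSEQ_le[OF H01_weighted_limit[OF u(1,3) \<phi> lim(1) continuous_on_const[of _ 1]]
        tendsto_mult_left[OF tendsto_mult_left[OF L(3)]]] trig_sum_upper_test_function[OF \<phi>]
    by simp
qed

lemma trig_sum_lower_H01:
  assumes "H01 (ball 0 (1/2)) u G" and c: "c > 0"
  shows "(2 * pi) ^ DIM('a) * ((\<Sum>j\<in>J. (cmod (a j))\<^sup>2) *
       (c\<^sup>2 * (LINT x|lborel. (u x)\<^sup>2) - (LINT x|lborel. (norm (G x))\<^sup>2)))
    \<le> (LINT \<tau>|lborel. indicator (ball 0 c) \<tau> *
          ((c\<^sup>2 - \<tau> \<bullet> \<tau>) * ((cmod (trig_sum J a y \<tau>))\<^sup>2 * (cmod (ft_real u \<tau>))\<^sup>2)))"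
proof -
  obtain \<phi> where u: "square_integrable u" "square_integrable G" "\<And>x. x \<notin> ball 0 (1/2) \<Longrightarrow> u x = 0"
    and \<phi>: "\<And>n. test_function (ball 0 (1/2)) (\<phi> n)"
    and lim: "(\<lambda>n. LINT x|lborel. (\<phi> n x - u x)\<^sup>2) \<longlonglongrightarrow> 0"
      "(\<lambda>n. LINT x|lborel. (norm (grad (\<phi> n) x - G x))\<^sup>2) \<longlonglongrightarrow> 0"
    using assms unfolding H01_def by blast
  note L = H01_inner_tendsto[OF u(1,2) \<phi> lim u(1,2)]
  have W: "continuous_on UNIV (\<lambda>\<tau>::'a. c\<^sup>2 - \<tau> \<bullet> \<tau>)" by (intro continuous_intros)
  show ?thesis
    by (rule LIMSEQ_le[OF tendsto_mult_left[OF tendsto_mult_left[OF tendsto_diff[OF tendsto_mult_left[OF L(3)] L(4)]]]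
          H01_weighted_limit[OF u(1,3) \<phi> lim(1) W]])
       (use trig_sum_lower_test_function[OF \<phi> c] in auto)
qed

end

section \<open>The Fourier transform of the ground state\<close>

lemma ground_state_properties:
  obtains G where "H01 (ball 0 (1/2)) (ground_state :: 'a::euclidean_space \<Rightarrow> real) G"
    "(LINT x|lborel. (ground_state (x::'a))\<^sup>2) = 1"
    "(LINT x|lborel. (norm (G x))\<^sup>2) = lambda_min TYPE('a)"
    "\<And>x::'a. x \<in> ball 0 (1/2) \<Longrightarrow> 0 < ground_state x"
    "\<And>x::'a. x \<notin> ball 0 (1/2) \<Longrightarrow> ground_state x = 0"
    "square_integrable (ground_state :: 'a \<Rightarrow> real)"
proof -
  let ?u = "ground_state :: 'a \<Rightarrow> real"
  have u: "dirichlet_eigenfunction (ball 0 (1/2)) (lambda_min TYPE('a)) ?u"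
    "\<forall>x\<in>ball 0 (1/2). 0 < ?u x" "(LINT x|lborel. (?u x)\<^sup>2) = 1"
    using positive_ground_state_ground_state[where 'a='a]
    unfolding positive_ground_state_def lambda_min_def by blast+
  then obtain G where G: "H01 (ball 0 (1/2)) ?u G"
    "\<And>v K. H01 (ball 0 (1/2)) v K \<Longrightarrow>
       (LINT x|lborel. G x \<bullet> K x) = lambda_min TYPE('a) * (LINT x|lborel. ?u x * v x)"
    unfolding dirichlet_eigenfunction_def by blast
  \<comment> \<open>The ground state serves as test function in its own equation.\<close>
  have "(LINT x|lborel. (norm (G x))\<^sup>2) = lambda_min TYPE('a)"
    unfolding power2_norm_eq_inner G(2)[OF G(1)] using u(3) by (simp add: power2_eq_square)
  moreover have "?u x = 0" if "x \<notin> ball 0 (1/2)" for x using G(1) that unfolding H01_def by blast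
  moreover have "square_integrable ?u" using G(1) unfolding H01_def by blast
  ultimately show ?thesis using G(1) u(2,3) by (intro that) blast+
qed

lemma ground_state_fourier_eq:
  "ground_state_fourier \<omega> = (2 * pi) powr (- (real DIM('a) / 2)) * Re (ft_real ground_state \<omega>)"
  for \<omega> :: "'a::euclidean_space"
  by (simp add: ground_state_fourier_def fourier_def ft_def wave_def)

lemma continuous_ground_state_fourier: "continuous_on A (ground_state_fourier :: 'a::euclidean_space \<Rightarrow> real)"
proof -
  obtain G where u: "square_integrable (ground_state :: 'a \<Rightarrow> real)"
    "\<And>x::'a. x \<notin> ball 0 (1/2) \<Longrightarrow> ground_state x = 0"
    using ground_state_properties[where 'a='a] by metis
  have "integrable lborel (\<lambda>x::'a. complex_of_real (ground_state x))"
    using L1_le_L2_on_half_ball(1)[OF u] by simp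
  then have "continuous_on A (ft_real (ground_state :: 'a \<Rightarrow> real))"
    by (rule continuous_on_subset[OF continuous_ft]) simp
  then have "continuous_on A (\<lambda>\<omega>::'a. (2 * pi) powr (- (real DIM('a) / 2)) * Re (ft_real ground_state \<omega>))"
    by (intro continuous_intros)
  then show ?thesis by (simp add: ground_state_fourier_eq[abs_def])
qed

text \<open>
  For \<open>|x| < 1/2\<close> and \<open>|\<omega>| \<le> \<pi>\<close> the angle \<open>\<omega> \<bullet> x\<close> is less than \<open>\<pi> / 2\<close> in modulus and has a positive cosine.
\<close>
lemma ground_state_fourier_pos:
  fixes \<omega> :: "'a::euclidean_space"
  assumes "norm \<omega> \<le> pi"
  shows "0 < ground_state_fourier \<omega>"
proof -
  let ?u = "ground_state :: 'a \<Rightarrow> real"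
  have pos: "\<And>x. x \<in> ball 0 (1/2) \<Longrightarrow> 0 < ?u x" and off: "\<And>x. x \<notin> ball 0 (1/2) \<Longrightarrow> ?u x = 0"
    and sq: "square_integrable ?u"
    using ground_state_properties[where 'a='a] by metis+
  have int: "integrable lborel ?u" by (rule L1_le_L2_on_half_ball(1)[OF sq off])
  have I: "integrable lborel (\<lambda>x. complex_of_real (?u x) * wave \<omega> x)"
    by (rule Bochner_Integration.integrable_bound[OF int]) (use int in \<open>auto simp: norm_mult\<close>)
  have Re: "Re (complex_of_real (?u x) * wave \<omega> x) = ?u x * cos (\<omega> \<bullet> x)" for x
    by (simp add: wave_def Re_exp)
  have intc: "integrable lborel (\<lambda>x. ?u x * cos (\<omega> \<bullet> x))"
    using integrable_Re[OF I] unfolding Re .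
  have cos: "0 < ?u x * cos (\<omega> \<bullet> x)" if x: "x \<in> ball 0 (1/2)" for x
  proof -
    have "\<bar>\<omega> \<bullet> x\<bar> \<le> norm \<omega> * norm x" by (rule Cauchy_Schwarz_ineq2)
    also have "\<dots> \<le> pi * norm x" using assms by (intro mult_right_mono) auto
    also have "\<dots> < pi * (1/2)" using x by (intro mult_strict_left_mono) auto
    finally have "0 < cos (\<omega> \<bullet> x)" by (intro cos_gt_zero_pi) auto
    then show ?thesis using pos[OF x] by simp
  qed
  have nonneg: "0 \<le> ?u x * cos (\<omega> \<bullet> x)" for x
    using cos[of x] off[of x] by (cases "x \<in> ball 0 (1/2)") auto
  have "(LINT x|lborel. ?u x * cos (\<omega> \<bullet> x)) \<noteq> 0"
    using integral_nonneg_eq_0_iff_AE[OF intc AE_I2[OF nonneg]]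
      not_AE_zero_if_pos_on_half_ball[of "\<lambda>x. ?u x * cos (\<omega> \<bullet> x)", OF cos] by blast
  moreover have "0 \<le> (LINT x|lborel. ?u x * cos (\<omega> \<bullet> x))"
    using nonneg by (intro Bochner_Integration.integral_nonneg)
  ultimately have "0 < (LINT x|lborel. ?u x * cos (\<omega> \<bullet> x))" by linarith
  also have "\<dots> = Re (ft_real ?u \<omega>)"
    unfolding ft_def using integral_Re[OF I] unfolding Re .
  finally show ?thesis by (simp add: ground_state_fourier_eq)
qed

lemma ground_state_fourier_min:
  obtains m where "m = (INF \<omega>\<in>cball (0::'a::euclidean_space) pi. ground_state_fourier \<omega>)" "m > 0"
    "\<And>\<omega>::'a. norm \<omega> \<le> pi \<Longrightarrow> m \<le> ground_state_fourier \<omega>"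
proof -
  have "\<exists>p\<in>cball (0::'a) pi. \<forall>\<omega>\<in>cball (0::'a) pi. ground_state_fourier p \<le> ground_state_fourier \<omega>"
  proof -
    have "compact (cball (0::'a) pi)" "cball (0::'a) pi \<noteq> {}" by auto
    from continuous_attains_inf[OF this continuous_ground_state_fourier] show ?thesis .
  qed
  then obtain p :: 'a where p: "p \<in> cball 0 pi" "\<And>\<omega>::'a. \<omega> \<in> cball 0 pi \<Longrightarrow> ground_state_fourier p \<le> ground_state_fourier \<omega>"
    by blast
  have "(INF \<omega>\<in>cball (0::'a) pi. ground_state_fourier \<omega>) = ground_state_fourier p"
    using p by (intro cInf_eq_minimum) auto
  then show ?thesis using p ground_state_fourier_pos[of p] by (intro that[of "ground_state_fourier p"]) auto
qed

section \<open>The inequalities for points at distance at least one\<close>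

lemma separation_distance_bounds:
  assumes "finite X" "card X \<ge> 2"
  shows "separation_distance X > 0"
    and "x \<in> X \<Longrightarrow> y \<in> X \<Longrightarrow> x \<noteq> y \<Longrightarrow> separation_distance X \<le> norm (x - y)"
proof -
  let ?S = "{norm (x - y) |x y. x \<in> X \<and> y \<in> X \<and> x \<noteq> y}"
  have "?S \<subseteq> (\<lambda>(x, y). norm (x - y)) ` (X \<times> X)" by auto
  then have fin: "finite ?S" using assms(1) finite_subset by blast
  obtain x y where "x \<in> X" "y \<in> X" "x \<noteq> y"
    using assms by (metis card_le_Suc0_iff_eq not_less_eq_eq numeral_2_eq_2)
  then have ne: "?S \<noteq> {}" by blast
  show "separation_distance X > 0"
    unfolding separation_distance_def using fin ne by (subst Min_gr_iff) auto
  show "separation_distance X \<le> norm (x - y)" if "x \<in> X" "y \<in> X" "x \<noteq> y" for x y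
    unfolding separation_distance_def using fin that by (intro Min_le) auto
qed

text \<open>
  The substitution \<open>\<omega> = x0 + (R / \<rho>) \<tau>\<close> multiplies the coefficients by phases that come from the
  centre \<open>x0\<close>, and the points by \<open>R / \<rho>\<close>.
\<close>
lemma exp_sum_ball_rescale:
  fixes x :: "nat \<Rightarrow> 'a::euclidean_space" and \<alpha> :: "nat \<Rightarrow> real" and x0 :: 'a
  assumes "R > 0" "\<rho> > 0"
  defines "a \<equiv> \<lambda>j. complex_of_real (\<alpha> j) * wave x0 (- x j)" and "y \<equiv> \<lambda>j. (R / \<rho>) *\<^sub>R x j"
  shows "(LINT \<omega>:ball x0 R|lborel. (cmod (exp_sum N x \<alpha> \<omega>))\<^sup>2)
     = (R / \<rho>) ^ DIM('a) * (LINT \<tau>|lborel. indicator (ball 0 \<rho>) \<tau> * (cmod (trig_sum {1..N} a y \<tau>))\<^sup>2)"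
proof -
  have e: "exp_sum N x \<alpha> (x0 + (R / \<rho>) *\<^sub>R \<tau>) = trig_sum {1..N} a y \<tau>" for \<tau>
    unfolding exp_sum_def trig_sum_def a_def y_def wave_def
    by (rule sum.cong) (auto simp: inner_add_left mult.assoc exp_add[symmetric] algebra_simps)
  have m: "(\<lambda>\<omega>. indicator (ball x0 R) \<omega> *\<^sub>R (cmod (exp_sum N x \<alpha> \<omega>))\<^sup>2) \<in> borel_measurable borel"
    unfolding exp_sum_def by measurable
  have b: "x0 + (R / \<rho>) *\<^sub>R \<tau> \<in> ball x0 R \<longleftrightarrow> \<tau> \<in> ball 0 \<rho>" for \<tau> :: 'a
    using assms by (simp add: dist_norm field_simps)
  show ?thesis
    unfolding set_lebesgue_integral_def
    by (subst lborel_integral_affine[OF m, of "R / \<rho>" x0]) (use assms b in \<open>simp_all add: e indicator_def\<close>)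
qed

text \<open>
  On the ball of radius \<open>\<pi>\<close> the modulus of the Fourier transform of the ground state is bounded from below,
  so this weight can be inserted into the integral and Plancherel's identity applied.
\<close>
theorem unit_separated_upper:
  fixes y :: "nat \<Rightarrow> 'a::euclidean_space"
  assumes J: "finite J" "\<And>j k. j \<in> J \<Longrightarrow> k \<in> J \<Longrightarrow> j \<noteq> k \<Longrightarrow> 1 \<le> norm (y j - y k)"
    and m: "m > 0" "\<And>\<omega>::'a. norm \<omega> \<le> pi \<Longrightarrow> m \<le> ground_state_fourier \<omega>"
  shows "(LINT \<tau>|lborel. indicator (ball 0 pi) \<tau> * (cmod (trig_sum J a y \<tau>))\<^sup>2) \<le> (\<Sum>j\<in>J. (cmod (a j))\<^sup>2) / m\<^sup>2"
proof -
  let ?u = "ground_state :: 'a \<Rightarrow> real" and ?A = "\<Sum>j\<in>J. (cmod (a j))\<^sup>2"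
  let ?T = "\<lambda>\<tau>. (cmod (trig_sum J a y \<tau>))\<^sup>2" and ?P = "\<lambda>\<tau>. (cmod (ft_real ?u \<tau>))\<^sup>2"
  let ?c = "(2 * pi) ^ DIM('a)"
  obtain G where G: "H01 (ball 0 (1/2)) ?u G" "(LINT x|lborel. (?u x)\<^sup>2) = 1"
    "\<And>x. x \<notin> ball 0 (1/2) \<Longrightarrow> ?u x = 0" "square_integrable ?u"
    using ground_state_properties[where 'a='a] by metis
  have int: "integrable lborel ?u" by (rule L1_le_L2_on_half_ball(1)[OF G(4,3)])
  have contft: "continuous_on UNIV (ft_real ?u)"
  proof (rule continuous_ft)
    show "integrable lborel (\<lambda>x. complex_of_real (?u x))"
      unfolding complex_of_real_integrable_eq by (rule int)
  qed
  note contT = continuous_trig_sum[OF J]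
  have P: "?c * m\<^sup>2 \<le> ?P \<tau>" if "\<tau> \<in> ball 0 pi" for \<tau>
  proof -
    have "(2 * pi) powr (- (real DIM('a) / 2)) * Re (ft_real ?u \<tau>) \<ge> m"
      using m(2)[of \<tau>] that by (simp add: ground_state_fourier_eq)
    then have "(2 * pi) powr (real DIM('a) / 2) * m
        \<le> (2 * pi) powr (real DIM('a) / 2) * ((2 * pi) powr (- (real DIM('a) / 2)) * Re (ft_real ?u \<tau>))"
      by (intro mult_left_mono) auto
    also have "\<dots> = Re (ft_real ?u \<tau>)" by (simp add: mult.assoc[symmetric] powr_add[symmetric])
    also have "\<dots> \<le> cmod (ft_real ?u \<tau>)" by (rule complex_Re_le_cmod)
    finally have "((2 * pi) powr (real DIM('a) / 2) * m)\<^sup>2 \<le> ?P \<tau>"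
      using m(1) by (intro power_mono) auto
    also have "((2 * pi) powr (real DIM('a) / 2) * m)\<^sup>2 = ?c * m\<^sup>2"
      by (simp add: power_mult_distrib power2_eq_square powr_add[symmetric] powr_realpow)
    finally show ?thesis .
  qed
  have "(LINT \<tau>|lborel. (?c * m\<^sup>2) * (indicator (ball 0 pi) \<tau> * ?T \<tau>))
      \<le> (LINT \<tau>|lborel. indicator (ball 0 pi) \<tau> * (?T \<tau> * ?P \<tau>))"
  proof (rule integral_mono)
    show "integrable lborel (\<lambda>\<tau>. (?c * m\<^sup>2) * (indicator (ball 0 pi) \<tau> * ?T \<tau>))"
      by (intro integrable_mult_right integrable_ball_continuous continuous_intros contT)
    show "integrable lborel (\<lambda>\<tau>. indicator (ball 0 pi) \<tau> * (?T \<tau> * ?P \<tau>))"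
      by (intro integrable_ball_continuous continuous_intros contT contft)
    fix \<tau> :: 'a
    show "(?c * m\<^sup>2) * (indicator (ball 0 pi) \<tau> * ?T \<tau>) \<le> indicator (ball 0 pi) \<tau> * (?T \<tau> * ?P \<tau>)"
    proof (cases "\<tau> \<in> ball 0 pi")
      case True
      then show ?thesis using mult_right_mono[OF P[OF True], of "?T \<tau>"] by (simp add: mult.commute)
    qed simp
  qed
  also have "\<dots> \<le> ?c * (?A * (LINT x|lborel. (?u x)\<^sup>2))"
    by (rule trig_sum_upper_H01[OF J G(1)])
  finally have "?c * (m\<^sup>2 * (LINT \<tau>|lborel. indicator (ball 0 pi) \<tau> * ?T \<tau>)) \<le> ?c * ?A"
    using G(2) by (simp add: mult.assoc)
  then have "m\<^sup>2 * (LINT \<tau>|lborel. indicator (ball 0 pi) \<tau> * ?T \<tau>) \<le> ?A"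
    by (rule mult_left_le_imp_le) simp
  then show ?thesis using m(1) by (simp add: field_simps)
qed

text \<open>
  The choice \<open>c\<^sup>2 = 2 \<lambda>\<close> leaves \<open>c\<^sup>2 \<Vert>u\<Vert>\<^sup>2 - \<Vert>grad u\<Vert>\<^sup>2 = \<lambda>\<close> for the ground state \<open>u\<close>, while its Fourier
  transform has modulus at most 1 and the weight \<open>c\<^sup>2 - |\<tau>|\<^sup>2\<close> is at most \<open>2 \<lambda>\<close>.
\<close>
theorem unit_separated_lower:
  fixes y :: "nat \<Rightarrow> 'a::euclidean_space"
  assumes J: "finite J" "\<And>j k. j \<in> J \<Longrightarrow> k \<in> J \<Longrightarrow> j \<noteq> k \<Longrightarrow> 1 \<le> norm (y j - y k)"
    and c: "c > 0" "c\<^sup>2 = 2 * lambda_min TYPE('a)"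
  shows "(2 * pi) ^ DIM('a) / 2 * (\<Sum>j\<in>J. (cmod (a j))\<^sup>2)
    \<le> (LINT \<tau>|lborel. indicator (ball 0 c) \<tau> * (cmod (trig_sum J a y \<tau>))\<^sup>2)"
proof -
  let ?u = "ground_state :: 'a \<Rightarrow> real" and ?A = "\<Sum>j\<in>J. (cmod (a j))\<^sup>2" and ?l = "lambda_min TYPE('a)"
  let ?T = "\<lambda>\<tau>. (cmod (trig_sum J a y \<tau>))\<^sup>2" and ?P = "\<lambda>\<tau>. (cmod (ft_real ?u \<tau>))\<^sup>2"
  let ?c = "(2 * pi) ^ DIM('a)"
  obtain G where G: "H01 (ball 0 (1/2)) ?u G" "(LINT x|lborel. (?u x)\<^sup>2) = 1"
    "(LINT x|lborel. (norm (G x))\<^sup>2) = ?l"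
    "\<And>x. x \<notin> ball 0 (1/2) \<Longrightarrow> ?u x = 0" "square_integrable ?u"
    using ground_state_properties[where 'a='a] by metis
  have int: "integrable lborel ?u" by (rule L1_le_L2_on_half_ball(1)[OF G(5,4)])
  have contft: "continuous_on UNIV (ft_real ?u)"
  proof (rule continuous_ft)
    show "integrable lborel (\<lambda>x. complex_of_real (?u x))"
      unfolding complex_of_real_integrable_eq by (rule int)
  qed
  note contT = continuous_trig_sum[OF J]
  have P: "?P \<tau> \<le> 1" for \<tau>
  proof -
    have "cmod (ft_real ?u \<tau>) \<le> 1" using norm_ft_le_L2[OF G(5,4), of \<tau>] G(2) by simp
    then show ?thesis by (simp add: power_le_one)
  qed
  have "?c * (?A * (c\<^sup>2 * 1 - ?l))
     \<le> (LINT \<tau>|lborel. indicator (ball 0 c) \<tau> * ((c\<^sup>2 - \<tau> \<bullet> \<tau>) * (?T \<tau> * ?P \<tau>)))"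
    using trig_sum_lower_H01[OF J G(1) c(1), where a=a] unfolding G(2,3) .
  also have "\<dots> \<le> (LINT \<tau>|lborel. c\<^sup>2 * (indicator (ball 0 c) \<tau> * ?T \<tau>))"
  proof (rule integral_mono)
    show "integrable lborel (\<lambda>\<tau>. c\<^sup>2 * (indicator (ball 0 c) \<tau> * ?T \<tau>))"
      by (intro integrable_mult_right integrable_ball_continuous continuous_intros contT)
    show "integrable lborel (\<lambda>\<tau>. indicator (ball 0 c) \<tau> * ((c\<^sup>2 - \<tau> \<bullet> \<tau>) * (?T \<tau> * ?P \<tau>)))"
      by (intro integrable_ball_continuous continuous_intros contT contft)
    fix \<tau> :: 'a
    have "(c\<^sup>2 - \<tau> \<bullet> \<tau>) * (?T \<tau> * ?P \<tau>) \<le> c\<^sup>2 * (?T \<tau> * ?P \<tau>)"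
      by (intro mult_right_mono) auto
    also have "\<dots> \<le> c\<^sup>2 * (?T \<tau> * 1)" by (intro mult_left_mono P) auto
    finally show "indicator (ball 0 c) \<tau> * ((c\<^sup>2 - \<tau> \<bullet> \<tau>) * (?T \<tau> * ?P \<tau>)) \<le> c\<^sup>2 * (indicator (ball 0 c) \<tau> * ?T \<tau>)"
      by (cases "\<tau> \<in> ball 0 c") auto
  qed
  finally have "?l * (?c * ?A) \<le> ?l * (2 * (LINT \<tau>|lborel. indicator (ball 0 c) \<tau> * ?T \<tau>))"
    using c(2) by (simp add: algebra_simps)
  then have "?c * ?A \<le> 2 * (LINT \<tau>|lborel. indicator (ball 0 c) \<tau> * ?T \<tau>)"
    using lambda_min_pos[where 'a='a] by (rule mult_left_le_imp_le)
  then show ?thesis by simp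
qed

section \<open>The constants\<close>

text \<open>
  For a basis vector \<open>e\<close> the function \<open>cos (\<pi> (x \<bullet> e))\<close> is an eigenfunction of the Laplacian that is positive
  on the strip \<open>|x \<bullet> e| < 1/2\<close>, which contains the ball.
\<close>
lemma dirichlet_lower_bound_cosine:
  fixes \<phi> :: "'a::euclidean_space \<Rightarrow> real"
  assumes \<phi>: "test_function (ball 0 (1/2)) \<phi>"
  shows "pi\<^sup>2 * (LINT x|lborel. (\<phi> x)\<^sup>2) \<le> (LINT x|lborel. (norm (grad \<phi> x))\<^sup>2)"
proof -
  obtain e :: 'a where e: "e \<in> Basis" using nonempty_Basis by blast
  let ?u = "\<lambda>x. cos (pi * (x \<bullet> e))" and ?Du = "\<lambda>x. (- pi * sin (pi * (x \<bullet> e))) *\<^sub>R e"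
  let ?D2 = "\<lambda>b x h. - pi\<^sup>2 * cos (pi * (x \<bullet> e)) * (h \<bullet> e) * (e \<bullet> b)"
  show ?thesis
  proof (rule dirichlet_lower_bound[where u="?u" and Du="?Du" and ?D2.0="?D2", OF _ _ _ _ _ _ open_ball \<phi>])
    show "(?u has_derivative (\<lambda>h. ?Du x \<bullet> h)) (at x)" for x
      by (auto intro!: derivative_eq_intros simp: inner_commute)
    show "((\<lambda>x. ?Du x \<bullet> b) has_derivative ?D2 b x) (at x)" for x b
      by (auto intro!: derivative_eq_intros simp: power2_eq_square)
    show "(\<Sum>b\<in>Basis. ?D2 b x b) = - pi\<^sup>2 * ?u x" for x
    proof -
      have "(\<Sum>b\<in>Basis. (b \<bullet> e) * (e \<bullet> b)) = 1"
        using e by (simp add: inner_Basis if_distrib[of "\<lambda>t. t * _"] cong: if_cong)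
      then show ?thesis
        by (simp add: mult.assoc sum_negf sum_distrib_left[symmetric])
    qed
    show "0 < ?u x" if "x \<in> ball 0 (1/2)" for x
    proof -
      have "\<bar>x \<bullet> e\<bar> < 1/2" using Basis_le_norm[OF e, of x] that by simp
      then have "pi * \<bar>x \<bullet> e\<bar> < pi * (1/2)" by (intro mult_strict_left_mono) auto
      then have "\<bar>pi * (x \<bullet> e)\<bar> < pi / 2" by (simp add: abs_mult)
      then have "- (pi / 2) < pi * (x \<bullet> e)" "pi * (x \<bullet> e) < pi / 2" by (simp_all only: abs_less_iff) linarith
      then show ?thesis by (rule cos_gt_zero_pi)
    qed
  qed (intro continuous_intros)+
qed

lemma lambda_min_ge_pi_squared: "pi\<^sup>2 \<le> lambda_min TYPE('a::euclidean_space)"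
proof -
  obtain G where G: "H01 (ball 0 (1/2)) (ground_state :: 'a \<Rightarrow> real) G"
    "(LINT x|lborel. (ground_state (x::'a))\<^sup>2) = 1" "(LINT x|lborel. (norm (G x))\<^sup>2) = lambda_min TYPE('a)"
    using ground_state_properties[where 'a='a] by metis
  show ?thesis using H01_lower_bound[OF dirichlet_lower_bound_cosine G(1)] G(2,3) by simp
qed

text \<open>
  The bound \<open>\<pi> \<le> c\<^sub>0\<close> lets the upper inequality, which needs \<open>R \<ge> \<pi> / q\<close>, cover all \<open>R \<ge> c\<^sub>0 / q\<close>.  The last
  estimate holds because the argument gives the lower inequality with \<open>(2 \<pi>) powr (d / 2)\<close> times \<open>c\<^sub>1\<close>.
\<close>
lemma ingham_constants:
  fixes T :: "'a::euclidean_space itself"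
  shows "ingham_c0 T > 0" "pi \<le> ingham_c0 T" "(ingham_c0 T)\<^sup>2 = 2 * lambda_min T" "ingham_c1 T > 0"
    "ingham_c1 T \<le> (2 * pi) ^ DIM('a) / (2 * ingham_c0 T ^ DIM('a))"
proof -
  have l: "lambda_min T > 0"
    using lambda_min_pos[where 'a='a] by (simp add: lambda_min_def)
  show c0: "ingham_c0 T > 0" using l by (simp add: ingham_c0_def)
  show c0sq: "(ingham_c0 T)\<^sup>2 = 2 * lambda_min T"
    using l by (simp add: ingham_c0_def power_mult_distrib powr_half_sqrt)
  have "pi\<^sup>2 \<le> lambda_min T"
    using lambda_min_ge_pi_squared[where 'a='a] by (simp add: lambda_min_def)
  then have "pi\<^sup>2 \<le> (ingham_c0 T)\<^sup>2" using c0sq l by linarith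
  then show "pi \<le> ingham_c0 T" by (rule power2_le_imp_le) (use c0 in simp)
  show "ingham_c1 T > 0" using l by (simp add: ingham_c1_def)
  let ?d = "real DIM('a) / 2"
  have c0d: "ingham_c0 T ^ DIM('a) = 2 powr ?d * lambda_min T powr ?d"
  proof -
    have "ingham_c0 T = (2 * lambda_min T) powr (1/2)"
      using l by (simp add: ingham_c0_def powr_half_sqrt real_sqrt_mult)
    then have "ingham_c0 T ^ DIM('a) = ((2 * lambda_min T) powr (1/2)) powr real DIM('a)"
      using l by (subst powr_realpow) auto
    also have "\<dots> = (2 * lambda_min T) powr ?d" by (simp add: powr_powr)
    also have "\<dots> = 2 powr ?d * lambda_min T powr ?d" using l by (simp add: powr_mult)
    finally show ?thesis .
  qed
  have "(2 * pi) ^ DIM('a) = (2 * pi) powr ?d * (2 * pi) powr ?d"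
    by (simp add: powr_add[symmetric] powr_realpow)
  also have "\<dots> = (2 * pi) powr ?d * (2 powr ?d * pi powr ?d)" by (simp add: powr_mult)
  finally have eq: "(2 * pi) ^ DIM('a) / (2 * ingham_c0 T ^ DIM('a)) = (2 * pi) powr ?d * ingham_c1 T"
    unfolding c0d ingham_c1_def using l by (simp add: field_simps)
  have "1 \<le> (2 * pi) powr ?d" using pi_gt3 by (intro ge_one_powr_ge_zero) auto
  then have "1 * ingham_c1 T \<le> (2 * pi) powr ?d * ingham_c1 T"
    using \<open>ingham_c1 T > 0\<close> by (intro mult_right_mono) auto
  then show "ingham_c1 T \<le> (2 * pi) ^ DIM('a) / (2 * ingham_c0 T ^ DIM('a))" unfolding eq by simp
qed

lemma ingham_c2_eq:
  fixes T :: "'a::euclidean_space itself"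
  assumes "m = (INF \<omega>\<in>cball (0::'a) pi. ground_state_fourier \<omega>)" "m > 0"
  shows "ingham_beta T > 0" "ingham_c2 T > 0" "ingham_c2 T = 1 / (pi ^ DIM('a) * m\<^sup>2)"
proof -
  let ?d = "real DIM('a) / 2"
  have b: "ingham_beta T = (2 * pi) powr ?d * m\<^sup>2"
    using assms(1) by (simp add: ingham_beta_def)
  then show "ingham_beta T > 0" using assms(2) by simp
  then show "ingham_c2 T > 0" by (simp add: ingham_c2_def)
  have "(2 / pi) powr ?d * pi ^ DIM('a) = (2 / pi) powr ?d * (pi powr ?d * pi powr ?d)"
    by (simp add: powr_add[symmetric] powr_realpow)
  also have "\<dots> = (2 / pi * (pi * pi)) powr ?d" by (simp add: powr_mult[symmetric])
  finally have "(2 / pi) powr ?d * pi ^ DIM('a) = (2 * pi) powr ?d" by simp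
  then show "ingham_c2 T = 1 / (pi ^ DIM('a) * m\<^sup>2)"
    unfolding ingham_c2_def b using assms(2) by (simp add: field_simps)
qed

section \<open>Rescaling to separation one\<close>

theorem theorem3:
  fixes X :: "'a::euclidean_space set" and x :: "nat \<Rightarrow> 'a"
  assumes "finite X" and "card X \<ge> 2" and "bij_betw x {1..card X} X"
  shows "ingham_beta TYPE('a) > 0 \<and> ingham_c1 TYPE('a) > 0 \<and> ingham_c2 TYPE('a) > 0 \<and>
    (\<forall>R x0 \<alpha>. R \<ge> ingham_c0 TYPE('a) / separation_distance X \<longrightarrow>
       ingham_c1 TYPE('a) * R ^ DIM('a) * (L2_set \<alpha> {1..card X})\<^sup>2
         \<le> (LINT \<omega>:ball x0 R|lborel. (cmod (exp_sum (card X) x \<alpha> \<omega>))\<^sup>2) \<and>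
       (LINT \<omega>:ball x0 R|lborel. (cmod (exp_sum (card X) x \<alpha> \<omega>))\<^sup>2)
         \<le> ingham_c2 TYPE('a) * R ^ DIM('a) * (L2_set \<alpha> {1..card X})\<^sup>2) \<and>
    (\<forall>R x0 \<alpha>. R \<ge> pi / separation_distance X \<longrightarrow>
       (LINT \<omega>:ball x0 R|lborel. (cmod (exp_sum (card X) x \<alpha> \<omega>))\<^sup>2)
         \<le> ingham_c2 TYPE('a) * R ^ DIM('a) * (L2_set \<alpha> {1..card X})\<^sup>2)"
proof -
  let ?N = "card X" and ?q = "separation_distance X" and ?d = "DIM('a)"
  let ?c0 = "ingham_c0 TYPE('a)" and ?c1 = "ingham_c1 TYPE('a)" and ?c2 = "ingham_c2 TYPE('a)"
  note q = separation_distance_bounds[OF assms(1,2)]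
  obtain m where m: "m = (INF \<omega>\<in>cball (0::'a) pi. ground_state_fourier \<omega>)" "m > 0"
    "\<And>\<omega>::'a. norm \<omega> \<le> pi \<Longrightarrow> m \<le> ground_state_fourier \<omega>"
    using ground_state_fourier_min[where 'a='a] by blast
  note C1 = ingham_constants[of "TYPE('a)"] and C2 = ingham_c2_eq[OF m(1,2), of "TYPE('a)"]
  let ?a = "\<lambda>x0 \<alpha> j. complex_of_real (\<alpha> j) * wave x0 (- x j)"
  have A: "(\<Sum>j\<in>{1..?N}. (cmod (?a x0 \<alpha> j))\<^sup>2) = (L2_set \<alpha> {1..?N})\<^sup>2" for x0 \<alpha>
    by (simp add: norm_mult L2_set_def sum_nonneg)
  have sep: "1 \<le> norm ((R / \<rho>) *\<^sub>R x j - (R / \<rho>) *\<^sub>R x k)"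
    if R: "R \<ge> \<rho> / ?q" "\<rho> > 0" and jk: "j \<in> {1..?N}" "k \<in> {1..?N}" "j \<noteq> k" for R \<rho> j k
  proof -
    have "x j \<noteq> x k"
      by (rule inj_on_contraD[OF bij_betw_imp_inj_on[OF assms(3)] jk(3,1,2)])
    moreover have "x j \<in> X" "x k \<in> X"
      by (rule bij_betwE[OF assms(3), rule_format, OF jk(1)], rule bij_betwE[OF assms(3), rule_format, OF jk(2)])
    ultimately have qle: "?q \<le> norm (x j - x k)" using q(2) by blast
    have "1 / ?q \<le> R / \<rho>" using R q(1) by (simp add: field_simps)
    then have "(1 / ?q) * ?q \<le> (R / \<rho>) * norm (x j - x k)"
      using qle q(1) by (intro mult_mono) (auto intro: order_trans[of _ "1 / ?q"])
    moreover have "0 \<le> R / \<rho>" using \<open>1 / ?q \<le> R / \<rho>\<close> q(1) by (auto intro: order_trans[of _ "1 / ?q"])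
    moreover from this have "norm ((R / \<rho>) *\<^sub>R x j - (R / \<rho>) *\<^sub>R x k) = (R / \<rho>) * norm (x j - x k)"
      by (simp only: scaleR_diff_right[symmetric] norm_scaleR abs_of_nonneg)
    ultimately show ?thesis using q(1) by simp
  qed
  have Rpos: "R > 0" if "R \<ge> \<rho> / ?q" "\<rho> > 0" for R \<rho>
    using that q(1) by (meson divide_pos_pos less_le_trans)
  have upper: "(LINT \<omega>:ball x0 R|lborel. (cmod (exp_sum ?N x \<alpha> \<omega>))\<^sup>2) \<le> ?c2 * R ^ ?d * (L2_set \<alpha> {1..?N})\<^sup>2"
    if R: "R \<ge> pi / ?q" for R x0 \<alpha>
  proof -
    note R0 = Rpos[OF R pi_gt_zero]
    have "(LINT \<omega>:ball x0 R|lborel. (cmod (exp_sum ?N x \<alpha> \<omega>))\<^sup>2) = (R / pi) ^ ?d *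
        (LINT \<tau>|lborel. indicator (ball 0 pi) \<tau> *
          (cmod (trig_sum {1..?N} (?a x0 \<alpha>) (\<lambda>j. (R / pi) *\<^sub>R x j) \<tau>))\<^sup>2)"
      by (rule exp_sum_ball_rescale[OF R0 pi_gt_zero])
    also have "\<dots> \<le> (R / pi) ^ ?d * ((\<Sum>j\<in>{1..?N}. (cmod (?a x0 \<alpha> j))\<^sup>2) / m\<^sup>2)"
      using R0 by (intro mult_left_mono unit_separated_upper sep[OF R] m(2,3)) auto
    also have "\<dots> = ?c2 * R ^ ?d * (L2_set \<alpha> {1..?N})\<^sup>2"
      unfolding A C2(3) by (simp add: power_divide)
    finally show ?thesis .
  qed
  have lower: "?c1 * R ^ ?d * (L2_set \<alpha> {1..?N})\<^sup>2 \<le> (LINT \<omega>:ball x0 R|lborel. (cmod (exp_sum ?N x \<alpha> \<omega>))\<^sup>2)"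
    if R: "R \<ge> ?c0 / ?q" for R x0 \<alpha>
  proof -
    note R0 = Rpos[OF R C1(1)]
    have "?c1 * (R ^ ?d * (L2_set \<alpha> {1..?N})\<^sup>2)
        \<le> (2 * pi) ^ ?d / (2 * ?c0 ^ ?d) * (R ^ ?d * (L2_set \<alpha> {1..?N})\<^sup>2)"
      using R0 C1(5) by (intro mult_right_mono) auto
    also have "\<dots> = (R / ?c0) ^ ?d * ((2 * pi) ^ ?d / 2 * (\<Sum>j\<in>{1..?N}. (cmod (?a x0 \<alpha> j))\<^sup>2))"
      unfolding A by (simp add: power_divide mult_ac)
    also have "\<dots> \<le> (R / ?c0) ^ ?d * (LINT \<tau>|lborel. indicator (ball 0 ?c0) \<tau> *
          (cmod (trig_sum {1..?N} (?a x0 \<alpha>) (\<lambda>j. (R / ?c0) *\<^sub>R x j) \<tau>))\<^sup>2)"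
      using R0 C1(1) by (intro mult_left_mono unit_separated_lower sep[OF R] C1(3)) auto
    also have "\<dots> = (LINT \<omega>:ball x0 R|lborel. (cmod (exp_sum ?N x \<alpha> \<omega>))\<^sup>2)"
      by (rule exp_sum_ball_rescale[OF R0 C1(1), symmetric])
    finally show ?thesis by (simp add: mult.assoc)
  qed
  \<comment> \<open>Here \<open>\<pi> \<le> c\<^sub>0\<close> enters.\<close>
  have "R \<ge> pi / ?q" if "R \<ge> ?c0 / ?q" for R
    using that C1(2) q(1) by (meson divide_right_mono less_imp_le order_trans)
  then show ?thesis using C1(4) C2(1,2) upper lower by blast
qed

end
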